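(* Let $\mu$ be an arbitrary probability measure on $\mathbb{R}^d$. Let $W_1,W_2,\ldots$ be iid centered Gaussian random fields on $\mathbb{R}^d$ with stationary increments, variance function $\sigma^2$ and variogram $\gamma$, and let $$\eta(t)=\sup_{i\ge 1}\big(V_i'+W_i(t)-\sigma^2(t)/2\big),\qquad t\in\mathbb{R}^d,$$ where $(V_i')_{i\ge1}$ are the points of a Poisson process on $\mathbb{R}$ with intensity measure $e^{-x}\,dx$, independent of $(W_i)_{i\ge 1}$. Let $Z_1,Z_2,\ldots$ be iid Gaussian random fields on $\mathbb{R}^d$ with stationary increments, mean function $-\gamma$, variance function $2\gamma$, variogram $\gamma$, and vanishing at the origin (in the sense fixed in the context). Let $\big((T_i,V_i)\big)_{i\ge1}$ be the points of a Poisson process on $\mathbb{R}^d\times\mathbb{R}$ with intensity measure $\mu(dt)\times e^{-v}\,dv$, independent of $(Z_i)_{i\ge1}$, and define $$\zeta(t)=\sup_{i\ge 1}\Big(V_i+Z_i(t-T_i)-\log\Big(\int_{\mathbb{R}^d}\exp\big(Z_i(s-T_i)\big)\,\mu(ds)\Big)\Big),\qquad t\in\mathbb{R}^d.$$ Then the random fields $(\eta(t))_{t\in\mathbb{R}^d}$ and $(\zeta(t))_{t\in\mathbb{R}^d}$ have the same distribution.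
   Context: All random fields are real-valued and indexed by $\mathbb{R}^d$. Let $W$ denote a generic copy of the $W_i$. The variance function is $\sigma^2(t)=\mathrm{Var}(W(t))$, and the variogram is $\gamma(t)=\frac12\,\mathbb{E}\big[(W(t)-W(0))^2\big]$, $t\in\mathbb{R}^d$. The field $W$ is centered Gaussian with stationary increments; it is not assumed that $W(0)=0$, and it is not assumed that $\sigma^2/2=\gamma$. A generic copy $Z$ of the $Z_i$ is a Gaussian random field with $Z(0)=0$, $\mathbb{E}Z(t)=-\gamma(t)$, $\mathrm{Var}(Z(t))=2\gamma(t)$, whose centered version $Z+\gamma$ has stationary increments and variogram $\gamma$; equivalently, $(Z(t))_{t\in\mathbb{R}^d}$ has the same law as $(W(t)-W(0)-\gamma(t))_{t\in\mathbb{R}^d}$. The fields are taken to be jointly measurable in $(\omega,t)$, so that the integrals with respect to $\mu$ and the evaluations at the random points $T_i$ are well defined. Equality in distribution of random fields means equality of all finite-dimensional distributions.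
   Formalization: Independence of the points (T_i,V_i) from the Z_i is taken in a stronger sense: they are independent of a sigma-algebra making all Z_i jointly measurable in (ω,t); with independence of the field values alone the claim fails for atomless μ. *)

theory Defs
  imports "HOL-Probability.Probability"
begin

text \<open>
  A random field on a probability space M is a function of the index t and the sample point w,
  in this order.
\<close>

definition measurable_field ::
  "'w measure \<Rightarrow> ('t::topological_space \<Rightarrow> 'w \<Rightarrow> real) \<Rightarrow> bool" where
  "measurable_field M X \<longleftrightarrow> (\<lambda>(w, t). X t w) \<in> borel_measurable (M \<Otimes>\<^sub>M borel)"

definition mean_fun :: "'w measure \<Rightarrow> ('t \<Rightarrow> 'w \<Rightarrow> real) \<Rightarrow> 't \<Rightarrow> real" where
  "mean_fun M X t = (\<integral>w. X t w \<partial>M)"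

definition variance_fun :: "'w measure \<Rightarrow> ('t \<Rightarrow> 'w \<Rightarrow> real) \<Rightarrow> 't \<Rightarrow> real" where
  "variance_fun M X t = (\<integral>w. (X t w - mean_fun M X t)\<^sup>2 \<partial>M)"

definition variogram :: "'w measure \<Rightarrow> ('t::zero \<Rightarrow> 'w \<Rightarrow> real) \<Rightarrow> 't \<Rightarrow> real" where
  "variogram M X t = (\<integral>w. (X t w - X 0 w)\<^sup>2 \<partial>M) / 2"

text \<open>
  Equality of all finite-dimensional distributions; the two fields may live on different
  probability spaces and may take values in the extended reals.
\<close>

definition same_fdd ::
  "'v measure \<Rightarrow> ('t \<Rightarrow> 'v \<Rightarrow> 'c::topological_space) \<Rightarrow>
   'w measure \<Rightarrow> ('t \<Rightarrow> 'w \<Rightarrow> 'c) \<Rightarrow> bool" where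
  "same_fdd M X N Y \<longleftrightarrow>
     (\<forall>S. finite S \<longrightarrow>
        distr M (\<Pi>\<^sub>M t\<in>S. borel) (\<lambda>w. \<lambda>t\<in>S. X t w) =
        distr N (\<Pi>\<^sub>M t\<in>S. borel) (\<lambda>w. \<lambda>t\<in>S. Y t w))"

definition stationary_increments ::
  "'w measure \<Rightarrow> ('t::ab_group_add \<Rightarrow> 'w \<Rightarrow> real) \<Rightarrow> bool" where
  "stationary_increments M X \<longleftrightarrow>
     (\<forall>h. same_fdd M (\<lambda>t w. X (t + h) w - X h w) M (\<lambda>t w. X t w - X 0 w))"

text \<open>Point masses count as (degenerate) Gaussian distributions.\<close>

definition gaussian_rv :: "'w measure \<Rightarrow> ('w \<Rightarrow> real) \<Rightarrow> bool" where
  "gaussian_rv M Y \<longleftrightarrow> Y \<in> borel_measurable M \<and>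
     ((\<exists>m. distr M borel Y = return borel m) \<or>
      (\<exists>m s. s > 0 \<and> distr M borel Y = density lborel (\<lambda>x. ennreal (normal_density m s x))))"

definition gaussian_field :: "'w measure \<Rightarrow> ('t \<Rightarrow> 'w \<Rightarrow> real) \<Rightarrow> bool" where
  "gaussian_field M X \<longleftrightarrow>
     (\<forall>S c. finite S \<longrightarrow> gaussian_rv M (\<lambda>w. \<Sum>t\<in>S. c t * X t w))"

definition iid_fields :: "'w measure \<Rightarrow> (nat \<Rightarrow> 't \<Rightarrow> 'w \<Rightarrow> real) \<Rightarrow> bool" where
  "iid_fields M X \<longleftrightarrow>
     prob_space.indep_vars M (\<lambda>_. \<Pi>\<^sub>M t\<in>UNIV. borel) (\<lambda>i w t. X i t w) UNIV \<and>
     (\<forall>i j. same_fdd M (X i) M (X j))"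

text \<open>
  Independence of random elements in two spaces of possibly different types (the library's
  \<open>indep_var\<close> requires the types to agree).
\<close>

definition indep_elements ::
  "'w measure \<Rightarrow> 'a measure \<Rightarrow> ('w \<Rightarrow> 'a) \<Rightarrow> 'b measure \<Rightarrow> ('w \<Rightarrow> 'b) \<Rightarrow> bool" where
  "indep_elements M A X B Y \<longleftrightarrow>
     X \<in> measurable M A \<and> Y \<in> measurable M B \<and>
     prob_space.indep_set M (sets (vimage_algebra (space M) X A)) (sets (vimage_algebra (space M) Y B))"

text \<open>
  Independence of a random element Y from a sequence of jointly measurable fields.  When the
  fields are evaluated at points depending on Y, independence of Y from the product sigma-algebra
  of the fields is not enough: a field equal to 1 at t = T(w) and to 0 elsewhere, with T
  atomless, is indistinguishable from 0 through its finite-dimensional distributions and is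
  independent of T in that sense.  The sigma-algebra F that is independent of Y is therefore
  required to make the fields jointly measurable in (w, t).  For fields with continuous paths, F
  can be taken to be the sigma-algebra generated by the field values.
\<close>

definition indep_of_measurable_fields ::
  "'w measure \<Rightarrow> 'a measure \<Rightarrow> ('w \<Rightarrow> 'a) \<Rightarrow> (nat \<Rightarrow> 't::topological_space \<Rightarrow> 'w \<Rightarrow> real) \<Rightarrow> bool" where
  "indep_of_measurable_fields M A Y X \<longleftrightarrow>
     (\<exists>F. subalgebra M F \<and> (\<forall>i. measurable_field F (X i)) \<and> indep_elements M A Y F (\<lambda>w. w))"

text \<open>Number of points in B, with multiplicity.\<close>

definition point_count :: "(nat \<Rightarrow> 'w \<Rightarrow> 'x) \<Rightarrow> 'x set \<Rightarrow> 'w \<Rightarrow> ennreal" where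
  "point_count X B w = emeasure (count_space UNIV) {i. X i w \<in> B}"

text \<open>
  The sequence X enumerates (in an arbitrary measurable way) the points of a Poisson process with
  intensity measure \<open>\<nu>\<close>.  The Poisson weights are written out since the library's
  \<open>poisson_pmf\<close> excludes the rate 0.
\<close>

definition poisson_points :: "'w measure \<Rightarrow> 'x measure \<Rightarrow> (nat \<Rightarrow> 'w \<Rightarrow> 'x) \<Rightarrow> bool" where
  "poisson_points M \<nu> X \<longleftrightarrow>
     (\<forall>i. X i \<in> measurable M \<nu>) \<and>
     (\<forall>B\<in>sets \<nu>. emeasure \<nu> B < \<infinity> \<longrightarrow>
        (\<forall>k::nat. measure M {w \<in> space M. point_count X B w = of_nat k} =
           measure \<nu> B ^ k / fact k * exp (- measure \<nu> B))) \<and>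
     (\<forall>B\<in>sets \<nu>. emeasure \<nu> B = \<infinity> \<longrightarrow> (AE w in M. point_count X B w = \<infinity>)) \<and>
     (\<forall>(J::nat set) B. finite J \<longrightarrow> (\<forall>j\<in>J. B j \<in> sets \<nu>) \<longrightarrow> disjoint_family_on B J \<longrightarrow>
        prob_space.indep_vars M (\<lambda>_. borel) (\<lambda>j. point_count X (B j)) J)"

definition exp_intensity :: "real measure" where
  "exp_intensity = density lborel (\<lambda>x. ennreal (exp (- x)))"

end

theory Submission
  imports Defs
begin

text \<open>
  For a finite set \<open>S\<close> and levels \<open>y\<close>, the event that \<open>\<eta> \<le> y\<close> on \<open>S\<close> says that no index
  \<open>i\<close> has a function \<open>V'\<^sub>i + W\<^sub>i - \<sigma>\<^sup>2/2\<close> exceeding \<open>y\<close> somewhere on \<open>S\<close>, and similarly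
  for \<open>\<zeta>\<close>.  The functions \<open>W\<^sub>i\<close> are independent marks of Poisson points, so this has
  probability \<open>exp\<close> of minus the expected number of exceeding points
  (\<open>poisson_iid_void_probability\<close>).  Let \<open>H(x)\<close> be the mass that \<open>e\<^sup>-\<^sup>v dv\<close> gives to the
  levels \<open>v\<close> for which \<open>v + x\<close> exceeds \<open>y\<close> somewhere on \<open>S\<close> (\<open>exceedance\<close>); it satisfies
  \<open>H(x + c) = e\<^sup>c H(x)\<close>.  With \<open>X = W - \<sigma>\<^sup>2/2\<close> the two exponents are

    \<open>E H(X)\<close>  and  \<open>\<integral> \<mu>(dt) E [H(Z(\<cdot> - t)) / \<integral> exp (Z(s - t)) \<mu>(ds)]\<close>.

  They agree for the following reason.  Put \<open>J(x) = \<integral> exp (x(s)) \<mu>(ds)\<close>.  Multiplying and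
  dividing by \<open>J(X)\<close> gives \<open>E H(X) = \<integral> \<mu>(dt) E [exp (X(t)) H(X) / J(X)]\<close>.  Here
  \<open>E exp (X(t)) = 1\<close>, so \<open>exp (X(t))\<close> is the density of a probability measure \<open>Q\<^sub>t\<close>; and \<open>H\<close>
  and \<open>J\<close> are homogeneous in the same way, so that \<open>X\<close> may be replaced by \<open>X - X(t)\<close> in the
  ratio.  By the Cameron-Martin formula \<open>X - X(t)\<close> has under \<open>Q\<^sub>t\<close> the law of \<open>Z(\<cdot> - t)\<close>
  (\<open>tilted_increments\<close>): both are Gaussian, with mean \<open>-\<gamma>(\<cdot> - t)\<close> and the variogram \<open>\<gamma>\<close>.
  This is \<open>change_of_measure_at_random_point\<close>.

  Three facts support this computation.  First, linear combinations determine a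
  finite-dimensional law (\<open>Cramer_Wold\<close>); the proof moves one coordinate at a time out of the
  characteristic function, by the one-dimensional uniqueness theorem of Levy applied to
  measures with trigonometric densities.  Second, the fields are only jointly measurable, so
  that \<open>J(X)\<close> need not be determined by countably many coordinates.  Nevertheless it is almost
  surely equal to a product-measurable functional of the path, and the functional depends on the law of
  the field alone (\<open>average_functional\<close>); hence equality of finite-dimensional distributions
  and independence of the fields extend to these integrals.  Third, a Poisson process given by
  its counts in disjoint sets satisfies \<open>E \<Prod>\<^sub>i (1 - u(X\<^sub>i)) = exp (- \<integral> u d\<nu>)\<close> for
  integrable \<open>u\<close> with values in \<open>[0, 1]\<close> (\<open>poisson_thinning\<close>).
\<close>

section \<open>Laws determined by finite-dimensional data\<close>

text \<open>
  Cylinders over finite index sets generate the product sigma-algebra and are stable under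
  intersection.
\<close>

lemma law_eq_of_same_fdd:
  fixes X :: "'t \<Rightarrow> 'v \<Rightarrow> 'c::topological_space" and Y :: "'t \<Rightarrow> 'w \<Rightarrow> 'c"
  assumes "prob_space M"
    and [measurable]: "\<And>t. X t \<in> borel_measurable M" "\<And>t. Y t \<in> borel_measurable N"
    and fdd: "same_fdd M X N Y"
  shows "distr M (\<Pi>\<^sub>M t\<in>UNIV. borel) (\<lambda>w t. X t w) = distr N (\<Pi>\<^sub>M t\<in>UNIV. borel) (\<lambda>w t. Y t w)"
proof (rule measure_eqI_PiM_infinite)
  interpret prob_space M by fact
  have X[measurable]: "(\<lambda>w t. X t w) \<in> measurable M (\<Pi>\<^sub>M t\<in>UNIV. borel)"
    and Y[measurable]: "(\<lambda>w t. Y t w) \<in> measurable N (\<Pi>\<^sub>M t\<in>UNIV. borel)"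
    by (auto intro!: measurable_PiM_single')
  fix A :: "'t \<Rightarrow> 'c set" and J :: "'t set"
  assume J: "finite J" and A: "\<And>i. i \<in> J \<Longrightarrow> A i \<in> sets borel"
  have XJ: "(\<lambda>w. \<lambda>t\<in>J. X t w) \<in> measurable M (\<Pi>\<^sub>M t\<in>J. borel)"
    and YJ: "(\<lambda>w. \<lambda>t\<in>J. Y t w) \<in> measurable N (\<Pi>\<^sub>M t\<in>J. borel)"
    by (auto intro!: measurable_restrict)
  have sA: "Pi\<^sub>E J A \<in> sets (\<Pi>\<^sub>M t\<in>J. borel)"
    using J A by (intro sets_PiM_I_finite) auto
  have eA: "prod_emb UNIV (\<lambda>_. borel) J (Pi\<^sub>E J A) \<in> sets (\<Pi>\<^sub>M t\<in>(UNIV::'t set). borel)"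
    using J A by (intro sets_PiM_I) auto
  have "emeasure (distr M (\<Pi>\<^sub>M t\<in>UNIV. borel) (\<lambda>w t. X t w)) (prod_emb UNIV (\<lambda>_. borel) J (Pi\<^sub>E J A))
     = emeasure (distr M (\<Pi>\<^sub>M t\<in>J. borel) (\<lambda>w. \<lambda>t\<in>J. X t w)) (Pi\<^sub>E J A)"
    using eA sA XJ by (auto simp: emeasure_distr prod_emb_def intro!: arg_cong[where f="emeasure M"])
  also have "\<dots> = emeasure (distr N (\<Pi>\<^sub>M t\<in>J. borel) (\<lambda>w. \<lambda>t\<in>J. Y t w)) (Pi\<^sub>E J A)"
    using fdd J unfolding same_fdd_def by simp
  also have "\<dots> = emeasure (distr N (\<Pi>\<^sub>M t\<in>UNIV. borel) (\<lambda>w t. Y t w)) (prod_emb UNIV (\<lambda>_. borel) J (Pi\<^sub>E J A))"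
    using eA sA YJ by (auto simp: emeasure_distr prod_emb_def intro!: arg_cong[where f="emeasure N"])
  finally show "emeasure (distr M (\<Pi>\<^sub>M t\<in>UNIV. borel) (\<lambda>w t. X t w)) (prod_emb UNIV (\<lambda>_. borel) J (Pi\<^sub>E J A)) =
     emeasure (distr N (\<Pi>\<^sub>M t\<in>UNIV. borel) (\<lambda>w t. Y t w)) (prod_emb UNIV (\<lambda>_. borel) J (Pi\<^sub>E J A))" .
next
  interpret prob_space M by fact
  show "finite_measure (distr M (\<Pi>\<^sub>M t\<in>UNIV. borel) (\<lambda>w t. X t w))"
    by (intro finite_measure_distr measurable_PiM_single') auto
qed simp_all

lemma emeasure_distr_density_divide:
  fixes U h :: "'v \<Rightarrow> real"
  assumes [measurable]: "U \<in> borel_measurable M" "h \<in> borel_measurable M" "A \<in> sets borel"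
    and "c > 0" "\<And>w. 0 \<le> h w"
  shows "emeasure (distr (density M h) borel U) A =
    ennreal c * emeasure (distr (density M (\<lambda>w. h w / c)) borel U) A"
proof -
  have "emeasure (density M h) (U -` A \<inter> space M) =
      (\<integral>\<^sup>+w. ennreal c * (ennreal (h w / c) * indicator (U -` A \<inter> space M) w) \<partial>M)"
    using assms by (auto simp: emeasure_density ennreal_mult[symmetric] mult.assoc[symmetric] intro!: nn_integral_cong)
  then show ?thesis
    by (simp add: emeasure_distr emeasure_density nn_integral_cmult)
qed

text \<open>
  Levy's uniqueness theorem for finite measures: both measures have the same total mass (take
  \<open>s = 0\<close>), and after normalisation the theorem for probability measures applies.  The weights
  \<open>h\<close> and \<open>h'\<close> later carry information on further random variables.
\<close>

lemma weighted_Levy_uniqueness: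
  fixes U h :: "'v \<Rightarrow> real" and U' h' :: "'w \<Rightarrow> real"
  assumes "prob_space M" "prob_space N"
    and [measurable]: "U \<in> borel_measurable M" "U' \<in> borel_measurable N"
    and ih: "integrable M h" "integrable N h'"
    and h: "\<And>w. 0 \<le> h w" "\<And>w. 0 \<le> h' w"
    and eq: "\<And>s. (CLINT w|M. h w * iexp (s * U w)) = (CLINT w|N. h' w * iexp (s * U' w))"
  shows "distr (density M h) borel U = distr (density N h') borel U'"
proof -
  interpret M: prob_space M by fact
  interpret N: prob_space N by fact
  note [measurable] = ih[THEN borel_measurable_integrable]
  define c where "c = (\<integral>w. h w \<partial>M)"
  have c': "c = (\<integral>w. h' w \<partial>N)"
    using eq[of 0] by (simp add: c_def)
  have c0: "c \<ge> 0" by (simp add: c_def h)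
  show ?thesis
  proof (cases "c = 0")
    case True
    have "AE w in M. h w = 0"
      using True ih h by (auto simp: c_def integral_nonneg_eq_0_iff_AE)
    moreover have "AE w in N. h' w = 0"
      using True ih h by (auto simp: c' integral_nonneg_eq_0_iff_AE)
    ultimately have z: "emeasure (density M h) A = 0" "emeasure (density N h') B = 0"
      if "A \<in> sets M" "B \<in> sets N" for A B
      using that by (auto simp: emeasure_density nn_integral_0_iff_AE elim!: eventually_mono)
    show ?thesis
      by (rule measure_eqI) (auto simp: emeasure_distr intro!: trans[OF z(1) z(2)[symmetric]])
  next
    case False
    then have c: "c > 0" using c0 by simp
    have ps: "prob_space (density M (\<lambda>w. h w / c))"
    proof (rule prob_spaceI)
      have "(\<integral>\<^sup>+w. ennreal (h w / c) \<partial>M) = ennreal (\<integral>w. h w / c \<partial>M)"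
        using ih h c by (intro nn_integral_eq_integral) auto
      then show "emeasure (density M (\<lambda>w. h w / c)) (space (density M (\<lambda>w. h w / c))) = 1"
        using c by (simp add: emeasure_density c_def[symmetric] cong: nn_integral_cong_simp)
    qed
    have ps': "prob_space (density N (\<lambda>w. h' w / c))"
    proof (rule prob_spaceI)
      have "(\<integral>\<^sup>+w. ennreal (h' w / c) \<partial>N) = ennreal (\<integral>w. h' w / c \<partial>N)"
        using ih h c by (intro nn_integral_eq_integral) auto
      then show "emeasure (density N (\<lambda>w. h' w / c)) (space (density N (\<lambda>w. h' w / c))) = 1"
        using c by (simp add: emeasure_density c'[symmetric] cong: nn_integral_cong_simp)
    qed
    have m1: "U \<in> borel_measurable (density M (\<lambda>w. h w / c))" by simp
    have m2: "U' \<in> borel_measurable (density N (\<lambda>w. h' w / c))" by simp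
    interpret D1: real_distribution "distr (density M (\<lambda>w. h w / c)) borel U"
      by (rule prob_space.real_distribution_distr[OF ps m1])
    interpret D2: real_distribution "distr (density N (\<lambda>w. h' w / c)) borel U'"
      by (rule prob_space.real_distribution_distr[OF ps' m2])
    have *: "distr (density M (\<lambda>w. h w / c)) borel U = distr (density N (\<lambda>w. h' w / c)) borel U'"
    proof (rule Levy_uniqueness)
      show "char (distr (density M (\<lambda>w. h w / c)) borel U) = char (distr (density N (\<lambda>w. h' w / c)) borel U')"
      proof
        fix s
        have "char (distr (density M (\<lambda>w. h w / c)) borel U) s = (CLINT w|M. (h w * iexp (s * U w)) / c)"
          unfolding char_def using h c
          by (subst integral_distr) (auto simp: integral_density scaleR_conv_of_real intro!: Bochner_Integration.integral_cong)
        also have "\<dots> = (CLINT w|N. (h' w * iexp (s * U' w)) / c)"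
          using eq[of s] by simp
        also have "\<dots> = char (distr (density N (\<lambda>w. h' w / c)) borel U') s"
          unfolding char_def using h c
          by (subst integral_distr) (auto simp: integral_density scaleR_conv_of_real intro!: Bochner_Integration.integral_cong)
        finally show "char (distr (density M (\<lambda>w. h w / c)) borel U) s = char (distr (density N (\<lambda>w. h' w / c)) borel U') s" .
      qed
    qed unfold_locales
    show ?thesis
      by (rule measure_eqI) (simp_all add: emeasure_distr_density_divide[OF _ _ _ c] h *)
  qed
qed

text \<open>
  A weight \<open>1 + cos (\<theta> + r)\<close> is nonnegative, and multiplying by it only shifts frequencies.
  So characteristic functions of several variables control the measures with such densities, and
  as \<open>\<theta>\<close> varies these recover the complex density \<open>iexp r\<close>.
\<close>

lemma iexp_cos_weight:
  fixes k \<theta> r u :: real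
  shows "complex_of_real (k * (1 + cos (\<theta> + r))) * iexp u =
    k * iexp (u + 0 * r) + (iexp \<theta> / 2) * (k * iexp (u + 1 * r)) + (iexp (- \<theta>) / 2) * (k * iexp (u + (-1) * r))"
proof -
  have c: "complex_of_real (cos a) = (iexp a + iexp (- a)) / 2" for a
    by (simp add: cos_of_real[symmetric] cos_exp_eq)
  have e: "iexp (a + b) = iexp a * iexp b" for a b
    by (simp add: exp_add[symmetric] distrib_left)
  have m: "- (\<theta> + r) = - \<theta> + (-1) * r" by simp
  have "complex_of_real (cos (\<theta> + r)) = (iexp \<theta> * iexp (1 * r) + iexp (- \<theta>) * iexp ((-1) * r)) / 2"
    unfolding c m e by simp
  moreover have "iexp (0 * r) = 1" by simp
  moreover have "i * (1 + C) * z = i * (z * 1) + a / 2 * (i * (z * p)) + b / 2 * (i * (z * q))"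
    if "C = (a * p + b * q) / 2" for C a b i p q z :: complex
    unfolding that by (simp add: distrib_left distrib_right add_divide_distrib mult_ac)
  ultimately show ?thesis
    unfolding of_real_mult[of k] of_real_add[of 1] e of_real_1 by metis
qed

lemma iexp_eq_cos_shift: "iexp r = of_real (cos (0 + r)) + \<i> * of_real (cos (- (pi/2) + r))"
proof -
  have "cos (- (pi/2) + r) = sin r" by (simp add: cos_diff)
  then show ?thesis by (simp add: exp_Euler sin_of_real[symmetric] cos_of_real[symmetric] algebra_simps)
qed

text \<open>
  By induction on \<open>E\<close>, the expectation of a product of indicators of the coordinates in \<open>E\<close> and
  a character of the remaining coordinates is the same under \<open>P\<close> and \<open>Q\<close>.  To move a coordinate
  \<open>e\<close> into \<open>E\<close>, the other factors are turned into a nonnegative density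
  \<open>I * (1 + cos (\<theta> + R))\<close>, and the one-dimensional uniqueness theorem is applied to the
  distribution of that coordinate.  For \<open>E = S\<close> only indicators remain.
\<close>

lemma Cramer_Wold:
  fixes P Q :: "('t \<Rightarrow> real) measure"
  assumes "prob_space P" "prob_space Q" and S: "finite S"
    and sets: "sets P = sets (\<Pi>\<^sub>M t\<in>S. borel)" "sets Q = sets (\<Pi>\<^sub>M t\<in>S. borel)"
    and eq: "\<And>c. (CLINT x|P. iexp (\<Sum>t\<in>S. c t * x t)) = (CLINT x|Q. iexp (\<Sum>t\<in>S. c t * x t))"
  shows "P = Q"
proof -
  interpret P: prob_space P by fact
  interpret Q: prob_space Q by fact
  have co[measurable]: "(\<lambda>x. x t) \<in> borel_measurable P" "(\<lambda>x. x t) \<in> borel_measurable Q" if "t \<in> S" for t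
    using that by (simp_all add: measurable_cong_sets[OF sets(1) refl] measurable_cong_sets[OF sets(2) refl])
  have main: "(CLINT x|P. (\<Prod>t\<in>E. indicator (A t) (x t)) * iexp (\<Sum>t\<in>S-E. c t * x t)) =
        (CLINT x|Q. (\<Prod>t\<in>E. indicator (A t) (x t)) * iexp (\<Sum>t\<in>S-E. c t * x t))"
    if "E \<subseteq> S" "\<And>t. t \<in> E \<Longrightarrow> A t \<in> sets borel" for E c and A :: "'t \<Rightarrow> real set"
    using finite_subset[OF that(1) S] that
  proof (induction E arbitrary: c rule: finite_induct)
    case empty
    then show ?case using eq by simp
  next
    case (insert e E)
    define I where "I x = (\<Prod>t\<in>E. indicator (A t) (x t) :: real)" for x :: "'t \<Rightarrow> real"
    define R where "R c x = (\<Sum>t\<in>S-insert e E. c t * x t)" for c :: "'t \<Rightarrow> real" and x :: "'t \<Rightarrow> real"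
    have e: "e \<in> S" "A e \<in> sets borel" using insert by auto
    have Im[measurable]: "I \<in> borel_measurable P" "I \<in> borel_measurable Q"
      using insert.prems unfolding I_def by (auto intro!: borel_measurable_prod measurable_compose[OF co(1)] measurable_compose[OF co(2)] borel_measurable_indicator)
    have Rm[measurable]: "R c \<in> borel_measurable P" "R c \<in> borel_measurable Q" for c
      unfolding R_def by (auto intro!: borel_measurable_sum borel_measurable_times co)
    have I01: "0 \<le> I x" "I x \<le> 1" for x
      unfolding I_def by (auto intro!: prod_nonneg prod_le_1 split: split_indicator)
    have ic: "complex_of_real (I x) = (\<Prod>t\<in>E. indicator (A t) (x t))" for x
      by (simp add: I_def of_real_indicator cong: prod.cong)
    have IH: "(CLINT x|P. I x * iexp (s * x e + R c x)) = (CLINT x|Q. I x * iexp (s * x e + R c x))" for s c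
    proof -
      have sum: "(\<Sum>t\<in>S-E. (c(e:=s)) t * x t) = s * x e + R c x" for x
      proof -
        have "S - E = insert e (S - insert e E)" using e insert by auto
        then have "(\<Sum>t\<in>S-E. (c(e:=s)) t * x t) = (c(e:=s)) e * x e + (\<Sum>t\<in>S - insert e E. (c(e:=s)) t * x t)"
          using S by (simp only: sum.insert finite_Diff Diff_iff insertI1 simp_thms)
        also have "(\<Sum>t\<in>S - insert e E. (c(e:=s)) t * x t) = R c x"
          unfolding R_def by (intro sum.cong) auto
        finally show ?thesis by (simp only: fun_upd_same)
      qed
      have "E \<subseteq> S" "\<And>t. t \<in> E \<Longrightarrow> A t \<in> sets borel" using insert.prems by auto
      from insert.IH[OF this, of "c(e:=s)"] show ?thesis
        by (simp only: ic sum)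
    qed
    have iP: "integrable P (\<lambda>x. I x * iexp (s * x e + r * R c x))" for r s c
      using e I01 by (intro P.integrable_const_bound[where B=1]) (auto simp: norm_mult abs_of_nonneg)
    have iQ: "integrable Q (\<lambda>x. I x * iexp (s * x e + r * R c x))" for r s c
      using e I01 by (intro Q.integrable_const_bound[where B=1]) (auto simp: norm_mult abs_of_nonneg)
    have IHr: "(CLINT x|P. I x * iexp (s * x e + r * R c x)) = (CLINT x|Q. I x * iexp (s * x e + r * R c x))" for s c r
      using IH[of s "\<lambda>t. r * c t"] by (simp add: R_def sum_distrib_left mult.assoc)
    \<comment> \<open>The weight carries the coordinates in \<open>E\<close> and the frequencies still to be treated.\<close>
    have dist: "distr (density P (\<lambda>x. I x * (1 + cos (\<theta> + R c x)))) borel (\<lambda>x. x e) =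
       distr (density Q (\<lambda>x. I x * (1 + cos (\<theta> + R c x)))) borel (\<lambda>x. x e)" for \<theta> c
    proof (rule weighted_Levy_uniqueness)
      have b: "\<bar>1 + cos (\<theta> + R c x)\<bar> \<le> 2" for x
        using cos_ge_minus_one[of "\<theta> + R c x"] cos_le_one[of "\<theta> + R c x"] by linarith
      have nn: "0 \<le> 1 + cos (\<theta> + R c x)" for x
        using cos_ge_minus_one[of "\<theta> + R c x"] by linarith
      show "0 \<le> I x * (1 + cos (\<theta> + R c x))" for x using nn I01 by simp
      then show "0 \<le> I x * (1 + cos (\<theta> + R c x))" for x .
      have b2: "\<bar>I x * (1 + cos (\<theta> + R c x))\<bar> \<le> 2" for x
        using mult_mono[OF I01(2) b] I01 by (simp add: abs_mult)
      show "integrable P (\<lambda>x. I x * (1 + cos (\<theta> + R c x)))"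
        using b2 by (intro P.integrable_const_bound[where B=2]) auto
      show "integrable Q (\<lambda>x. I x * (1 + cos (\<theta> + R c x)))"
        using b2 by (intro Q.integrable_const_bound[where B=2]) auto
      show "(CLINT x|P. complex_of_real (I x * (1 + cos (\<theta> + R c x))) * iexp (s * x e)) =
         (CLINT x|Q. complex_of_real (I x * (1 + cos (\<theta> + R c x))) * iexp (s * x e))" for s
        unfolding iexp_cos_weight using iP[of s 0 c] iP[of s 1 c] iP[of s "-1" c] iQ[of s 0 c] iQ[of s 1 c] iQ[of s "-1" c]
         IHr[of s 0 c] IHr[of s 1 c] IHr[of s "-1" c]
        by (simp only: Bochner_Integration.integral_add Bochner_Integration.integrable_add integrable_mult_right integral_mult_right_zero)
    qed (use e assms in auto)
    have cosint: "(\<integral>x. I x * indicator (A e) (x e) * (1 + cos (\<theta> + R c x)) \<partial>P) =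
       (\<integral>x. I x * indicator (A e) (x e) * (1 + cos (\<theta> + R c x)) \<partial>Q)" for \<theta> c
    proof -
      have nn: "0 \<le> I x * (1 + cos (\<theta> + R c x))" for x
        using I01(1)[of x] cos_ge_minus_one[of "\<theta> + R c x"] by (intro mult_nonneg_nonneg) linarith+
      have "(\<integral>u. indicator (A e) u \<partial>distr (density P (\<lambda>x. I x * (1 + cos (\<theta> + R c x)))) borel (\<lambda>x. x e)) =
        (\<integral>u. (indicator (A e) u :: real) \<partial>distr (density Q (\<lambda>x. I x * (1 + cos (\<theta> + R c x)))) borel (\<lambda>x. x e))"
        by (simp only: dist)
      moreover have "(\<integral>u. indicator (A e) u \<partial>distr (density P (\<lambda>x. I x * (1 + cos (\<theta> + R c x)))) borel (\<lambda>x. x e))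
         = (\<integral>x. I x * indicator (A e) (x e) * (1 + cos (\<theta> + R c x)) \<partial>P)"
        using e nn by (subst integral_distr, simp, simp, subst integral_density) (auto simp: mult_ac)
      moreover have "(\<integral>u. indicator (A e) u \<partial>distr (density Q (\<lambda>x. I x * (1 + cos (\<theta> + R c x)))) borel (\<lambda>x. x e))
         = (\<integral>x. I x * indicator (A e) (x e) * (1 + cos (\<theta> + R c x)) \<partial>Q)"
        using e nn by (subst integral_distr, simp, simp, subst integral_density) (auto simp: mult_ac)
      ultimately show ?thesis by simp
    qed
    define J where "J x = I x * indicator (A e) (x e)" for x
    have Jm[measurable]: "J \<in> borel_measurable P" "J \<in> borel_measurable Q"
      using e unfolding J_def by measurable
    have J01: "0 \<le> J x" "J x \<le> 1" for x
      using I01 by (auto simp: J_def split: split_indicator)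
    have jP: "integrable P (\<lambda>x. J x * cos (\<theta> + R c x))" "integrable P J" for \<theta> c
      using J01 by (auto intro!: P.integrable_const_bound[where B=1] simp: abs_mult mult_le_one)
    have jQ: "integrable Q (\<lambda>x. J x * cos (\<theta> + R c x))" "integrable Q J" for \<theta> c
      using J01 by (auto intro!: Q.integrable_const_bound[where B=1] simp: abs_mult mult_le_one)
    have "(\<integral>x. J x * (1 + cos (0 + R (\<lambda>_. 0) x)) \<partial>P) = (\<integral>x. J x * (1 + cos (0 + R (\<lambda>_. 0) x)) \<partial>Q)"
      using cosint[of 0 "\<lambda>_. 0"] unfolding J_def .
    then have J1: "(\<integral>x. J x \<partial>P) = (\<integral>x. J x \<partial>Q)" by (simp add: R_def)
    \<comment> \<open>The constant part of the weight is the case without frequencies; subtracting it leaves the cosine.\<close>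
    have Jc: "(\<integral>x. J x * cos (\<theta> + R c x) \<partial>P) = (\<integral>x. J x * cos (\<theta> + R c x) \<partial>Q)" for \<theta> c
      using cosint[of \<theta> c] J1 jP jQ unfolding J_def[symmetric] by (simp add: distrib_left)
    have ex: "complex_of_real (J x) * iexp (R c x) = of_real (J x * cos (0 + R c x)) + \<i> * of_real (J x * cos (- (pi/2) + R c x))" for x
      unfolding iexp_eq_cos_shift by (simp add: algebra_simps)
    have "(CLINT x|P. complex_of_real (J x) * iexp (R c x)) = (CLINT x|Q. complex_of_real (J x) * iexp (R c x))"
      unfolding ex using jP(1)[of 0 c] jP(1)[of "-(pi/2)" c] jQ(1)[of 0 c] jQ(1)[of "-(pi/2)" c] Jc[of 0 c] Jc[of "-(pi/2)" c]
      by (simp only: Bochner_Integration.integral_add integrable_of_real integrable_mult_right integral_mult_right_zero integral_complex_of_real)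
    moreover have "complex_of_real (J x) = (\<Prod>t\<in>insert e E. indicator (A t) (x t))" for x
      using insert.hyps by (simp add: J_def ic of_real_indicator mult.commute)
    ultimately show ?case by (simp add: R_def)
  qed
  show ?thesis
  proof (rule measure_eqI_PiM_finite[OF S sets])
    fix A :: "'t \<Rightarrow> real set" assume A: "\<And>t. t \<in> S \<Longrightarrow> A t \<in> sets borel"
    have sp: "x \<in> space P \<Longrightarrow> x \<in> extensional S" "x \<in> space Q \<Longrightarrow> x \<in> extensional S" for x
      using sets_eq_imp_space_eq[OF sets(1)] sets_eq_imp_space_eq[OF sets(2)] by (auto simp: space_PiM PiE_def)
    have i: "(\<Prod>t\<in>S. indicator (A t) (x t)) = complex_of_real (indicator (Pi\<^sub>E S A) x)" if "x \<in> extensional S" for x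
      using S that by (auto simp: indicator_def PiE_iff)
    have AP: "Pi\<^sub>E S A \<in> sets P" "Pi\<^sub>E S A \<in> sets Q"
      using A S sets by (auto intro: sets_PiM_I_finite)
    have "(CLINT x|P. complex_of_real (indicator (Pi\<^sub>E S A) x)) = (CLINT x|Q. complex_of_real (indicator (Pi\<^sub>E S A) x))"
      using main[of S A undefined] A sp by (simp add: i cong: Bochner_Integration.integral_cong)
    then have "measure P (Pi\<^sub>E S A) = measure Q (Pi\<^sub>E S A)"
      using AP by (simp add: sets.Int_space_eq1)
    then show "emeasure P (Pi\<^sub>E S A) = emeasure Q (Pi\<^sub>E S A)"
      by (simp add: P.emeasure_eq_measure Q.emeasure_eq_measure)
  next
    show "range (\<lambda>_. space (\<Pi>\<^sub>M t\<in>S. borel)) \<subseteq> prod_algebra S (\<lambda>_. borel :: real measure)"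
      using space_in_prod_algebra[of S "\<lambda>_. borel :: real measure"] by (auto simp: space_PiM)
  qed auto
qed

text \<open>
  The levels are allowed to be \<open>\<infinity>\<close>, so that the orthants cover the whole space, and \<open>-\<infinity>\<close> is
  excluded because the exceedance mass of that level is infinite; intersections of countably many
  orthants recover it.
\<close>

lemma ereal_law_eqI:
  fixes P Q :: "('t \<Rightarrow> ereal) measure"
  assumes "prob_space P" and S: "finite S"
    and sets: "sets P = sets (\<Pi>\<^sub>M t\<in>S. borel)" "sets Q = sets (\<Pi>\<^sub>M t\<in>S. borel)"
    and eq: "\<And>y. (\<And>t. t \<in> S \<Longrightarrow> y t \<noteq> -\<infinity>) \<Longrightarrow>
      emeasure P {x \<in> space P. \<forall>t\<in>S. x t \<le> y t} = emeasure Q {x \<in> space Q. \<forall>t\<in>S. x t \<le> y t}"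
  shows "P = Q"
proof -
  interpret prob_space P by fact
  let ?\<Omega> = "\<Pi>\<^sub>E t\<in>S. UNIV :: ereal set"
  define E where "E = {Pi\<^sub>E S (\<lambda>t. {..y t}) | y. \<forall>t\<in>S. y t \<noteq> (-\<infinity>::ereal)}"
  have E\<Omega>: "E \<subseteq> Pow ?\<Omega>" by (auto simp: E_def)
  have spP: "space P = ?\<Omega>" "space Q = ?\<Omega>"
    using sets_eq_imp_space_eq[OF sets(1)] sets_eq_imp_space_eq[OF sets(2)] by (simp_all add: space_PiM)
  have gen: "sets (\<Pi>\<^sub>M t\<in>S. (borel :: ereal measure)) = sigma_sets ?\<Omega> E"
  proof
    have coord: "(\<lambda>x. x t) \<in> borel_measurable (sigma ?\<Omega> E)" if t: "t \<in> S" for t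
    proof -
      have fin: "{x \<in> ?\<Omega>. x t \<le> a} \<in> sigma_sets ?\<Omega> E" if a: "a \<noteq> -\<infinity>" for a
      proof -
        have "{x \<in> ?\<Omega>. x t \<le> a} = Pi\<^sub>E S (\<lambda>s. {..if s = t then a else \<infinity>})"
          using t by (auto simp: PiE_iff extensional_def split: if_splits)
        then have "{x \<in> ?\<Omega>. x t \<le> a} \<in> E" using a unfolding E_def
          by (auto intro!: exI[of _ "\<lambda>s. if s = t then a else \<infinity>"] split: if_splits)
        then show ?thesis by blast
      qed
      have minf: "a \<le> -\<infinity> \<longleftrightarrow> (\<forall>n. a \<le> ereal (- real n))" for a
      proof
        assume *: "\<forall>n. a \<le> ereal (- real n)"
        show "a \<le> -\<infinity>"
        proof (cases a)
          case (real r)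
          obtain n where "- r < real n" using reals_Archimedean2 by blast
          then show ?thesis using *[rule_format, of n] real by simp
        qed (use *[rule_format, of 0] in auto)
      qed auto
      then have "{x \<in> ?\<Omega>. x t \<le> -\<infinity>} = (\<Inter>n::nat. {x \<in> ?\<Omega>. x t \<le> ereal (- real n)})"
        unfolding minf by auto
      moreover have "(\<Inter>n::nat. {x \<in> ?\<Omega>. x t \<le> ereal (- real n)}) \<in> sets (sigma ?\<Omega> E)"
        using E\<Omega> fin by (intro sets.countable_INT) auto
      ultimately have "{x \<in> ?\<Omega>. x t \<le> a} \<in> sigma_sets ?\<Omega> E" for a
        using fin[of a] E\<Omega> by (cases "a = -\<infinity>") auto
      then show ?thesis
        unfolding borel_measurable_iff_Iic_ereal using E\<Omega> by (auto simp: vimage_def Int_def conj_commute)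
    qed
    show "sets (\<Pi>\<^sub>M t\<in>S. (borel :: ereal measure)) \<subseteq> sigma_sets ?\<Omega> E"
    proof -
      have "sets (\<Pi>\<^sub>M t\<in>S. (borel :: ereal measure)) \<subseteq> sets (sigma ?\<Omega> E)"
      proof (rule sets_PiM_in_sets)
        fix t A assume "t \<in> S" "A \<in> sets (borel :: ereal measure)"
        from measurable_sets[OF coord[OF this(1)] this(2)]
        show "{x \<in> space (sigma ?\<Omega> E). x t \<in> A} \<in> sets (sigma ?\<Omega> E)"
          by (simp add: vimage_def Int_def conj_commute)
      qed (use E\<Omega> in simp)
      then show ?thesis using E\<Omega> by simp
    qed
    show "sigma_sets ?\<Omega> E \<subseteq> sets (\<Pi>\<^sub>M t\<in>S. (borel :: ereal measure))"
    proof -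
      have "E \<subseteq> sets (\<Pi>\<^sub>M t\<in>S. (borel :: ereal measure))"
        using S by (auto simp: E_def intro!: sets_PiM_I_finite)
      then show ?thesis
        using sets.sigma_sets_subset[of E "\<Pi>\<^sub>M t\<in>S. (borel :: ereal measure)"] by (simp add: space_PiM)
    qed
  qed
  show ?thesis
  proof (rule measure_eqI_generator_eq[OF _ E\<Omega>, where A="\<lambda>_. ?\<Omega>"])
    show "Int_stable E"
    proof (rule Int_stableI)
      fix a b assume "a \<in> E" "b \<in> E"
      then obtain y z where "a = Pi\<^sub>E S (\<lambda>t. {..y t})" "b = Pi\<^sub>E S (\<lambda>t. {..z t})"
        and "\<forall>t\<in>S. y t \<noteq> -\<infinity>" "\<forall>t\<in>S. z t \<noteq> -\<infinity>" by (auto simp: E_def)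
      then have "a \<inter> b = Pi\<^sub>E S (\<lambda>t. {..min (y t) (z t)})" "\<forall>t\<in>S. min (y t) (z t) \<noteq> -\<infinity>"
        by (auto simp: PiE_iff) (auto simp: min_def split: if_splits)
      then show "a \<inter> b \<in> E" unfolding E_def mem_Collect_eq by (intro exI[of _ "\<lambda>t. min (y t) (z t)"]) simp
    qed
    fix X assume "X \<in> E"
    then obtain y where X: "X = Pi\<^sub>E S (\<lambda>t. {..y t})" and y: "\<And>t. t \<in> S \<Longrightarrow> y t \<noteq> -\<infinity>"
      by (auto simp: E_def)
    have "X = {x \<in> ?\<Omega>. \<forall>t\<in>S. x t \<le> y t}" by (auto simp: X PiE_iff extensional_def)
    then show "emeasure P X = emeasure Q X" using eq[OF y] by (simp add: spP)
  next
    have "?\<Omega> = Pi\<^sub>E S (\<lambda>t. {..\<infinity>})" by auto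
    then have "?\<Omega> \<in> E" unfolding E_def mem_Collect_eq by (intro exI[of _ "\<lambda>_. \<infinity>"]) simp
    then show "range (\<lambda>_::nat. ?\<Omega>) \<subseteq> E" by auto
  qed (simp_all add: sets gen)
qed

lemma same_fddI_ereal:
  fixes X :: "'t \<Rightarrow> 'v \<Rightarrow> ereal" and Y :: "'t \<Rightarrow> 'w \<Rightarrow> ereal"
  assumes M: "prob_space M" and N: "prob_space N"
    and [measurable]: "\<And>t. X t \<in> borel_measurable M" "\<And>t. Y t \<in> borel_measurable N"
    and eq: "\<And>S y. finite S \<Longrightarrow> (\<And>t. t \<in> S \<Longrightarrow> y t \<noteq> -\<infinity>) \<Longrightarrow>
      measure M {w \<in> space M. \<forall>t\<in>S. X t w \<le> y t} = measure N {w \<in> space N. \<forall>t\<in>S. Y t w \<le> y t}"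
  shows "same_fdd M X N Y"
  unfolding same_fdd_def
proof (intro allI impI)
  fix S :: "'t set" assume S: "finite S"
  interpret M: prob_space M by fact
  interpret N: prob_space N by fact
  have mX: "(\<lambda>w. \<lambda>t\<in>S. X t w) \<in> measurable M (\<Pi>\<^sub>M t\<in>S. borel)"
    and mY: "(\<lambda>w. \<lambda>t\<in>S. Y t w) \<in> measurable N (\<Pi>\<^sub>M t\<in>S. borel)"
    by (auto intro!: measurable_restrict)
  show "distr M (\<Pi>\<^sub>M t\<in>S. borel) (\<lambda>w. \<lambda>t\<in>S. X t w) = distr N (\<Pi>\<^sub>M t\<in>S. borel) (\<lambda>w. \<lambda>t\<in>S. Y t w)"
  proof (rule ereal_law_eqI[OF M.prob_space_distr[OF mX] S])
    fix y :: "'t \<Rightarrow> ereal" assume y: "\<And>t. t \<in> S \<Longrightarrow> y t \<noteq> -\<infinity>"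
    let ?B = "{x \<in> space (\<Pi>\<^sub>M t\<in>S. borel). \<forall>t\<in>S. x t \<le> y t}"
    have B: "?B \<in> sets (\<Pi>\<^sub>M t\<in>S. borel)" using S by measurable
    have "(\<lambda>w. \<lambda>t\<in>S. X t w) -` ?B \<inter> space M = {w \<in> space M. \<forall>t\<in>S. X t w \<le> y t}"
      by (auto simp: space_PiM)
    moreover have "(\<lambda>w. \<lambda>t\<in>S. Y t w) -` ?B \<inter> space N = {w \<in> space N. \<forall>t\<in>S. Y t w \<le> y t}"
      by (auto simp: space_PiM)
    ultimately show "emeasure (distr M (\<Pi>\<^sub>M t\<in>S. borel) (\<lambda>w. \<lambda>t\<in>S. X t w)) {x \<in> space (distr M (\<Pi>\<^sub>M t\<in>S. borel) (\<lambda>w. \<lambda>t\<in>S. X t w)). \<forall>t\<in>S. x t \<le> y t}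
      = emeasure (distr N (\<Pi>\<^sub>M t\<in>S. borel) (\<lambda>w. \<lambda>t\<in>S. Y t w)) {x \<in> space (distr N (\<Pi>\<^sub>M t\<in>S. borel) (\<lambda>w. \<lambda>t\<in>S. Y t w)). \<forall>t\<in>S. x t \<le> y t}"
      using eq[OF S y] B by (simp add: emeasure_distr[OF mX] emeasure_distr[OF mY] M.emeasure_eq_measure N.emeasure_eq_measure)
  qed simp_all
qed

section \<open>Gaussian fields and the Cameron-Martin tilt\<close>

text \<open>
  Completing the square: an exponential weight moves the mean of a normal law by its variance.
\<close>

lemma normal_density_exp_tilt:
  assumes "s > 0"
  shows "exp x * normal_density m s x = exp (m + s\<^sup>2 / 2) * normal_density (m + s\<^sup>2) s x"
proof -
  have "x - (x - m)\<^sup>2 / (2 * s\<^sup>2) = m + s\<^sup>2 / 2 - (x - (m + s\<^sup>2))\<^sup>2 / (2 * s\<^sup>2)"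
    using assms by (simp add: field_simps power2_eq_square)
  then have "exp x * exp (- (x - m)\<^sup>2 / (2 * s\<^sup>2)) = exp (m + s\<^sup>2 / 2) * exp (- (x - (m + s\<^sup>2))\<^sup>2 / (2 * s\<^sup>2))"
    by (simp add: exp_add[symmetric])
  then show ?thesis by (simp add: normal_density_def)
qed

lemma char_normal_density:
  assumes "s > 0"
  shows "(CLINT x|density lborel (\<lambda>x. ennreal (normal_density m s x)). iexp (r * x)) = exp (\<i> * (r * m) - (r\<^sup>2 * s\<^sup>2 / 2))"
proof -
  define D where "D = density lborel (\<lambda>x. ennreal (normal_density m s x))"
  interpret prob_space D unfolding D_def by (rule prob_space_normal_density[OF assms])
  have "distributed D lborel (\<lambda>x. x) (normal_density m s)"
    unfolding distributed_def D_def by (simp add: distr_id2)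
  then have "distributed D lborel (\<lambda>x. (x - m) / s) std_normal_density"
    using normal_standard_normal_convert[OF assms, of "\<lambda>x. x" m] by simp
  then have d: "distr D lborel (\<lambda>x. (x - m) / s) = std_normal_distribution"
    by (simp add: distributed_def)
  have [measurable]: "(\<lambda>x. (x - m) / s) \<in> borel_measurable D" by (simp add: D_def)
  have "(CLINT x|D. iexp (r * x)) = (CLINT x|D. iexp (r * m) * iexp (r * s * ((x - m) / s)))"
    using assms by (intro Bochner_Integration.integral_cong) (auto simp: exp_add[symmetric] field_simps)
  also have "\<dots> = iexp (r * m) * (CLINT x|D. iexp (r * s * ((x - m) / s)))"
    by (rule integral_mult_right_zero)
  also have "(CLINT x|D. iexp (r * s * ((x - m) / s))) = (CLINT x|distr D lborel (\<lambda>x. (x - m) / s). iexp (r * s * x))"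
    by (subst integral_distr) (auto simp: D_def)
  also have "\<dots> = char std_normal_distribution (r * s)"
    by (simp add: d char_def)
  also have "\<dots> = complex_of_real (exp (- (r * s)\<^sup>2 / 2))"
    by (simp only: char_std_normal_distribution)
  also have "iexp (r * m) * \<dots> = exp (\<i> * (r * m) - (r\<^sup>2 * s\<^sup>2 / 2))"
    by (simp only: exp_of_real[symmetric] exp_add[symmetric]) (simp add: power_mult_distrib)
  finally show ?thesis unfolding D_def .
qed

lemma integrable_mult_of_squares:
  fixes f g :: "'v \<Rightarrow> real"
  assumes "f \<in> borel_measurable M" "g \<in> borel_measurable M"
    "integrable M (\<lambda>w. (f w)\<^sup>2)" "integrable M (\<lambda>w. (g w)\<^sup>2)"
  shows "integrable M (\<lambda>w. f w * g w)"
proof (rule Bochner_Integration.integrable_bound[of M "\<lambda>w. (f w)\<^sup>2 + (g w)\<^sup>2"])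
  have "\<bar>a * b\<bar> \<le> a\<^sup>2 + b\<^sup>2" for a b :: real
    using sum_squares_bound[of "\<bar>a\<bar>" "\<bar>b\<bar>"] mult_nonneg_nonneg[of "\<bar>a\<bar>" "\<bar>b\<bar>"]
    unfolding abs_mult power2_abs by linarith
  then show "AE w in M. norm (f w * g w) \<le> norm ((f w)\<^sup>2 + (g w)\<^sup>2)" by simp
qed (use assms in auto)

lemma gaussian_rv_cases:
  assumes "prob_space M" and "gaussian_rv M Y"
  obtains (const) m where "AE w in M. Y w = m"
  | (normal) m s where "s > 0" "distr M borel Y = density lborel (\<lambda>x. ennreal (normal_density m s x))"
proof -
  have [measurable]: "Y \<in> borel_measurable M" using assms by (simp add: gaussian_rv_def)
  consider m where "distr M borel Y = return borel m"
   | m s where "s > 0" "distr M borel Y = density lborel (\<lambda>x. ennreal (normal_density m s x))"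
    using assms by (auto simp: gaussian_rv_def)
  then show thesis
  proof cases
    case 1
    have "AE y in distr M borel Y. y = m"
      unfolding 1 by (subst AE_return) auto
    then have "AE w in M. Y w = m" by (simp add: AE_distr_iff)
    then show thesis by (rule const)
  qed (use normal in blast)
qed

text \<open>
  A Gaussian variable is described by its mean and variance, uniformly for point masses and
  nondegenerate normal laws.  The last clause is the characteristic function of the tilted law.
\<close>

lemma gaussian_rv_facts:
  assumes "prob_space M" and g: "gaussian_rv M Y"
  defines "m \<equiv> \<integral>w. Y w \<partial>M"
  defines "v \<equiv> \<integral>w. (Y w - m)\<^sup>2 \<partial>M"
  shows "integrable M (\<lambda>w. (Y w)\<^sup>2) \<and> (CLINT w|M. iexp (r * Y w)) = exp (\<i> * of_real (r * m) - of_real (r\<^sup>2 * v / 2)) \<and>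
    (\<integral>\<^sup>+w. ennreal (exp (Y w)) \<partial>M) = ennreal (exp (m + v / 2)) \<and>
    (m = 0 \<longrightarrow> (CLINT w|M. complex_of_real (exp (Y w - v / 2)) * iexp (r * Y w)) = exp (\<i> * of_real (r * v) - of_real (r\<^sup>2 * v / 2)))"
proof -
  interpret prob_space M by fact
  have [measurable]: "Y \<in> borel_measurable M" using g by (simp add: gaussian_rv_def)
  show ?thesis
    using \<open>prob_space M\<close> g
  proof (cases rule: gaussian_rv_cases)
    case (const a)
    have m: "m = a"
      unfolding m_def using const by (subst integral_cong_AE[where g="\<lambda>_. a"]) (auto simp: prob_space)
    have "v = (\<integral>w. 0 \<partial>M)"
      unfolding v_def using const by (intro integral_cong_AE) (auto simp: m)
    then have v: "v = 0" by simp
    have 1: "integrable M (\<lambda>w. (Y w)\<^sup>2)"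
      using const by (intro integrable_const_bound[where B="a\<^sup>2"]) auto
    have 2: "(CLINT w|M. iexp (r * Y w)) = (CLINT w|M. iexp (r * a))"
      using const by (intro integral_cong_AE) auto
    have 3: "(\<integral>\<^sup>+w. exp (Y w) \<partial>M) = (\<integral>\<^sup>+w. exp a \<partial>M)"
      using const by (intro nn_integral_cong_AE) auto
    have 4: "(CLINT w|M. complex_of_real (exp (Y w - v / 2)) * iexp (r * Y w)) = (CLINT w|M. complex_of_real (exp (a - v / 2)) * iexp (r * a))"
      using const by (intro integral_cong_AE) auto
    show ?thesis
      using 1 2 3 4 by (auto simp: m v prob_space emeasure_space_1)
  next
    case (normal a s)
    have D: "distributed M lborel Y (normal_density a s)"
      using normal by (simp add: distributed_def measurable_lborel1 cong: distr_cong)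
    have m: "m = a"
      unfolding m_def by (rule normal_distributed_expectation[OF normal(1) D])
    have v: "v = s\<^sup>2"
      using normal_distributed_variance[OF normal(1) D] by (simp add: v_def m_def)
    have tr: "(\<integral>w. f (Y w) \<partial>M) = (\<integral>x. f x \<partial>density lborel (\<lambda>x. ennreal (normal_density a s x)))"
      if "f \<in> borel_measurable borel" for f :: "real \<Rightarrow> complex"
      using that by (simp add: normal(2)[symmetric] integral_distr)
    have "integrable (distr M borel Y) (\<lambda>x. x\<^sup>2)"
    proof -
      have "integrable lborel (\<lambda>x. normal_density a s x * (x - a)^2 + 2 * a * (normal_density a s x * x) - a\<^sup>2 * normal_density a s x)"
        using normal(1) integrable_normal_moment[of s a 2] integrable_normal_moment_nz_1[of s a] integrable_normal_density[of s a]
        by (intro Bochner_Integration.integrable_diff Bochner_Integration.integrable_add integrable_mult_right) auto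
      also have "(\<lambda>x. normal_density a s x * (x - a)^2 + 2 * a * (normal_density a s x * x) - a\<^sup>2 * normal_density a s x) = (\<lambda>x. normal_density a s x * x\<^sup>2)"
        by (auto simp: fun_eq_iff power2_eq_square algebra_simps)
      finally show ?thesis
        unfolding normal(2) by (subst integrable_density) auto
    qed
    then have 1: "integrable M (\<lambda>w. (Y w)\<^sup>2)" by (simp add: integrable_distr_eq)
    have 2: "(CLINT w|M. iexp (r * Y w)) = exp (\<i> * (r * a) - (r\<^sup>2 * s\<^sup>2 / 2))"
      by (subst tr) (auto simp: char_normal_density[OF normal(1), of a r, simplified])
    have 3: "(\<integral>\<^sup>+w. exp (Y w) \<partial>M) = exp (a + s\<^sup>2 / 2)"
    proof -
      have "(\<integral>\<^sup>+w. exp (Y w) \<partial>M) = (\<integral>\<^sup>+x. exp x \<partial>density lborel (\<lambda>x. ennreal (normal_density a s x)))"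
        by (simp add: normal(2)[symmetric] nn_integral_distr)
      also have "\<dots> = (\<integral>\<^sup>+x. ennreal (exp (a + s\<^sup>2 / 2)) * ennreal (normal_density (a + s\<^sup>2) s x) \<partial>lborel)"
        using normal_density_exp_tilt[OF normal(1), of _ a]
        by (subst nn_integral_density) (auto simp: ennreal_mult[symmetric] mult.commute intro!: nn_integral_cong)
      also have "\<dots> = ennreal (exp (a + s\<^sup>2 / 2)) * (\<integral>\<^sup>+x. ennreal (normal_density (a + s\<^sup>2) s x) \<partial>lborel)"
        by (rule nn_integral_cmult) simp
      also have "(\<integral>\<^sup>+x. ennreal (normal_density (a + s\<^sup>2) s x) \<partial>lborel) = 1"
        using prob_space.emeasure_space_1[OF prob_space_normal_density[OF normal(1), of "a + s\<^sup>2"]]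
        by (simp add: emeasure_density)
      finally show ?thesis by simp
    qed
    have 4: "(CLINT w|M. complex_of_real (exp (Y w - s\<^sup>2 / 2)) * iexp (r * Y w)) = exp (\<i> * (r * s\<^sup>2) - (r\<^sup>2 * s\<^sup>2 / 2))" if "a = 0"
    proof -
      have "(CLINT w|M. complex_of_real (exp (Y w - s\<^sup>2 / 2)) * iexp (r * Y w)) =
          (CLINT x|lborel. normal_density a s x *\<^sub>R (complex_of_real (exp (x - s\<^sup>2 / 2)) * iexp (r * x)))"
        by (subst tr) (auto simp: integral_density)
      also have "\<dots> = (CLINT x|lborel. normal_density (s\<^sup>2) s x *\<^sub>R iexp (r * x))"
      proof (intro Bochner_Integration.integral_cong refl)
        fix x
        have "normal_density 0 s x * exp (x - s\<^sup>2 / 2) = normal_density (s\<^sup>2) s x"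
          using normal_density_exp_tilt[OF normal(1), of x 0] by (simp add: exp_diff mult.commute)
        then have "complex_of_real (normal_density 0 s x) * complex_of_real (exp (x - s\<^sup>2 / 2)) = complex_of_real (normal_density (s\<^sup>2) s x)"
          by (simp only: of_real_mult[symmetric])
        then show "normal_density a s x *\<^sub>R (complex_of_real (exp (x - s\<^sup>2 / 2)) * iexp (r * x)) = normal_density (s\<^sup>2) s x *\<^sub>R iexp (r * x)"
          by (simp only: scaleR_conv_of_real that mult.assoc[symmetric])
      qed
      also have "\<dots> = (CLINT x|density lborel (\<lambda>x. ennreal (normal_density (s\<^sup>2) s x)). iexp (r * x))"
        by (subst integral_density) auto
      finally show ?thesis using char_normal_density[OF normal(1), of "s\<^sup>2" r] by simp
    qed
    show ?thesis using 1 2 3 4 by (simp add: m v)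
  qed
qed

lemmas gaussian_rv_square_integrable = gaussian_rv_facts[THEN conjunct1]
lemmas gaussian_rv_char = gaussian_rv_facts[THEN conjunct2, THEN conjunct1]
lemmas gaussian_rv_mgf = gaussian_rv_facts[THEN conjunct2, THEN conjunct2, THEN conjunct1]
lemmas gaussian_rv_tilted_char = gaussian_rv_facts[THEN conjunct2, THEN conjunct2, THEN conjunct2, THEN mp]

text \<open>
  Let the characters of \<open>R\<close> factor out of those of \<open>U\<close>, as happens for uncorrelated jointly
  Gaussian variables.  Then they factor out of every integrable function of \<open>U\<close>, including
  unbounded ones such as the exponential weight of a tilt: by uniqueness the weight
  \<open>1 + cos (\<theta> + R)\<close> acts on functions of \<open>U\<close> like the constant \<open>1 + \<rho> * cos \<theta>\<close>.
\<close>

lemma expectation_factor_of_char_factor: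
  fixes U R :: "'v \<Rightarrow> real" and g :: "real \<Rightarrow> complex"
  assumes "prob_space M" and [measurable]: "U \<in> borel_measurable M" "R \<in> borel_measurable M"
    and char: "\<And>s r. r \<in> {1, -1} \<Longrightarrow> (CLINT w|M. iexp (s * U w + r * R w)) = of_real \<rho> * (CLINT w|M. iexp (s * U w))"
    and \<rho>: "\<bar>\<rho>\<bar> \<le> 1"
    and [measurable]: "g \<in> borel_measurable borel" and g: "integrable M (\<lambda>w. g (U w))"
  shows "(CLINT w|M. g (U w) * iexp (R w)) = of_real \<rho> * (CLINT w|M. g (U w))"
proof -
  interpret prob_space M by fact
  have ib: "integrable M (\<lambda>w. iexp (s * U w + r * R w))" for s r
    by (intro integrable_const_bound[where B=1]) auto
  have gi: "integrable M (\<lambda>w. of_real (cos (\<theta> + R w)) * g (U w))" for \<theta>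
    using g by (rule Bochner_Integration.integrable_bound) (auto simp: norm_mult mult_left_le_one_le)
  have shifted: "(CLINT w|M. of_real (cos (\<theta> + R w)) * g (U w)) = of_real (\<rho> * cos \<theta>) * (CLINT w|M. g (U w))" for \<theta>
  proof -
    have nn: "0 \<le> 1 + cos (\<theta> + R w)" for w
      using cos_ge_minus_one[of "\<theta> + R w"] by linarith
    have b: "\<bar>1 + cos (\<theta> + R w)\<bar> \<le> 2" for w
      using cos_ge_minus_one[of "\<theta> + R w"] cos_le_one[of "\<theta> + R w"] by linarith
    have "\<bar>\<rho> * cos \<theta>\<bar> \<le> 1"
      using \<rho> by (simp add: abs_mult mult_le_one)
    then have nn': "0 \<le> 1 + \<rho> * cos \<theta>" by linarith
    have D: "distr (density M (\<lambda>w. 1 + cos (\<theta> + R w))) borel U = distr (density M (\<lambda>w. 1 + \<rho> * cos \<theta>)) borel U"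
    proof (rule weighted_Levy_uniqueness)
      show "integrable M (\<lambda>w. 1 + cos (\<theta> + R w))"
        using b by (intro integrable_const_bound[where B=2]) auto
      fix s
      have c: "complex_of_real (cos \<theta>) = (iexp \<theta> + iexp (- \<theta>)) / 2"
        by (simp add: cos_of_real[symmetric] cos_exp_eq)
      have c2: "(CLINT w|M. iexp (s * U w + 1 * R w)) = of_real \<rho> * (CLINT w|M. iexp (s * U w))"
        and c3: "(CLINT w|M. iexp (s * U w + (-1) * R w)) = of_real \<rho> * (CLINT w|M. iexp (s * U w))"
        by (rule char; simp)+
      have "(CLINT w|M. complex_of_real (1 * (1 + cos (\<theta> + R w))) * iexp (s * U w)) =
        (CLINT w|M. iexp (s * U w + 0 * R w)) + (iexp \<theta> / 2) * (CLINT w|M. iexp (s * U w + 1 * R w))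
          + (iexp (- \<theta>) / 2) * (CLINT w|M. iexp (s * U w + (-1) * R w))"
        unfolding iexp_cos_weight of_real_1 mult_1_left[where 'a=complex]
        using ib[of s 0] ib[of s 1] ib[of s "-1"]
        by (simp only: Bochner_Integration.integral_add Bochner_Integration.integrable_add integrable_mult_right integral_mult_right_zero)
      also have "\<dots> = (1 + of_real \<rho> * of_real (cos \<theta>)) * (CLINT w|M. iexp (s * U w))"
        unfolding c2 c3 c by (simp add: distrib_left distrib_right add_divide_distrib mult_ac)
      finally show "(CLINT w|M. complex_of_real (1 + cos (\<theta> + R w)) * iexp (s * U w)) =
        (CLINT w|M. complex_of_real (1 + \<rho> * cos \<theta>) * iexp (s * U w))"
        by simp
    qed (use nn nn' \<open>prob_space M\<close> in auto)
    have "(CLINT w|M. (1 + cos (\<theta> + R w)) *\<^sub>R g (U w)) = (CLINT u|distr (density M (\<lambda>w. 1 + cos (\<theta> + R w))) borel U. g u)"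
      using nn by (simp add: integral_distr integral_density)
    also have "\<dots> = (CLINT w|M. (1 + \<rho> * cos \<theta>) *\<^sub>R g (U w))"
      unfolding D using nn' by (subst integral_distr, simp, simp, subst integral_density) auto
    also have "\<dots> = (1 + of_real (\<rho> * cos \<theta>)) * (CLINT w|M. g (U w))"
      by (simp add: scaleR_conv_of_real)
    finally have "(CLINT w|M. g (U w) + of_real (cos (\<theta> + R w)) * g (U w)) = (1 + of_real (\<rho> * cos \<theta>)) * (CLINT w|M. g (U w))"
      by (simp add: scaleR_conv_of_real distrib_right)
    then show ?thesis
      using g gi[of \<theta>] by (simp add: distrib_right)
  qed
  have "(CLINT w|M. g (U w) * iexp (R w)) =
     (CLINT w|M. of_real (cos (0 + R w)) * g (U w) + \<i> * (of_real (cos (- (pi/2) + R w)) * g (U w)))"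
    unfolding iexp_eq_cos_shift by (simp add: algebra_simps)
  also have "\<dots> = (CLINT w|M. of_real (cos (0 + R w)) * g (U w)) + \<i> * (CLINT w|M. of_real (cos (- (pi/2) + R w)) * g (U w))"
    using gi[of 0] gi[of "-(pi/2)"]
    by (simp only: Bochner_Integration.integral_add integrable_mult_right integral_mult_right_zero)
  finally show ?thesis unfolding shifted by simp
qed

text \<open>
  Split \<open>V = b * U + R\<close> with \<open>R\<close> uncorrelated with \<open>U\<close>.  The tilt acts on the part \<open>b * U\<close> alone
  and moves its mean by \<open>b * v\<close>, which is the covariance of \<open>U\<close> and \<open>V\<close>; the factor of \<open>R\<close> is
  split off by \<open>expectation_factor_of_char_factor\<close>.
\<close>

lemma Cameron_Martin:
  fixes U V :: "'v \<Rightarrow> real"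
  assumes "prob_space M" and G: "\<And>a b. gaussian_rv M (\<lambda>w. a * U w + b * V w)"
    and mU: "(\<integral>w. U w \<partial>M) = 0" and mV: "(\<integral>w. V w \<partial>M) = 0"
  defines "v \<equiv> \<integral>w. (U w)\<^sup>2 \<partial>M"
  shows "(CLINT w|M. complex_of_real (exp (U w - v / 2)) * iexp (V w)) = exp (\<i> * (\<integral>w. U w * V w \<partial>M) - (\<integral>w. (V w)\<^sup>2 \<partial>M) / 2)"
proof -
  interpret prob_space M by fact
  have GU: "gaussian_rv M U" and GV: "gaussian_rv M V"
    using G[of 1 0] G[of 0 1] by simp_all
  have [measurable]: "U \<in> borel_measurable M" "V \<in> borel_measurable M"
    using GU GV by (auto simp: gaussian_rv_def)
  have iU2: "integrable M (\<lambda>w. (U w)\<^sup>2)" and iV2: "integrable M (\<lambda>w. (V w)\<^sup>2)"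
    using gaussian_rv_square_integrable[OF \<open>prob_space M\<close>] GU GV by auto
  have iU: "integrable M U" and iV: "integrable M V"
    using iU2 iV2 by (auto intro: square_integrable_imp_integrable)
  have iUV: "integrable M (\<lambda>w. U w * V w)"
    using iU2 iV2 by (intro integrable_mult_of_squares) auto
  define C where "C = (\<integral>w. U w * V w \<partial>M)"
  \<comment> \<open>For \<open>v = 0\<close> also \<open>C = 0\<close>, and the convention \<open>C / 0 = 0\<close> gives the right coefficient.\<close>
  define b where "b = C / v"
  have bv: "b * v = C"
  proof (cases "v = 0")
    case True
    then have "AE w in M. U w = 0"
      using iU2 by (auto simp: v_def integral_nonneg_eq_0_iff_AE)
    then have "C = (\<integral>w. 0 \<partial>M)"
      unfolding C_def by (intro integral_cong_AE) auto
    then show ?thesis using True by simp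
  qed (simp add: b_def)
  define R where "R w = V w - b * U w" for w
  define \<kappa> where "\<kappa> = (\<integral>w. (V w)\<^sup>2 \<partial>M) - b\<^sup>2 * v"
  have [measurable]: "R \<in> borel_measurable M" by (simp add: R_def[abs_def])
  have sq: "(\<integral>w. (s * U w + r * R w)\<^sup>2 \<partial>M) = s\<^sup>2 * v + r\<^sup>2 * \<kappa>" for s r
  proof -
    have "(\<integral>w. (s * U w + r * R w)\<^sup>2 \<partial>M) = (\<integral>w. (s - r * b)\<^sup>2 * (U w)\<^sup>2 + (2 * (s - r * b) * r) * (U w * V w) + r\<^sup>2 * (V w)\<^sup>2 \<partial>M)"
      by (intro Bochner_Integration.integral_cong) (auto simp: R_def power2_eq_square algebra_simps)
    also have "\<dots> = (s - r * b)\<^sup>2 * v + (2 * (s - r * b) * r) * C + r\<^sup>2 * (\<integral>w. (V w)\<^sup>2 \<partial>M)"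
      using iU2 iV2 iUV by (simp add: v_def C_def)
    also have "\<dots> = s\<^sup>2 * v + r\<^sup>2 * \<kappa>"
      unfolding \<kappa>_def bv[symmetric] by (simp add: power2_eq_square algebra_simps)
    finally show ?thesis .
  qed
  have char: "(CLINT w|M. iexp (s * U w + r * R w)) = of_real (exp (- ((s\<^sup>2 * v + r\<^sup>2 * \<kappa>) / 2)))" for s r
  proof -
    have g: "gaussian_rv M (\<lambda>w. s * U w + r * R w)"
      using G[of "s - r * b" r] by (simp add: R_def algebra_simps)
    have m: "(\<integral>w. s * U w + r * R w \<partial>M) = 0"
      using iU iV mU mV by (simp add: R_def)
    show ?thesis
      using gaussian_rv_char[OF \<open>prob_space M\<close> g, of 1] unfolding m by (simp add: sq exp_of_real[symmetric])
  qed
  have "0 \<le> (\<integral>w. (0 * U w + 1 * R w)\<^sup>2 \<partial>M)" by (rule Bochner_Integration.integral_nonneg) simp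
  then have \<kappa>0: "\<kappa> \<ge> 0" unfolding sq by simp
  have "(\<integral>\<^sup>+w. exp (U w) \<partial>M) < \<infinity>"
    by (subst gaussian_rv_mgf[OF \<open>prob_space M\<close> GU]) simp
  then have ie: "integrable M (\<lambda>w. exp (U w))" by (simp add: integrable_iff_bounded)
  have "(CLINT w|M. complex_of_real (exp (U w - v / 2)) * iexp (V w)) = (CLINT w|M. (complex_of_real (exp (U w - v / 2)) * iexp (b * U w)) * iexp (R w))"
  proof (intro Bochner_Integration.integral_cong refl)
    fix w
    have "iexp (V w) = iexp (b * U w) * iexp (R w)"
      unfolding exp_add[symmetric] distrib_left[symmetric] of_real_add[symmetric] by (simp add: R_def)
    then show "complex_of_real (exp (U w - v / 2)) * iexp (V w) = (complex_of_real (exp (U w - v / 2)) * iexp (b * U w)) * iexp (R w)"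
      by (simp only: mult.assoc)
  qed
  also have "\<dots> = of_real (exp (- \<kappa> / 2)) * (CLINT w|M. complex_of_real (exp (U w - v / 2)) * iexp (b * U w))"
  proof (rule expectation_factor_of_char_factor[where g="\<lambda>u. complex_of_real (exp (u - v / 2)) * iexp (b * u)"])
    show "(CLINT w|M. iexp (s * U w + r * R w)) = of_real (exp (- \<kappa> / 2)) * (CLINT w|M. iexp (s * U w))" if "r \<in> {1, -1}" for s r
    proof -
      have "exp (- ((s\<^sup>2 * v + r\<^sup>2 * \<kappa>) / 2)) = exp (- \<kappa> / 2) * exp (- ((s\<^sup>2 * v + 0\<^sup>2 * \<kappa>) / 2))"
        using that by (auto simp: exp_add[symmetric] add_divide_distrib)
      then have "complex_of_real (exp (- ((s\<^sup>2 * v + r\<^sup>2 * \<kappa>) / 2))) = of_real (exp (- \<kappa> / 2)) * of_real (exp (- ((s\<^sup>2 * v + 0\<^sup>2 * \<kappa>) / 2)))"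
        by (simp only: of_real_mult)
      then show ?thesis using char[of s r] char[of s 0] by simp
    qed
    have "integrable M (\<lambda>w. exp (U w) / exp (v / 2))" using ie by simp
    then show "integrable M (\<lambda>w. complex_of_real (exp (U w - v / 2)) * iexp (b * U w))"
    proof (rule Bochner_Integration.integrable_bound)
      have "norm (iexp (b * U w)) = 1" for w by (rule norm_exp_i_times)
      then show "AE w in M. norm (complex_of_real (exp (U w - v / 2)) * iexp (b * U w)) \<le> norm (exp (U w) / exp (v / 2))"
        by (simp add: norm_mult norm_divide exp_diff del: of_real_mult)
    qed measurable
  qed (use \<open>prob_space M\<close> \<kappa>0 in \<open>simp_all del: of_real_mult\<close>)
  also have "(CLINT w|M. complex_of_real (exp (U w - v / 2)) * iexp (b * U w)) = exp (\<i> * (b * v) - (b\<^sup>2 * v / 2))"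
    using gaussian_rv_tilted_char[OF \<open>prob_space M\<close> GU mU, of b] by (simp add: mU v_def)
  also have "of_real (exp (- \<kappa> / 2)) * \<dots> = exp (\<i> * C - (\<integral>w. (V w)\<^sup>2 \<partial>M) / 2)"
    unfolding \<kappa>_def bv by (simp only: exp_of_real[symmetric] exp_add[symmetric]) (simp add: field_simps)
  finally show ?thesis unfolding C_def .
qed

text \<open>
  Polarisation: products are recovered from squares of variables and of differences, which is
  how a variogram determines the variance of linear combinations.
\<close>

lemma second_moment_sum:
  fixes D :: "'t \<Rightarrow> 'v \<Rightarrow> real"
  assumes meas: "\<And>s. s \<in> S \<Longrightarrow> D s \<in> borel_measurable M"
    and sq: "\<And>s. s \<in> S \<Longrightarrow> integrable M (\<lambda>w. (D s w)\<^sup>2)"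
    and q: "\<And>s. s \<in> S \<Longrightarrow> (\<integral>w. (D s w)\<^sup>2 \<partial>M) = q s"
    and r: "\<And>s s'. s \<in> S \<Longrightarrow> s' \<in> S \<Longrightarrow> (\<integral>w. (D s w - D s' w)\<^sup>2 \<partial>M) = r s s'"
  shows "(\<integral>w. (\<Sum>s\<in>S. c s * D s w)\<^sup>2 \<partial>M) = (\<Sum>s\<in>S. \<Sum>s'\<in>S. c s * c s' * ((q s + q s' - r s s') / 2))"
proof -
  have prod: "integrable M (\<lambda>w. D s w * D s' w)" if "s \<in> S" "s' \<in> S" for s s'
    using that meas sq by (intro integrable_mult_of_squares) auto
  have E: "(\<integral>w. D s w * D s' w \<partial>M) = (q s + q s' - r s s') / 2" if s: "s \<in> S" "s' \<in> S" for s s'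
  proof -
    have "r s s' = (\<integral>w. (D s w)\<^sup>2 + (D s' w)\<^sup>2 - 2 * (D s w * D s' w) \<partial>M)"
      unfolding r[OF s, symmetric] by (intro Bochner_Integration.integral_cong) (auto simp: power2_eq_square algebra_simps)
    also have "\<dots> = q s + q s' - 2 * (\<integral>w. D s w * D s' w \<partial>M)"
      using s sq prod by (simp add: q)
    finally show ?thesis by simp
  qed
  have "(\<integral>w. (\<Sum>s\<in>S. c s * D s w)\<^sup>2 \<partial>M) = (\<integral>w. (\<Sum>s\<in>S. \<Sum>s'\<in>S. c s * c s' * (D s w * D s' w)) \<partial>M)"
    by (intro Bochner_Integration.integral_cong) (auto simp: power2_eq_square sum_product mult_ac intro!: sum.cong)
  also have "\<dots> = (\<Sum>s\<in>S. \<Sum>s'\<in>S. c s * c s' * (\<integral>w. D s w * D s' w \<partial>M))"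
    using prod by (simp add: Bochner_Integration.integral_sum)
  finally show ?thesis using E by simp
qed

lemma gaussian_field_imp_gaussian_rv:
  assumes "gaussian_field M X" shows "gaussian_rv M (X t)"
  using assms[unfolded gaussian_field_def, rule_format, of "{t}" "\<lambda>_. 1"] by simp

text \<open>
  The variogram is defined through increments from the origin; stationarity moves the base
  point.
\<close>

lemma stationary_increments_second_moment:
  fixes X :: "'t::ab_group_add \<Rightarrow> 'v \<Rightarrow> real"
  assumes [measurable]: "\<And>t. X t \<in> borel_measurable M" and st: "stationary_increments M X"
  shows "(\<integral>w. (X s w - X t w)\<^sup>2 \<partial>M) = 2 * variogram M X (s - t)"
proof -
  have m: "(\<lambda>w. \<lambda>u\<in>{s - t}. f u w) \<in> measurable M (\<Pi>\<^sub>M u\<in>{s - t}. borel)" if "\<And>u. f u \<in> borel_measurable M" for f :: "'t \<Rightarrow> 'v \<Rightarrow> real"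
    using that by (intro measurable_restrict) auto
  have "(\<integral>w. (X s w - X t w)\<^sup>2 \<partial>M) = (\<integral>x. (x (s - t))\<^sup>2 \<partial>distr M (\<Pi>\<^sub>M u\<in>{s - t}. borel) (\<lambda>w. \<lambda>u\<in>{s - t}. X (u + t) w - X t w))"
    by (subst integral_distr[OF m]) auto
  also have "\<dots> = (\<integral>x. (x (s - t))\<^sup>2 \<partial>distr M (\<Pi>\<^sub>M u\<in>{s - t}. borel) (\<lambda>w. \<lambda>u\<in>{s - t}. X u w - X 0 w))"
    using st unfolding stationary_increments_def same_fdd_def by simp
  also have "\<dots> = 2 * variogram M X (s - t)"
    by (subst integral_distr[OF m]) (auto simp: variogram_def)
  finally show ?thesis .
qed

text \<open>
  A linear combination of the \<open>X s - X t\<close> is the variable \<open>V - k\<close> with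
  \<open>V = (\<Sum>s\<in>S. c s * (W s - W t))\<close> and a constant \<open>k\<close>.  Cameron-Martin with \<open>U = W t\<close> moves its
  mean from \<open>-k\<close> to \<open>m = -(\<Sum>s\<in>S. c s * \<gamma> (s - t))\<close>, the mean of the same combination of the
  \<open>Z (s - t)\<close>; the variances agree because both fields have variogram \<open>\<gamma>\<close>.
\<close>

lemma tilted_increments:
  fixes W :: "'t::ab_group_add \<Rightarrow> 'v \<Rightarrow> real" and Z :: "'t \<Rightarrow> 'w \<Rightarrow> real" and \<sigma>2 \<gamma> :: "'t \<Rightarrow> real"
  assumes M: "prob_space M" and Wg: "gaussian_field M W" and Wm: "\<And>t. mean_fun M W t = 0"
    and Ws: "stationary_increments M W" and Wv: "\<And>t. variance_fun M W t = \<sigma>2 t" and W\<gamma>: "\<And>t. variogram M W t = \<gamma> t"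
    and N: "prob_space N" and Zg: "gaussian_field N Z" and Zm: "\<And>t. mean_fun N Z t = - \<gamma> t"
    and Zv: "\<And>t. variance_fun N Z t = 2 * \<gamma> t" and Zs: "stationary_increments N (\<lambda>t w. Z t w + \<gamma> t)"
    and Z\<gamma>: "\<And>t. variogram N (\<lambda>t w. Z t w + \<gamma> t) t = \<gamma> t"
  defines "X \<equiv> \<lambda>s w. W s w - \<sigma>2 s / 2"
  defines "Q \<equiv> \<lambda>t. density M (\<lambda>w. ennreal (exp (X t w)))"
  shows "prob_space (Q t)" and "same_fdd (Q t) (\<lambda>s w. X s w - X t w) N (\<lambda>s w. Z (s - t) w)"
proof -
  interpret M: prob_space M by fact
  interpret N: prob_space N by fact
  have WG: "gaussian_rv M (W s)" and ZG: "gaussian_rv N (Z s)" for s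
    using Wg Zg by (auto intro: gaussian_field_imp_gaussian_rv)
  have [measurable]: "W s \<in> borel_measurable M" "Z s \<in> borel_measurable N" for s
    using WG ZG by (auto simp: gaussian_rv_def)
  have [measurable]: "X s \<in> borel_measurable M" for s by (simp add: X_def)
  have W2: "integrable M (\<lambda>w. (W s w)\<^sup>2)" and Z2: "integrable N (\<lambda>w. (Z s w)\<^sup>2)" for s
    using gaussian_rv_square_integrable[OF M WG] gaussian_rv_square_integrable[OF N ZG] by auto
  have W1: "integrable M (W s)" and Z1: "integrable N (Z s)" for s
    using W2 Z2 by (auto intro: M.square_integrable_imp_integrable N.square_integrable_imp_integrable)
  have WW: "integrable M (\<lambda>w. W s w * W s' w)" for s s'
    using W2 by (intro integrable_mult_of_squares) auto
  have EW: "(\<integral>w. W s w \<partial>M) = 0" and EW2: "(\<integral>w. (W s w)\<^sup>2 \<partial>M) = \<sigma>2 s" for s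
    using Wm[of s] Wv[of s] by (simp_all add: mean_fun_def variance_fun_def)
  have EZ: "(\<integral>w. Z s w \<partial>N) = - \<gamma> s" for s
    using Zm[of s] by (simp add: mean_fun_def)
  have EZ2: "(\<integral>w. (Z s w + \<gamma> s)\<^sup>2 \<partial>N) = 2 * \<gamma> s" for s
    using Zv[of s] Zm[of s] by (simp add: variance_fun_def)
  have Winc: "(\<integral>w. (W s w - W s' w)\<^sup>2 \<partial>M) = 2 * \<gamma> (s - s')" for s s'
    using stationary_increments_second_moment[of W M s s'] Ws W\<gamma> by simp
  have Zinc: "(\<integral>w. ((Z s w + \<gamma> s) - (Z s' w + \<gamma> s'))\<^sup>2 \<partial>N) = 2 * \<gamma> (s - s')" for s s'
    using stationary_increments_second_moment[of "\<lambda>t w. Z t w + \<gamma> t" N s s'] Zs Z\<gamma> by simp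
  have cov: "(\<integral>w. W t w * W s w \<partial>M) = (\<sigma>2 s + \<sigma>2 t) / 2 - \<gamma> (s - t)" for s
  proof -
    have "2 * \<gamma> (s - t) = (\<integral>w. (W s w)\<^sup>2 + (W t w)\<^sup>2 - 2 * (W t w * W s w) \<partial>M)"
      unfolding Winc[symmetric] by (intro Bochner_Integration.integral_cong) (auto simp: power2_eq_square algebra_simps)
    also have "\<dots> = \<sigma>2 s + \<sigma>2 t - 2 * (\<integral>w. W t w * W s w \<partial>M)"
      using W2 WW by (simp add: EW2)
    finally show ?thesis by (simp add: field_simps)
  qed
  have "(\<integral>\<^sup>+w. ennreal (exp (X t w)) \<partial>M) = (\<integral>\<^sup>+w. ennreal (exp (- \<sigma>2 t / 2)) * ennreal (exp (W t w)) \<partial>M)"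
    by (intro nn_integral_cong) (simp add: X_def ennreal_mult[symmetric] exp_add[symmetric])
  also have "\<dots> = ennreal (exp (- \<sigma>2 t / 2)) * ennreal (exp (\<sigma>2 t / 2))"
    using gaussian_rv_mgf[OF M WG, of t] by (simp add: nn_integral_cmult EW EW2)
  also have "\<dots> = 1" by (simp add: ennreal_mult[symmetric] exp_add[symmetric])
  finally have one: "(\<integral>\<^sup>+w. ennreal (exp (X t w)) \<partial>M) = 1" .
  show Q: "prob_space (Q t)"
    by (rule prob_spaceI) (simp add: Q_def emeasure_density one cong: nn_integral_cong_simp)
  show "same_fdd (Q t) (\<lambda>s w. X s w - X t w) N (\<lambda>s w. Z (s - t) w)"
    unfolding same_fdd_def
  proof (intro allI impI)
    fix S :: "'t set" assume S: "finite S"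
    have mX: "(\<lambda>w. \<lambda>s\<in>S. X s w - X t w) \<in> measurable (Q t) (\<Pi>\<^sub>M s\<in>S. borel)"
      unfolding Q_def by (intro measurable_restrict) simp
    have mZ: "(\<lambda>w. \<lambda>s\<in>S. Z (s - t) w) \<in> measurable N (\<Pi>\<^sub>M s\<in>S. borel)"
      by (intro measurable_restrict) simp
    show "distr (Q t) (\<Pi>\<^sub>M s\<in>S. borel) (\<lambda>w. \<lambda>s\<in>S. X s w - X t w) = distr N (\<Pi>\<^sub>M s\<in>S. borel) (\<lambda>w. \<lambda>s\<in>S. Z (s - t) w)"
    proof (rule Cramer_Wold[OF _ _ S])
      fix c :: "'t \<Rightarrow> real"
      define \<kappa> where "\<kappa> = (\<Sum>s\<in>S. \<Sum>s'\<in>S. c s * c s' * ((2 * \<gamma> (s - t) + 2 * \<gamma> (s' - t) - 2 * \<gamma> (s - s')) / 2))"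
      define m where "m = - (\<Sum>s\<in>S. c s * \<gamma> (s - t))"
      define V where "V w = (\<Sum>s\<in>S. c s * (W s w - W t w))" for w
      define k where "k = (\<Sum>s\<in>S. c s * (\<sigma>2 s / 2 - \<sigma>2 t / 2))"
      have [measurable]: "V \<in> borel_measurable M" unfolding V_def[abs_def] by measurable
      have inc2: "integrable M (\<lambda>w. (W s w - W t w)\<^sup>2)" for s
      proof -
        have "integrable M (\<lambda>w. (W s w)\<^sup>2 + (W t w)\<^sup>2 - 2 * (W t w * W s w))"
          using W2 WW by simp
        then show ?thesis
          by (rule Bochner_Integration.integrable_cong[THEN iffD1, rotated 2]) (auto simp: power2_eq_square algebra_simps)
      qed
      have G: "gaussian_rv M (\<lambda>w. a * W t w + b * V w)" for a b
      proof -
        \<comment> \<open>The point \<open>t\<close> may or may not belong to \<open>S\<close>; its coefficient collects both contributions.\<close>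
        define d where "d s = (if s \<in> S then b * c s else 0) + (if s = t then a - b * (\<Sum>s\<in>S. c s) else 0)" for s
        have "(\<Sum>s\<in>insert t S. d s * W s w) = a * W t w + b * V w" for w
        proof -
          have "(\<Sum>s\<in>insert t S. d s * W s w) = (\<Sum>s\<in>insert t S. if s \<in> S then b * c s * W s w else 0)
              + (\<Sum>s\<in>insert t S. if s = t then (a - b * (\<Sum>s\<in>S. c s)) * W t w else 0)"
            unfolding sum.distrib[symmetric] by (intro sum.cong) (auto simp: d_def distrib_right)
          also have "(\<Sum>s\<in>insert t S. if s \<in> S then b * c s * W s w else 0) = (\<Sum>s\<in>S. b * c s * W s w)"
            using S by (intro sum.mono_neutral_cong_right) auto
          also have "(\<Sum>s\<in>insert t S. if s = t then (a - b * (\<Sum>s\<in>S. c s)) * W t w else 0) = (a - b * (\<Sum>s\<in>S. c s)) * W t w"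
            using S by simp
          finally show ?thesis
            by (simp add: V_def sum_distrib_left sum_distrib_right sum_subtractf algebra_simps)
        qed
        then show ?thesis
          using Wg[unfolded gaussian_field_def, rule_format, of "insert t S" d] S by simp
      qed
      have EV: "(\<integral>w. V w \<partial>M) = 0"
        using W1 by (simp add: V_def EW)
      have EV2: "(\<integral>w. (V w)\<^sup>2 \<partial>M) = \<kappa>"
      proof -
        have "W s w - W t w - (W s' w - W t w) = W s w - W s' w" for s s' w by simp
        then show ?thesis unfolding V_def \<kappa>_def
          by (subst second_moment_sum[where q="\<lambda>s. 2 * \<gamma> (s - t)" and r="\<lambda>s s'. 2 * \<gamma> (s - s')"]) (auto simp: Winc inc2)
      qed
      have EUV: "(\<integral>w. W t w * V w \<partial>M) = k + m"
      proof -
        have "(\<integral>w. W t w * V w \<partial>M) = (\<integral>w. (\<Sum>s\<in>S. c s * (W t w * W s w - (W t w)\<^sup>2)) \<partial>M)"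
          by (intro Bochner_Integration.integral_cong) (auto simp: V_def sum_distrib_left power2_eq_square algebra_simps)
        also have "\<dots> = (\<Sum>s\<in>S. c s * ((\<sigma>2 s + \<sigma>2 t) / 2 - \<gamma> (s - t) - \<sigma>2 t))"
          using W2 WW by (simp add: cov EW2)
        also have "\<dots> = k + m"
          unfolding k_def m_def sum_negf[symmetric] sum.distrib[symmetric] by (intro sum.cong) (auto simp: field_simps)
        finally show ?thesis .
      qed
      have CM: "(CLINT w|M. complex_of_real (exp (X t w)) * iexp (V w)) = exp (\<i> * of_real (k + m) - of_real \<kappa> / 2)"
        using Cameron_Martin[OF M G EW EV] unfolding EW2 EV2 EUV X_def by simp
      have "(CLINT x|distr (Q t) (\<Pi>\<^sub>M s\<in>S. borel) (\<lambda>w. \<lambda>s\<in>S. X s w - X t w). iexp (\<Sum>s\<in>S. c s * x s)) =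
          (CLINT w|Q t. iexp (\<Sum>s\<in>S. c s * (X s w - X t w)))"
        using S by (subst integral_distr[OF mX]) (auto intro!: Bochner_Integration.integral_cong arg_cong[where f=iexp] sum.cong)
      also have "\<dots> = (CLINT w|M. exp (X t w) *\<^sub>R iexp (\<Sum>s\<in>S. c s * (X s w - X t w)))"
        unfolding Q_def by (subst integral_density) auto
      also have "\<dots> = (CLINT w|M. iexp (- k) * (complex_of_real (exp (X t w)) * iexp (V w)))"
      proof (intro Bochner_Integration.integral_cong refl)
        fix w
        have "(\<Sum>s\<in>S. c s * (X s w - X t w)) = - k + V w"
          unfolding k_def V_def X_def sum_negf[symmetric] sum.distrib[symmetric] by (intro sum.cong) (auto simp: algebra_simps)
        then have "iexp (\<Sum>s\<in>S. c s * (X s w - X t w)) = iexp (- k) * iexp (V w)"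
          by (simp only: exp_add[symmetric] distrib_left[symmetric] of_real_add[symmetric])
        then show "exp (X t w) *\<^sub>R iexp (\<Sum>s\<in>S. c s * (X s w - X t w)) = iexp (- k) * (complex_of_real (exp (X t w)) * iexp (V w))"
          by (simp only: scaleR_conv_of_real mult_ac)
      qed
      also have "\<dots> = iexp (- k) * exp (\<i> * of_real (k + m) - of_real \<kappa> / 2)"
        by (simp only: integral_mult_right_zero CM)
      also have "\<dots> = exp (\<i> * of_real m - of_real \<kappa> / 2)"
        by (simp only: exp_add[symmetric]) (simp add: algebra_simps)
      also have "\<dots> = (CLINT w|N. iexp (\<Sum>s\<in>S. c s * Z (s - t) w))"
      proof -
        define Y where "Y w = (\<Sum>s\<in>S. c s * Z (s - t) w)" for w
        have "Y = (\<lambda>w. \<Sum>u\<in>(\<lambda>s. s - t) ` S. c (u + t) * Z u w)"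
          by (subst sum.reindex) (auto simp: inj_on_def Y_def fun_eq_iff)
        then have GY: "gaussian_rv N Y"
          using Zg S unfolding gaussian_field_def by auto
        have EY: "(\<integral>w. Y w \<partial>N) = m"
          using Z1 by (simp add: Y_def m_def EZ sum_negf)
        have "(\<integral>w. (Y w - m)\<^sup>2 \<partial>N) = (\<integral>w. (\<Sum>s\<in>S. c s * (Z (s - t) w + \<gamma> (s - t)))\<^sup>2 \<partial>N)"
          by (intro Bochner_Integration.integral_cong) (auto simp: Y_def m_def sum.distrib distrib_left)
        also have "\<dots> = \<kappa>" unfolding \<kappa>_def
        proof (rule second_moment_sum)
          show "integrable N (\<lambda>w. (Z (s - t) w + \<gamma> (s - t))\<^sup>2)" for s
          proof -
            have "integrable N (\<lambda>w. (Z (s - t) w)\<^sup>2 + 2 * \<gamma> (s - t) * Z (s - t) w + (\<gamma> (s - t))\<^sup>2)"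
              using Z2 Z1 by simp
            then show ?thesis
              by (rule Bochner_Integration.integrable_cong[THEN iffD1, rotated 2]) (auto simp: power2_eq_square algebra_simps)
          qed
          show "(\<integral>w. ((Z (s - t) w + \<gamma> (s - t)) - (Z (s' - t) w + \<gamma> (s' - t)))\<^sup>2 \<partial>N) = 2 * \<gamma> (s - s')" for s s'
            using Zinc[of "s - t" "s' - t"] by simp
        qed (auto simp: EZ2)
        finally have VY: "(\<integral>w. (Y w - m)\<^sup>2 \<partial>N) = \<kappa>" .
        show ?thesis
          using gaussian_rv_char[OF N GY, of 1] unfolding EY VY by (simp add: Y_def)
      qed
      also have "\<dots> = (CLINT x|distr N (\<Pi>\<^sub>M s\<in>S. borel) (\<lambda>w. \<lambda>s\<in>S. Z (s - t) w). iexp (\<Sum>s\<in>S. c s * x s))"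
        using S by (subst integral_distr[OF mZ]) (auto intro!: Bochner_Integration.integral_cong arg_cong[where f=iexp] sum.cong)
      finally show "(CLINT x|distr (Q t) (\<Pi>\<^sub>M s\<in>S. borel) (\<lambda>w. \<lambda>s\<in>S. X s w - X t w). iexp (\<Sum>s\<in>S. c s * x s)) =
        (CLINT x|distr N (\<Pi>\<^sub>M s\<in>S. borel) (\<lambda>w. \<lambda>s\<in>S. Z (s - t) w). iexp (\<Sum>s\<in>S. c s * x s))" .
    qed (use mX mZ Q N in \<open>auto intro: prob_space.prob_space_distr\<close>)
  qed
qed

section \<open>Path averages of jointly measurable fields\<close>

text \<open>
  The three equations say that the integral of \<open>(u - v)\<^sup>2\<close> vanishes.  The detour through real
  numbers is needed because subtraction on \<open>ennreal\<close> is truncated.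
\<close>

lemma AE_eq_of_second_moments:
  fixes u v :: "'w \<Rightarrow> ennreal"
  assumes [measurable]: "u \<in> borel_measurable M" "v \<in> borel_measurable M"
    and uu: "(\<integral>\<^sup>+w. u w * u w \<partial>M) = K" and uv: "(\<integral>\<^sup>+w. u w * v w \<partial>M) = K" and vv: "(\<integral>\<^sup>+w. v w * v w \<partial>M) = K"
    and K: "K < \<infinity>"
  shows "AE w in M. u w = v w"
proof -
  have "AE w in M. u w * u w \<noteq> \<infinity>" "AE w in M. v w * v w \<noteq> \<infinity>"
    by (rule nn_integral_PInf_AE; use uu vv K in force)+
  then have fin: "AE w in M. u w < \<infinity> \<and> v w < \<infinity>"
    by eventually_elim (auto simp: ennreal_mult_eq_top_iff less_top[symmetric])
  define d where "d w = ennreal ((enn2real (u w) - enn2real (v w))\<^sup>2)" for w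
  have [measurable]: "d \<in> borel_measurable M" by (simp add: d_def[abs_def])
  have "AE w in M. u w * u w + v w * v w = 2 * (u w * v w) + d w"
    using fin
  proof eventually_elim
    fix w assume "u w < \<infinity> \<and> v w < \<infinity>"
    then obtain a b where "u w = ennreal a" "v w = ennreal b" "0 \<le> a" "0 \<le> b"
      by (cases "u w"; cases "v w") auto
    moreover have "a * a + b * b = 2 * (a * b) + (a - b)\<^sup>2" by (simp add: power2_eq_square algebra_simps)
    moreover have "2 * ennreal (a * b) = ennreal (2 * (a * b))"
      using \<open>0 \<le> a\<close> \<open>0 \<le> b\<close> by (simp add: ennreal_mult)
    ultimately show "u w * u w + v w * v w = 2 * (u w * v w) + d w"
      by (simp add: d_def ennreal_mult[symmetric] ennreal_plus[symmetric] del: ennreal_plus)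
  qed
  then have "(\<integral>\<^sup>+w. u w * u w + v w * v w \<partial>M) = (\<integral>\<^sup>+w. 2 * (u w * v w) + d w \<partial>M)"
    by (rule nn_integral_cong_AE)
  then have "2 * K + 0 = 2 * K + (\<integral>\<^sup>+w. d w \<partial>M)"
    by (simp add: nn_integral_add nn_integral_cmult uu vv uv mult_2)
  then have "(\<integral>\<^sup>+w. d w \<partial>M) = 0"
    using K by (subst (asm) ennreal_add_left_cancel) (auto simp: ennreal_mult_eq_top_iff)
  then have "AE w in M. d w = 0" by (simp add: nn_integral_0_iff_AE)
  with fin show ?thesis
  proof eventually_elim
    fix w assume *: "u w < \<infinity> \<and> v w < \<infinity>" "d w = 0"
    then have "enn2real (u w) = enn2real (v w)" by (simp add: d_def)
    then show "u w = v w" using * by (metis ennreal_enn2real infinity_ennreal_def)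
  qed
qed

text \<open>
  The path functional that reproduces the average of \<open>f\<close> along the path: weight the law of the
  field by this average and take the density with respect to the unweighted law.  It is the
  conditional expectation of the average given the path, as a function on path space.
\<close>

definition average_density ::
  "'v measure \<Rightarrow> ('t \<Rightarrow> 'v \<Rightarrow> real) \<Rightarrow> 't measure \<Rightarrow> (real \<Rightarrow> ennreal) \<Rightarrow> ('t \<Rightarrow> real) \<Rightarrow> ennreal" where
  "average_density M X \<mu> f = RN_deriv (distr M (\<Pi>\<^sub>M t\<in>UNIV. borel) (\<lambda>w t. X t w))
     (distr (density M (\<lambda>w. \<integral>\<^sup>+t. f (X t w) \<partial>\<mu>)) (\<Pi>\<^sub>M t\<in>UNIV. borel) (\<lambda>w t. X t w))"

lemma measurable_field_coordinate:
  assumes "measurable_field M X" shows "X t \<in> borel_measurable M"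
proof -
  have "(\<lambda>w. case (w, t) of (w, t) \<Rightarrow> X t w) \<in> borel_measurable M"
    by (rule measurable_compose[OF _ assms[unfolded measurable_field_def]]) simp
  then show ?thesis by simp
qed

lemma measurable_field_average:
  assumes X: "measurable_field M X" and \<mu>: "prob_space \<mu>" "sets \<mu> = sets borel"
    and f[measurable]: "f \<in> borel_measurable borel"
  shows "(\<lambda>w. \<integral>\<^sup>+t. f (X t w) \<partial>\<mu>) \<in> borel_measurable M"
    and "(\<lambda>(w, t). f (X t w)) \<in> borel_measurable (M \<Otimes>\<^sub>M \<mu>)"
proof -
  interpret prob_space \<mu> by fact
  have "sets (M \<Otimes>\<^sub>M \<mu>) = sets (M \<Otimes>\<^sub>M borel)"
    using \<mu>(2) by (intro sets_pair_measure_cong) auto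
  then have "(\<lambda>(w, t). X t w) \<in> borel_measurable (M \<Otimes>\<^sub>M \<mu>)"
    using X unfolding measurable_field_def by (simp cong: measurable_cong_sets)
  then have "(\<lambda>p. f ((\<lambda>(w, t). X t w) p)) \<in> borel_measurable (M \<Otimes>\<^sub>M \<mu>)"
    by (rule measurable_compose) simp
  then show *: "(\<lambda>(w, t). f (X t w)) \<in> borel_measurable (M \<Otimes>\<^sub>M \<mu>)"
    by (simp add: case_prod_beta')
  show "(\<lambda>w. \<integral>\<^sup>+t. f (X t w) \<partial>\<mu>) \<in> borel_measurable M"
    using borel_measurable_nn_integral[of "\<lambda>w t. f (X t w)" M] * by simp
qed

text \<open>
  Fubini; joint measurability of the field enters the theory of averages here.
\<close>

lemma nn_integral_average_mult:
  fixes Y :: "'t::topological_space \<Rightarrow> 'w \<Rightarrow> real"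
  assumes N: "prob_space N" and Y: "measurable_field N Y" and \<mu>: "prob_space \<mu>" "sets \<mu> = sets borel"
    and f[measurable]: "f \<in> borel_measurable borel" and [measurable]: "g \<in> borel_measurable N"
  shows "(\<integral>\<^sup>+w. (\<integral>\<^sup>+t. f (Y t w) \<partial>\<mu>) * g w \<partial>N) = (\<integral>\<^sup>+t. (\<integral>\<^sup>+w. f (Y t w) * g w \<partial>N) \<partial>\<mu>)"
proof -
  interpret N: prob_space N by fact
  interpret \<mu>: prob_space \<mu> by fact
  interpret pair_sigma_finite N \<mu> by unfold_locales
  have fY[measurable]: "(\<lambda>(w, t). f (Y t w)) \<in> borel_measurable (N \<Otimes>\<^sub>M \<mu>)"
    by (rule measurable_field_average[OF Y \<mu> f])
  have fY': "(\<lambda>t. f (Y t w)) \<in> borel_measurable \<mu>" if "w \<in> space N" for w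
    using measurable_compose[OF measurable_Pair1'[OF that] fY] by simp
  have "(\<integral>\<^sup>+w. (\<integral>\<^sup>+t. f (Y t w) \<partial>\<mu>) * g w \<partial>N) = (\<integral>\<^sup>+w. (\<integral>\<^sup>+t. f (Y t w) * g w \<partial>\<mu>) \<partial>N)"
    using fY' by (intro nn_integral_cong) (simp add: nn_integral_multc)
  also have "\<dots> = (\<integral>\<^sup>+t. (\<integral>\<^sup>+w. f (Y t w) * g w \<partial>N) \<partial>\<mu>)"
    by (rule Fubini'[symmetric]) measurable
  finally show ?thesis .
qed

text \<open>
  The right-hand side mentions the law of the field only, so two fields with the same law give
  the same weighted law.
\<close>

lemma average_weighted_law:
  fixes Y :: "'t::topological_space \<Rightarrow> 'w \<Rightarrow> real"
  assumes N: "prob_space N" and Y: "measurable_field N Y" and \<mu>: "prob_space \<mu>" "sets \<mu> = sets borel"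
    and f[measurable]: "f \<in> borel_measurable borel" and h[measurable]: "h \<in> borel_measurable (\<Pi>\<^sub>M t\<in>UNIV. borel)"
  shows "(\<integral>\<^sup>+w. (\<integral>\<^sup>+t. f (Y t w) \<partial>\<mu>) * h (\<lambda>t. Y t w) \<partial>N) =
    (\<integral>\<^sup>+t. (\<integral>\<^sup>+x. f (x t) * h x \<partial>distr N (\<Pi>\<^sub>M t\<in>UNIV. borel) (\<lambda>w t. Y t w)) \<partial>\<mu>)"
proof -
  have [measurable]: "Y t \<in> borel_measurable N" for t by (rule measurable_field_coordinate[OF Y])
  have Ym[measurable]: "(\<lambda>w t. Y t w) \<in> measurable N (\<Pi>\<^sub>M t\<in>UNIV. borel)"
    by (auto intro!: measurable_PiM_single')
  have "(\<integral>\<^sup>+x. f (x t) * h x \<partial>distr N (\<Pi>\<^sub>M t\<in>UNIV. borel) (\<lambda>w t. Y t w)) = (\<integral>\<^sup>+w. f (Y t w) * h (\<lambda>t. Y t w) \<partial>N)" for t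
    by (subst nn_integral_distr) auto
  then show ?thesis
    using nn_integral_average_mult[OF N Y \<mu> f measurable_compose[OF Ym h]] by simp
qed

text \<open>
  Let \<open>I\<close> be the average along \<open>Y\<close> and \<open>\<phi>(Y)\<close> its conditional expectation given the path.
  Averaging over \<open>t\<close> the defining relation \<open>E [I f(Y t)] = E [\<phi>(Y) f(Y t)]\<close> gives
  \<open>E [I\<^sup>2] = E [\<phi>(Y) I] = E [\<phi>(Y)\<^sup>2]\<close>, so \<open>I = \<phi>(Y)\<close> almost surely.  Boundedness of \<open>f\<close> makes
  these moments finite.  The functional is built from the field \<open>X\<close>, which may live on another
  probability space.
\<close>

lemma average_density_bounded:
  fixes X :: "'t::topological_space \<Rightarrow> 'v \<Rightarrow> real" and Y :: "'t \<Rightarrow> 'w \<Rightarrow> real"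
  assumes M: "prob_space M" and X: "measurable_field M X" and N: "prob_space N" and Y: "measurable_field N Y"
    and law: "distr M (\<Pi>\<^sub>M t\<in>UNIV. borel) (\<lambda>w t. X t w) = distr N (\<Pi>\<^sub>M t\<in>UNIV. borel) (\<lambda>w t. Y t w)"
    and \<mu>: "prob_space \<mu>" "sets \<mu> = sets borel"
    and f[measurable]: "f \<in> borel_measurable borel" and B: "\<And>x. f x \<le> ennreal B"
  shows "AE w in N. (\<integral>\<^sup>+t. f (Y t w) \<partial>\<mu>) = average_density M X \<mu> f (\<lambda>t. Y t w)"
proof -
  interpret N: prob_space N by fact
  interpret \<mu>: prob_space \<mu> by fact
  define P where "P = distr N (\<Pi>\<^sub>M t\<in>UNIV. borel) (\<lambda>w t. Y t w)"
  define I where "I w = (\<integral>\<^sup>+t. f (Y t w) \<partial>\<mu>)" for w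
  define \<phi> where "\<phi> = average_density M X \<mu> f"
  have [measurable]: "X t \<in> borel_measurable M" "Y t \<in> borel_measurable N" for t
    using measurable_field_coordinate X Y by auto
  have Xm[measurable]: "(\<lambda>w t. X t w) \<in> measurable M (\<Pi>\<^sub>M t\<in>UNIV. borel)"
    and Ym[measurable]: "(\<lambda>w t. Y t w) \<in> measurable N (\<Pi>\<^sub>M t\<in>UNIV. borel)"
    by (auto intro!: measurable_PiM_single')
  have IX[measurable]: "(\<lambda>w. \<integral>\<^sup>+t. f (X t w) \<partial>\<mu>) \<in> borel_measurable M"
    and IY[measurable]: "I \<in> borel_measurable N"
    unfolding I_def[abs_def] using measurable_field_average(1)[OF X \<mu> f] measurable_field_average(1)[OF Y \<mu> f] by auto
  interpret P: prob_space P unfolding P_def by (rule N.prob_space_distr) simp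
  define \<Lambda> where "\<Lambda> = distr (density N I) (\<Pi>\<^sub>M t\<in>UNIV. borel) (\<lambda>w t. Y t w)"
  have \<Lambda>: "\<Lambda> = distr (density M (\<lambda>w. \<integral>\<^sup>+t. f (X t w) \<partial>\<mu>)) (\<Pi>\<^sub>M t\<in>UNIV. borel) (\<lambda>w t. X t w)"
  proof (rule measure_eqI)
    fix A assume "A \<in> sets \<Lambda>"
    then have A[measurable]: "A \<in> sets (\<Pi>\<^sub>M t\<in>UNIV. borel)" by (simp add: \<Lambda>_def)
    have 1: "emeasure \<Lambda> A = (\<integral>\<^sup>+w. I w * indicator A (\<lambda>t. Y t w) \<partial>N)"
      unfolding \<Lambda>_def by (subst emeasure_distr) (auto simp: emeasure_density indicator_def intro!: nn_integral_cong)
    have 2: "emeasure (distr (density M (\<lambda>w. \<integral>\<^sup>+t. f (X t w) \<partial>\<mu>)) (\<Pi>\<^sub>M t\<in>UNIV. borel) (\<lambda>w t. X t w)) A =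
       (\<integral>\<^sup>+w. (\<integral>\<^sup>+t. f (X t w) \<partial>\<mu>) * indicator A (\<lambda>t. X t w) \<partial>M)"
      by (subst emeasure_distr) (auto simp: emeasure_density indicator_def intro!: nn_integral_cong)
    show "emeasure \<Lambda> A = emeasure (distr (density M (\<lambda>w. \<integral>\<^sup>+t. f (X t w) \<partial>\<mu>)) (\<Pi>\<^sub>M t\<in>UNIV. borel) (\<lambda>w t. X t w)) A"
      unfolding 1 2 I_def
      by (subst average_weighted_law[OF N Y \<mu> f], simp, subst average_weighted_law[OF M X \<mu> f], simp, simp only: law)
  qed (simp add: \<Lambda>_def)
  have \<phi>: "\<phi> = RN_deriv P \<Lambda>"
    by (simp add: \<phi>_def average_density_def \<Lambda> P_def law)
  \<comment> \<open>So that the density recovers the weighted law.\<close>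
  have ac: "absolutely_continuous P \<Lambda>"
    unfolding absolutely_continuous_def
  proof
    fix A assume "A \<in> null_sets P"
    then have A: "A \<in> sets (\<Pi>\<^sub>M t\<in>UNIV. borel)" and 0: "emeasure P A = 0"
      by (auto simp: P_def)
    have "emeasure N ((\<lambda>w t. Y t w) -` A \<inter> space N) = 0"
      using 0 A by (simp add: P_def emeasure_distr)
    then have "(\<lambda>w t. Y t w) -` A \<inter> space N \<in> null_sets N"
      using A Ym by (auto intro: measurable_sets)
    then have "(\<lambda>w t. Y t w) -` A \<inter> space N \<in> null_sets (density N I)"
      using absolutely_continuousI_density[OF IY] by (auto simp: absolutely_continuous_def)
    then show "A \<in> null_sets \<Lambda>"
      using A by (auto simp: \<Lambda>_def null_sets_def emeasure_distr)
  qed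
  have dens: "density P \<phi> = \<Lambda>"
    unfolding \<phi> by (rule P.density_RN_deriv[OF ac]) (simp add: P_def \<Lambda>_def)
  have \<phi>m: "\<phi> \<in> borel_measurable (\<Pi>\<^sub>M t\<in>UNIV. borel)"
    using borel_measurable_RN_deriv[of P \<Lambda>] unfolding \<phi> by (simp add: P_def cong: measurable_cong_sets)
  have \<phi>Y[measurable]: "(\<lambda>w. \<phi> (\<lambda>t. Y t w)) \<in> borel_measurable N"
    by (rule measurable_compose[OF Ym \<phi>m])
  have proj: "(\<integral>\<^sup>+w. I w * h (\<lambda>t. Y t w) \<partial>N) = (\<integral>\<^sup>+w. \<phi> (\<lambda>t. Y t w) * h (\<lambda>t. Y t w) \<partial>N)"
    if h[measurable]: "h \<in> borel_measurable (\<Pi>\<^sub>M t\<in>UNIV. borel)" for h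
  proof -
    have "(\<integral>\<^sup>+w. I w * h (\<lambda>t. Y t w) \<partial>N) = (\<integral>\<^sup>+x. h x \<partial>\<Lambda>)"
      unfolding \<Lambda>_def by (subst nn_integral_distr) (auto simp: nn_integral_density measurable_compose[OF Ym h])
    also have "\<dots> = (\<integral>\<^sup>+x. \<phi> x * h x \<partial>P)"
      unfolding dens[symmetric] using \<phi>m by (subst nn_integral_density) (auto simp: P_def cong: measurable_cong_sets)
    also have "\<dots> = (\<integral>\<^sup>+w. \<phi> (\<lambda>t. Y t w) * h (\<lambda>t. Y t w) \<partial>N)"
      unfolding P_def using \<phi>m by (subst nn_integral_distr) auto
    finally show ?thesis .
  qed
  have I\<phi>: "(\<integral>\<^sup>+w. I w * \<phi> (\<lambda>t. Y t w) \<partial>N) = (\<integral>\<^sup>+w. \<phi> (\<lambda>t. Y t w) * \<phi> (\<lambda>t. Y t w) \<partial>N)"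
    by (rule proj[OF \<phi>m])
  have fubini: "(\<integral>\<^sup>+w. I w * g w \<partial>N) = (\<integral>\<^sup>+t. (\<integral>\<^sup>+w. f (Y t w) * g w \<partial>N) \<partial>\<mu>)"
    if "g \<in> borel_measurable N" for g
    unfolding I_def using that by (rule nn_integral_average_mult[OF N Y \<mu> f])
  have "(\<integral>\<^sup>+w. I w * I w \<partial>N) = (\<integral>\<^sup>+t. (\<integral>\<^sup>+w. f (Y t w) * I w \<partial>N) \<partial>\<mu>)"
    by (rule fubini) simp
  also have "\<dots> = (\<integral>\<^sup>+t. (\<integral>\<^sup>+w. f (Y t w) * \<phi> (\<lambda>t. Y t w) \<partial>N) \<partial>\<mu>)"
    using proj[of "\<lambda>x. f (x t)" for t] by (simp add: mult.commute)
  also have "\<dots> = (\<integral>\<^sup>+w. I w * \<phi> (\<lambda>t. Y t w) \<partial>N)"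
    by (rule fubini[symmetric]) simp
  finally have II: "(\<integral>\<^sup>+w. I w * I w \<partial>N) = (\<integral>\<^sup>+w. \<phi> (\<lambda>t. Y t w) * \<phi> (\<lambda>t. Y t w) \<partial>N)"
    unfolding I\<phi> .
  have "I w \<le> ennreal B" for w
    unfolding I_def using nn_integral_mono[of \<mu> "\<lambda>t. f (Y t w)" "\<lambda>_. ennreal B"] B
    by (simp add: \<mu>.emeasure_space_1)
  then have "(\<integral>\<^sup>+w. I w * I w \<partial>N) \<le> (\<integral>\<^sup>+w. ennreal B * ennreal B \<partial>N)"
    by (intro nn_integral_mono mult_mono) auto
  also have "\<dots> < \<infinity>" by (simp add: N.emeasure_space_1 ennreal_mult_less_top)
  finally have "AE w in N. I w = \<phi> (\<lambda>t. Y t w)"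
    by (intro AE_eq_of_second_moments[OF _ _ II I\<phi> refl]) (auto simp: II)
  then show ?thesis unfolding I_def \<phi>_def .
qed

definition average_functional ::
  "'v measure \<Rightarrow> ('t \<Rightarrow> 'v \<Rightarrow> real) \<Rightarrow> 't measure \<Rightarrow> (real \<Rightarrow> ennreal) \<Rightarrow> ('t \<Rightarrow> real) \<Rightarrow> ennreal" where
  "average_functional M X \<mu> f x = (SUP n. average_density M X \<mu> (\<lambda>r. min (f r) (of_nat n)) x)"

lemma measurable_average_functional[measurable]:
  "average_functional M X \<mu> f \<in> borel_measurable (\<Pi>\<^sub>M t\<in>UNIV. borel)"
proof -
  have [measurable]: "average_density M X \<mu> g \<in> borel_measurable (\<Pi>\<^sub>M t\<in>UNIV. borel)" for g
    using borel_measurable_RN_deriv unfolding average_density_def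
    by (metis measurable_cong_sets sets_distr)
  show ?thesis unfolding average_functional_def[abs_def] by measurable
qed

text \<open>
  Finite-dimensional distributions and independence on the product sigma-algebra do not speak
  about path averages directly.  They do so through this functional, which represents the average
  along every jointly measurable field with the law of \<open>X\<close>.
\<close>

lemma average_functional:
  fixes X :: "'t::topological_space \<Rightarrow> 'v \<Rightarrow> real" and Y :: "'t \<Rightarrow> 'w \<Rightarrow> real"
  assumes M: "prob_space M" and X: "measurable_field M X" and N: "prob_space N" and Y: "measurable_field N Y"
    and law: "distr M (\<Pi>\<^sub>M t\<in>UNIV. borel) (\<lambda>w t. X t w) = distr N (\<Pi>\<^sub>M t\<in>UNIV. borel) (\<lambda>w t. Y t w)"
    and \<mu>: "prob_space \<mu>" "sets \<mu> = sets borel"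
    and f[measurable]: "f \<in> borel_measurable borel"
  shows "AE w in N. (\<integral>\<^sup>+t. f (Y t w) \<partial>\<mu>) = average_functional M X \<mu> f (\<lambda>t. Y t w)"
proof -
  \<comment> \<open>Truncation gives finite moments; monotone convergence removes it path by path.\<close>
  have "AE w in N. (\<integral>\<^sup>+t. min (f (Y t w)) (of_nat n) \<partial>\<mu>) = average_density M X \<mu> (\<lambda>r. min (f r) (of_nat n)) (\<lambda>t. Y t w)" for n
    by (rule average_density_bounded[OF M X N Y law \<mu>, where B="real n"]) (auto simp: ennreal_of_nat_eq_real_of_nat)
  then have "AE w in N. \<forall>n. (\<integral>\<^sup>+t. min (f (Y t w)) (of_nat n) \<partial>\<mu>) = average_density M X \<mu> (\<lambda>r. min (f r) (of_nat n)) (\<lambda>t. Y t w)"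
    by (simp add: AE_all_countable)
  then show ?thesis
    using AE_space
  proof eventually_elim
    fix w assume eq: "\<forall>n. (\<integral>\<^sup>+t. min (f (Y t w)) (of_nat n) \<partial>\<mu>) = average_density M X \<mu> (\<lambda>r. min (f r) (of_nat n)) (\<lambda>t. Y t w)"
      and w: "w \<in> space N"
    have [measurable]: "(\<lambda>t. f (Y t w)) \<in> borel_measurable \<mu>"
      using measurable_compose[OF measurable_Pair1'[OF w] measurable_field_average(2)[OF Y \<mu> f]] by simp
    have sup: "(SUP n. min a (of_nat n)) = a" for a :: ennreal
    proof (rule antisym)
      show "a \<le> (SUP n. min a (of_nat n))"
      proof (rule ccontr)
        assume "\<not> a \<le> (SUP n. min a (of_nat n))"
        then obtain y where y: "(SUP n. min a (of_nat n)) < y" "y < a" by (auto simp: not_le dest: dense)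
        then obtain n where "y < of_nat n" by (metis ennreal_Ex_less_of_nat less_le_trans top_greatest top.not_eq_extremum order.strict_trans not_less_iff_gr_or_eq)
        then have "y \<le> min a (of_nat n)" using y by auto
        also have "\<dots> \<le> (SUP n. min a (of_nat n))" by (rule SUP_upper) simp
        finally show False using y by simp
      qed
    qed (auto intro: SUP_least)
    have "(\<integral>\<^sup>+t. f (Y t w) \<partial>\<mu>) = (\<integral>\<^sup>+t. (SUP n. min (f (Y t w)) (of_nat n)) \<partial>\<mu>)"
      by (simp add: sup)
    also have "\<dots> = (SUP n. \<integral>\<^sup>+t. min (f (Y t w)) (of_nat n) \<partial>\<mu>)"
      by (rule nn_integral_monotone_convergence_SUP) (auto simp: incseq_def le_fun_def intro: min.coboundedI2)
    finally show "(\<integral>\<^sup>+t. f (Y t w) \<partial>\<mu>) = average_functional M X \<mu> f (\<lambda>t. Y t w)"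
      using eq by (simp add: average_functional_def)
  qed
qed

section \<open>Void probabilities of marked Poisson processes\<close>

text \<open>
  The value at an infinite count is \<open>0\<close> also for \<open>q = 1\<close>, so that the generating function at
  \<open>1\<close> is the probability of a finite count.
\<close>

definition power_count :: "real \<Rightarrow> ennreal \<Rightarrow> real" where
  "power_count q n = (if n = \<infinity> then 0 else q ^ nat \<lfloor>enn2real n\<rfloor>)"

lemma power_count_of_nat: "power_count q (of_nat k) = q ^ k"
  by (simp add: power_count_def ennreal_of_nat_eq_real_of_nat)

lemma measurable_power_count[measurable]: "power_count q \<in> borel_measurable borel"
  unfolding power_count_def[abs_def] by measurable

lemma point_count_cases:
  obtains (infinite) "infinite {i. X i w \<in> B}" "point_count X B w = \<infinity>"
  | (finite) "finite {i. X i w \<in> B}" "point_count X B w = of_nat (card {i. X i w \<in> B})"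
  by (cases "finite {i. X i w \<in> B}") (auto simp: point_count_def)

lemma measurable_point_count:
  assumes N: "prob_space N" and P: "poisson_points N \<nu> X" and B: "B \<in> sets \<nu>"
  shows "point_count X B \<in> borel_measurable N"
proof -
  interpret prob_space N by fact
  have "\<forall>(J::nat set) B. finite J \<longrightarrow> (\<forall>j\<in>J. B j \<in> sets \<nu>) \<longrightarrow> disjoint_family_on B J \<longrightarrow> indep_vars (\<lambda>_. borel) (\<lambda>j. point_count X (B j)) J"
    using P unfolding poisson_points_def by blast
  from this[rule_format, of "{0}" "\<lambda>_. B"] B show ?thesis
    by (simp add: indep_vars_def disjoint_family_on_def)
qed

lemma poisson_generating_function:
  assumes N: "prob_space N" and P: "poisson_points N \<nu> X"
    and B: "B \<in> sets \<nu>" "emeasure \<nu> B < \<infinity>" and q: "0 \<le> q" "q \<le> 1"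
  shows "(\<integral>w. power_count q (point_count X B w) \<partial>N) = exp (- ((1 - q) * measure \<nu> B))"
proof -
  interpret prob_space N by fact
  have [measurable]: "point_count X B \<in> borel_measurable N"
    by (rule measurable_point_count[OF N P B(1)])
  define l where "l = measure \<nu> B"
  have pk: "prob {w \<in> space N. point_count X B w = of_nat k} = l ^ k / fact k * exp (- l)" for k
    using P B unfolding poisson_points_def l_def by blast
  have l: "0 \<le> l" by (simp add: l_def)
  have nn: "0 \<le> power_count q n" for n using q by (simp add: power_count_def)
  have split: "ennreal (power_count q (point_count X B w)) = (\<Sum>k. ennreal (q ^ k) * indicator {w \<in> space N. point_count X B w = of_nat k} w)"
    if w: "w \<in> space N" for w
  proof (cases rule: point_count_cases[where X=X and w=w and B=B])
    case infinite
    then show ?thesis by (simp add: power_count_def)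
  next
    case finite
    define n where "n = card {i. X i w \<in> B}"
    have "(\<Sum>k. ennreal (q ^ k) * indicator {w \<in> space N. point_count X B w = of_nat k} w)
       = (\<Sum>k\<in>{n}. ennreal (q ^ k) * indicator {w \<in> space N. point_count X B w = of_nat k} w)"
      using finite by (intro suminf_finite) (auto simp: n_def)
    then show ?thesis using finite w by (simp add: power_count_of_nat n_def[symmetric])
  qed
  have "(\<lambda>k. exp (- l) * ((q * l) ^ k / fact k)) sums (exp (- l) * exp (q * l))"
    using exp_converges[of "q * l"] by (intro sums_mult) (simp add: divide_inverse mult.commute scaleR_conv_of_real)
  then have sums: "(\<lambda>k. q ^ k * (l ^ k / fact k * exp (- l))) sums exp (- ((1 - q) * l))"
    by (simp add: exp_add[symmetric] power_mult_distrib field_simps)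
  have "(\<integral>\<^sup>+w. ennreal (power_count q (point_count X B w)) \<partial>N) =
      (\<integral>\<^sup>+w. (\<Sum>k. ennreal (q ^ k) * indicator {w \<in> space N. point_count X B w = of_nat k} w) \<partial>N)"
    by (intro nn_integral_cong split)
  also have "\<dots> = (\<Sum>k. \<integral>\<^sup>+w. ennreal (q ^ k) * indicator {w \<in> space N. point_count X B w = of_nat k} w \<partial>N)"
    by (rule nn_integral_suminf) measurable
  also have "\<dots> = (\<Sum>k. ennreal (q ^ k * (l ^ k / fact k * exp (- l))))"
    using q l by (simp add: nn_integral_cmult_indicator emeasure_eq_measure pk ennreal_mult[symmetric])
  also have "\<dots> = ennreal (exp (- ((1 - q) * l)))"
    using q l sums by (intro suminf_ennreal_eq) auto
  finally show ?thesis
    using nn by (subst integral_eq_nn_integral) (auto simp: l_def)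
qed

lemma AE_point_count_finite:
  assumes N: "prob_space N" and P: "poisson_points N \<nu> X"
    and B: "B \<in> sets \<nu>" "emeasure \<nu> B < \<infinity>"
  shows "AE w in N. finite {i. X i w \<in> B}"
proof -
  interpret prob_space N by fact
  have [measurable]: "point_count X B \<in> borel_measurable N"
    by (rule measurable_point_count[OF N P B(1)])
  have eq: "power_count 1 n = indicator {..<\<infinity>} n" for n
    by (auto simp: power_count_def indicator_def less_top)
  have "(\<integral>w. indicator {w \<in> space N. point_count X B w < \<infinity>} w \<partial>N) = (\<integral>w. power_count 1 (point_count X B w) \<partial>N)"
    by (intro Bochner_Integration.integral_cong) (auto simp: eq indicator_def)
  also have "\<dots> = 1" using poisson_generating_function[OF N P B, of 1] by simp
  finally have "prob {w \<in> space N. point_count X B w < \<infinity>} = 1" by simp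
  then have "AE w in N. point_count X B w < \<infinity>"
    by (subst (asm) prob_Collect_eq_1) auto
  then show ?thesis
  proof eventually_elim
    fix w assume "point_count X B w < \<infinity>"
    then show "finite {i. X i w \<in> B}"
      by (cases rule: point_count_cases[where X=X and w=w and B=B]) auto
  qed
qed

lemma prod_thinning_tendsto:
  assumes "finite {i. x i \<in> B}"
  shows "(\<lambda>m. \<Prod>i<m. 1 - c * indicator B (x i) :: real) \<longlonglongrightarrow> (1 - c) ^ card {i. x i \<in> B}"
proof -
  define F where "F = {i. x i \<in> B}"
  obtain m0 where m0: "F \<subseteq> {..<m0}"
    using assms finite_nat_iff_bounded by (auto simp: F_def)
  have "(\<Prod>i<m. 1 - c * indicator B (x i)) = (1 - c) ^ card F" if "m \<ge> m0" for m
  proof -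
    have "(\<Prod>i<m. 1 - c * indicator B (x i)) = (\<Prod>i\<in>F. 1 - c)"
      using m0 that by (intro prod.mono_neutral_cong_right) (auto simp: F_def)
    then show ?thesis by simp
  qed
  then have "\<forall>\<^sub>F m in sequentially. (\<Prod>i<m. 1 - c * indicator B (x i)) = (1 - c) ^ card F"
    by (auto simp: eventually_sequentially)
  then show ?thesis unfolding F_def[symmetric] by (rule tendsto_eventually)
qed

text \<open>
  For disjoint sets \<open>1 - (\<Sum>j. c j * indicator (B j))\<close> is the product of the factors
  \<open>1 - c j * indicator (B j)\<close>, so the product over the points is a product of powers
  \<open>(1 - c j)\<close> to the count of \<open>B j\<close>, and independence of the counts gives a product of Poisson
  generating functions.
\<close>

lemma poisson_thinning_step:
  fixes B :: "nat \<Rightarrow> 'x set" and c :: "nat \<Rightarrow> real"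
  assumes N: "prob_space N" and P: "poisson_points N \<nu> X" and J: "finite J"
    and B: "\<And>j. j \<in> J \<Longrightarrow> B j \<in> sets \<nu>" "\<And>j. j \<in> J \<Longrightarrow> emeasure \<nu> (B j) < \<infinity>" "disjoint_family_on B J"
    and c: "\<And>j. j \<in> J \<Longrightarrow> 0 \<le> c j \<and> c j \<le> 1"
  shows "(\<lambda>m. \<integral>w. (\<Prod>i<m. 1 - (\<Sum>j\<in>J. c j * indicator (B j) (X i w))) \<partial>N) \<longlonglongrightarrow>
    exp (- (\<Sum>j\<in>J. c j * measure \<nu> (B j)))"
proof -
  interpret prob_space N by fact
  have Xm[measurable]: "X i \<in> measurable N \<nu>" for i using P by (simp add: poisson_points_def)
  have pc: "point_count X (B j) \<in> borel_measurable N" if "j \<in> J" for j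
    using that B by (intro measurable_point_count[OF N P])
  have factor: "1 - (\<Sum>j\<in>J. c j * indicator (B j) x) = (\<Prod>j\<in>J. 1 - c j * indicator (B j) x)" for x
  proof (cases "\<exists>k\<in>J. x \<in> B k")
    case True
    then obtain k where k: "k \<in> J" "x \<in> B k" by blast
    then have o: "x \<notin> B j" if "j \<in> J" "j \<noteq> k" for j
      using B(3) that by (auto simp: disjoint_family_on_def)
    have "(\<Sum>j\<in>J. c j * indicator (B j) x) = (\<Sum>j\<in>{k}. c j)"
      using k o J by (intro sum.mono_neutral_cong_right) auto
    moreover have "(\<Prod>j\<in>J. 1 - c j * indicator (B j) x) = (\<Prod>j\<in>{k}. 1 - c j)"
      using k o J by (intro prod.mono_neutral_cong_right) auto
    ultimately show ?thesis by simp
  qed auto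
  have bnd: "\<bar>\<Prod>i<m. 1 - (\<Sum>j\<in>J. c j * indicator (B j) (X i w))\<bar> \<le> 1" for m w
  proof -
    define g where "g x = 1 - (\<Sum>j\<in>J. c j * indicator (B j) x)" for x
    have "0 \<le> 1 - c j * indicator (B j) x \<and> 1 - c j * indicator (B j) x \<le> 1" if "j \<in> J" for j x
      using c[OF that] by (simp split: split_indicator)
    then have "0 \<le> g x \<and> g x \<le> 1" for x
      unfolding g_def factor by (intro conjI prod_nonneg prod_le_1) auto
    then have "\<bar>\<Prod>i<m. g (X i w)\<bar> \<le> 1" by (simp add: abs_prod prod_le_1)
    then show ?thesis by (simp only: g_def)
  qed
  have "(\<lambda>m. \<integral>w. (\<Prod>i<m. 1 - (\<Sum>j\<in>J. c j * indicator (B j) (X i w))) \<partial>N) \<longlonglongrightarrow>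
    (\<integral>w. (\<Prod>j\<in>J. power_count (1 - c j) (point_count X (B j) w)) \<partial>N)"
  proof (rule integral_dominated_convergence[where w="\<lambda>_. 1"])
    show "(\<lambda>w. \<Prod>j\<in>J. power_count (1 - c j) (point_count X (B j) w)) \<in> borel_measurable N"
      using pc by (intro borel_measurable_prod measurable_compose[OF _ measurable_power_count]) auto
    show "(\<lambda>w. \<Prod>i<m. 1 - (\<Sum>j\<in>J. c j * indicator (B j) (X i w))) \<in> borel_measurable N" for m
      using B by (intro borel_measurable_prod borel_measurable_diff borel_measurable_sum borel_measurable_times
          measurable_compose[OF Xm borel_measurable_indicator]) auto
    have "AE w in N. \<forall>j\<in>J. finite {i. X i w \<in> B j}"
      using J B by (intro AE_finite_allI AE_point_count_finite[OF N P])
    then show "AE w in N. (\<lambda>m. \<Prod>i<m. 1 - (\<Sum>j\<in>J. c j * indicator (B j) (X i w))) \<longlonglongrightarrow> (\<Prod>j\<in>J. power_count (1 - c j) (point_count X (B j) w))"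
    proof eventually_elim
      fix w assume fin: "\<forall>j\<in>J. finite {i. X i w \<in> B j}"
      have "(\<lambda>m. \<Prod>j\<in>J. \<Prod>i<m. 1 - c j * indicator (B j) (X i w)) \<longlonglongrightarrow> (\<Prod>j\<in>J. (1 - c j) ^ card {i. X i w \<in> B j})"
        using fin by (intro tendsto_prod prod_thinning_tendsto) auto
      moreover have "power_count (1 - c j) (point_count X (B j) w) = (1 - c j) ^ card {i. X i w \<in> B j}" if "j \<in> J" for j
        using fin that by (auto simp: point_count_def power_count_of_nat)
      ultimately show "(\<lambda>m. \<Prod>i<m. 1 - (\<Sum>j\<in>J. c j * indicator (B j) (X i w))) \<longlonglongrightarrow> (\<Prod>j\<in>J. power_count (1 - c j) (point_count X (B j) w))"
        unfolding factor by (subst prod.swap) (simp cong: prod.cong)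
    qed
    show "AE w in N. norm (\<Prod>i<m. 1 - (\<Sum>j\<in>J. c j * indicator (B j) (X i w))) \<le> 1" for m
      using bnd by simp
  qed simp
  also have "(\<integral>w. (\<Prod>j\<in>J. power_count (1 - c j) (point_count X (B j) w)) \<partial>N) =
     (\<Prod>j\<in>J. \<integral>w. power_count (1 - c j) (point_count X (B j) w) \<partial>N)"
  proof (rule indep_vars_lebesgue_integral[OF J])
    have "indep_vars (\<lambda>_. borel) (\<lambda>j. point_count X (B j)) J"
      using P J B unfolding poisson_points_def by blast
    from indep_vars_compose2[OF this, of "\<lambda>j. power_count (1 - c j)" "\<lambda>_. borel"]
    show "indep_vars (\<lambda>_. borel) (\<lambda>j w. power_count (1 - c j) (point_count X (B j) w)) J" by simp
    show "integrable N (\<lambda>w. power_count (1 - c j) (point_count X (B j) w))" if "j \<in> J" for j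
      using that c[OF that] pc[OF that]
      by (intro integrable_const_bound[where B=1] measurable_compose[OF _ measurable_power_count])
         (auto simp: power_count_def power_le_one)
  qed
  also have "\<dots> = (\<Prod>j\<in>J. exp (- (c j * measure \<nu> (B j))))"
    using c B by (intro prod.cong refl) (subst poisson_generating_function[OF N P], auto)
  also have "\<dots> = exp (- (\<Sum>j\<in>J. c j * measure \<nu> (B j)))"
    using J by (simp add: exp_sum[symmetric] sum_negf)
  finally show ?thesis .
qed

text \<open>
  Approximate \<open>u\<close> from below by dyadic step functions \<open>U n\<close>.  Since \<open>U n \<le> u\<close>, the
  expectations for \<open>u\<close> lie below those for \<open>U n\<close>, which tend to \<open>b n\<close>; for each fixed number
  \<open>m\<close> of factors they are also limits of expectations for \<open>U n\<close>, each at least \<open>b n\<close>.  As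
  \<open>b n\<close> tends to the claimed value, the expectations for \<open>u\<close> are squeezed to it.
\<close>

lemma poisson_thinning:
  fixes u :: "'x \<Rightarrow> real"
  assumes N: "prob_space N" and P: "poisson_points N \<nu> X"
    and u: "integrable \<nu> u" "\<And>x. 0 \<le> u x" "\<And>x. u x \<le> 1"
  shows "(\<lambda>m. \<integral>w. (\<Prod>i<m. 1 - u (X i w)) \<partial>N) \<longlonglongrightarrow> exp (- (\<integral>x. u x \<partial>\<nu>))"
proof -
  interpret prob_space N by fact
  have Xm[measurable]: "X i \<in> measurable N \<nu>" for i using P by (simp add: poisson_points_def)
  have um[measurable]: "u \<in> borel_measurable \<nu>" using u by simp
  \<comment> \<open>The index 0 is left out: the set where \<open>u\<close> is below \<open>1 / 2^n\<close> may have infinite measure,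
    and the step function vanishes there.\<close>
  define J where "J n = {1..(2::nat)^n}" for n
  define B where "B n j = {x \<in> space \<nu>. \<lfloor>2^n * u x\<rfloor> = int j}" for n j
  define c where "c n j = real j / 2^n" for n j
  define U where "U n x = (\<Sum>j\<in>J n. c n j * indicator (B n j) x)" for n x
  have Bm[measurable]: "B n j \<in> sets \<nu>" for n j unfolding B_def by measurable
  have Ueq: "U n x = of_int \<lfloor>2^n * u x\<rfloor> / 2^n" if "x \<in> space \<nu>" for n x
  proof -
    define k where "k = nat \<lfloor>2^n * u x\<rfloor>"
    have k: "int k = \<lfloor>2^n * u x\<rfloor>" using u(2) by (simp add: k_def)
    have "2^n * u x \<le> 2^n * 1" by (intro mult_left_mono u) simp
    then have "\<lfloor>2^n * u x\<rfloor> \<le> \<lfloor>(2::real)^n * 1\<rfloor>" by (rule floor_mono)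
    then have "int k \<le> int (2^n)" by (simp add: k)
    then have k2: "k \<le> 2^n" by linarith
    have "U n x = (\<Sum>j\<in>J n. if j = k then c n k else 0)"
      unfolding U_def using that by (intro sum.cong) (auto simp: B_def k[symmetric])
    also have "\<dots> = c n k" using k2 by (cases "k = 0") (auto simp: J_def c_def)
    finally show ?thesis by (simp add: c_def k[symmetric])
  qed
  have Ule: "U n x \<le> u x" and uU: "u x \<le> U n x + 1 / 2^n" and U0: "0 \<le> U n x" if "x \<in> space \<nu>" for n x
  proof -
    have "of_int \<lfloor>2^n * u x\<rfloor> \<le> 2^n * u x" "2^n * u x \<le> of_int \<lfloor>2^n * u x\<rfloor> + 1" by linarith+
    then show "U n x \<le> u x" "u x \<le> U n x + 1 / 2^n"
      unfolding Ueq[OF that] by (auto simp: field_simps)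
    show "0 \<le> U n x" unfolding Ueq[OF that] using u(2)[of x] by simp
  qed
  have Ulim: "(\<lambda>n. U n x) \<longlonglongrightarrow> u x" if "x \<in> space \<nu>" for x
  proof (rule tendsto_sandwich[OF _ _ _ tendsto_const])
    have "(\<lambda>n. u x - (1/2)^n) \<longlonglongrightarrow> u x - 0" by (intro tendsto_intros LIMSEQ_power_zero) simp
    then show "(\<lambda>n. u x - 1 / 2^n) \<longlonglongrightarrow> u x" by (simp add: power_one_over)
  qed (use Ule[OF that] uU[OF that] in \<open>auto simp: algebra_simps\<close>)
  have Um[measurable]: "U n \<in> borel_measurable \<nu>" for n unfolding U_def[abs_def] by measurable
  have Bfin: "emeasure \<nu> (B n j) < \<infinity>" if "j \<in> J n" for n j
  proof -
    \<comment> \<open>Markov's inequality: \<open>u\<close> is at least \<open>1 / 2^n\<close> on the level sets in use.\<close>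
    have "indicator (B n j) x \<le> (2^n * u x :: real)" for x
    proof (cases "x \<in> B n j")
      case True
      then have "real j \<le> 2^n * u x" by (simp add: B_def) linarith
      then show ?thesis using that True by (auto simp: J_def)
    qed (use u(2) in simp)
    then have "(\<integral>\<^sup>+x. ennreal (indicator (B n j) x) \<partial>\<nu>) \<le> (\<integral>\<^sup>+x. ennreal (2^n * u x) \<partial>\<nu>)"
      by (intro nn_integral_mono ennreal_leI)
    then have "emeasure \<nu> (B n j) \<le> (\<integral>\<^sup>+x. ennreal (2^n * u x) \<partial>\<nu>)"
      by (simp add: ennreal_indicator)
    also have "\<dots> < \<infinity>"
      using u by (subst nn_integral_eq_integral) auto
    finally show ?thesis .
  qed
  define a where "a m = (\<integral>w. (\<Prod>i<m. 1 - u (X i w)) \<partial>N)" for m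
  define b where "b n = exp (- (\<integral>x. U n x \<partial>\<nu>))" for n
  have IU: "(\<integral>x. U n x \<partial>\<nu>) = (\<Sum>j\<in>J n. c n j * measure \<nu> (B n j))" for n
    unfolding U_def using Bfin
    by (subst Bochner_Integration.integral_sum) (auto intro!: integrable_real_indicator simp: sets.Int_space_eq2)
  have step: "(\<lambda>m. \<integral>w. (\<Prod>i<m. 1 - U n (X i w)) \<partial>N) \<longlonglongrightarrow> b n" for n
    unfolding b_def IU unfolding U_def
  proof (rule poisson_thinning_step[OF N P])
    show "disjoint_family_on (B n) (J n)" by (auto simp: disjoint_family_on_def B_def)
    show "0 \<le> c n j \<and> c n j \<le> 1" if "j \<in> J n" for j
    proof -
      have "real j \<le> real (2^n)" using that unfolding J_def of_nat_le_iff by simp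
      then show ?thesis by (simp add: c_def)
    qed
    show "emeasure \<nu> (B n j) < \<infinity>" if "j \<in> J n" for j by (rule Bfin[OF that])
  qed (auto simp: J_def)
  have sp: "X i w \<in> space \<nu>" if "w \<in> space N" for i w
    using measurable_space[OF Xm that] .
  have U1: "U n x \<le> 1" if "x \<in> space \<nu>" for n x
    using Ule[OF that, of n] u(3)[of x] by linarith
  have inU: "integrable N (\<lambda>w. \<Prod>i<m. 1 - U n (X i w))" and inu: "integrable N (\<lambda>w. \<Prod>i<m. 1 - u (X i w))" for m n
  proof -
    have "\<bar>\<Prod>i<m. 1 - U n (X i w)\<bar> \<le> 1" if "w \<in> space N" for w
      unfolding abs_prod using U0[OF sp[OF that]] U1[OF sp[OF that]] by (intro prod_le_1) (simp_all add: abs_of_nonneg)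
    then show "integrable N (\<lambda>w. \<Prod>i<m. 1 - U n (X i w))"
      by (intro integrable_const_bound[where B=1]) auto
    have "\<bar>\<Prod>i<m. 1 - u (X i w)\<bar> \<le> 1" for w
      unfolding abs_prod using u(2,3) by (intro prod_le_1) (simp_all add: abs_of_nonneg)
    then show "integrable N (\<lambda>w. \<Prod>i<m. 1 - u (X i w))"
      by (intro integrable_const_bound[where B=1]) auto
  qed
  have a_le: "a m \<le> (\<integral>w. (\<Prod>i<m. 1 - U n (X i w)) \<partial>N)" for m n
    unfolding a_def using inu inU sp Ule u(3)
    by (intro integral_mono) (auto intro!: prod_mono)
  have bn: "b n \<le> (\<integral>w. (\<Prod>i<m. 1 - U n (X i w)) \<partial>N)" for m n
  proof (rule decseq_ge[OF _ step])
    show "decseq (\<lambda>m. \<integral>w. (\<Prod>i<m. 1 - U n (X i w)) \<partial>N)"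
    proof (rule decseq_SucI, rule integral_mono[OF inU inU])
      fix m w assume w: "w \<in> space N"
      have p: "0 \<le> (\<Prod>i<m. 1 - U n (X i w))"
        using U1[OF sp[OF w]] by (intro prod_nonneg) simp
      show "(\<Prod>i<Suc m. 1 - U n (X i w)) \<le> (\<Prod>i<m. 1 - U n (X i w))"
        using mult_left_mono[OF _ p, of "1 - U n (X m w)" 1] U0[OF sp[OF w]] by simp
    qed
  qed
  have blim: "b \<longlonglongrightarrow> exp (- (\<integral>x. u x \<partial>\<nu>))"
    unfolding b_def
  proof (intro tendsto_intros integral_dominated_convergence[where w=u])
    show "AE x in \<nu>. (\<lambda>n. U n x) \<longlonglongrightarrow> u x" using Ulim by simp
    show "AE x in \<nu>. norm (U n x) \<le> u x" for n using U0 Ule by simp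
  qed (use u in auto)
  have alow: "exp (- (\<integral>x. u x \<partial>\<nu>)) \<le> a m" for m
  proof (rule LIMSEQ_le[OF blim])
    show "(\<lambda>n. \<integral>w. (\<Prod>i<m. 1 - U n (X i w)) \<partial>N) \<longlonglongrightarrow> a m"
      unfolding a_def
    proof (rule integral_dominated_convergence[where w="\<lambda>_. 1"])
      show "AE w in N. (\<lambda>n. \<Prod>i<m. 1 - U n (X i w)) \<longlonglongrightarrow> (\<Prod>i<m. 1 - u (X i w))"
        using Ulim sp by (auto intro!: tendsto_prod tendsto_diff AE_I2)
      show "AE w in N. norm (\<Prod>i<m. 1 - U n (X i w)) \<le> 1" for n
      proof (intro AE_I2)
        fix w assume "w \<in> space N"
        then show "norm (\<Prod>i<m. 1 - U n (X i w)) \<le> 1"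
          using U0 U1 sp unfolding real_norm_def abs_prod by (intro prod_le_1) (simp_all add: abs_of_nonneg)
      qed
    qed auto
    show "\<exists>n0. \<forall>n\<ge>n0. b n \<le> (\<integral>w. (\<Prod>i<m. 1 - U n (X i w)) \<partial>N)" using bn by blast
  qed
  show ?thesis
    unfolding a_def[symmetric]
  proof (rule order_tendstoI)
    fix y assume "y < exp (- (\<integral>x. u x \<partial>\<nu>))"
    then show "\<forall>\<^sub>F m in sequentially. y < a m" by (intro always_eventually allI less_le_trans[OF _ alow])
  next
    fix y assume y: "exp (- (\<integral>x. u x \<partial>\<nu>)) < y"
    from order_tendstoD(2)[OF blim y] obtain n where "b n < y" by (auto simp: eventually_sequentially)
    from order_tendstoD(2)[OF step this] show "\<forall>\<^sub>F m in sequentially. a m < y"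
      by eventually_elim (rule le_less_trans[OF a_le])
  qed
qed

text \<open>
  Conditioning on the points: given \<open>X\<^sub>i = x\<^sub>i\<close>, the first \<open>m\<close> marks satisfy \<open>U\<close> with
  probability \<open>\<Prod>\<^sub>i\<^sub><\<^sub>m p(x\<^sub>i)\<close>, and the expectation of this product is evaluated by
  \<open>poisson_thinning\<close> with \<open>u = 1 - p\<close>.  The sigma-algebra \<open>F\<close> carries the marks and makes \<open>U\<close>
  jointly measurable, so that evaluation of the marks at the random points is covered.
\<close>

lemma poisson_void_probability:
  fixes X :: "nat \<Rightarrow> 'w \<Rightarrow> 'x" and p :: "'x \<Rightarrow> real"
  assumes N: "prob_space N" and P: "poisson_points N \<nu> X"
    and F: "subalgebra N F" and ind: "indep_elements N (\<Pi>\<^sub>M i\<in>UNIV. \<nu>) (\<lambda>w i. X i w) F (\<lambda>w. w)"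
    and U: "\<And>i. Measurable.pred (\<nu> \<Otimes>\<^sub>M F) (\<lambda>(x, w). U i x w)"
    and prod: "\<And>m x. (\<And>i. x i \<in> space \<nu>) \<Longrightarrow> measure N {w \<in> space N. \<forall>i<m. U i (x i) w} = (\<Prod>i<m. p (x i))"
    and p: "\<And>x. 0 \<le> p x" "\<And>x. p x \<le> 1" "integrable \<nu> (\<lambda>x. 1 - p x)"
  shows "measure N {w \<in> space N. \<forall>i. U i (X i w) w} = exp (- (\<integral>x. 1 - p x \<partial>\<nu>))"
proof -
  interpret prob_space N by fact
  have Xm[measurable]: "X i \<in> measurable N \<nu>" for i using P by (simp add: poisson_points_def)
  let ?A = "\<Pi>\<^sub>M i\<in>(UNIV::nat set). \<nu>"
  let ?Y = "\<lambda>w i. X i w"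
  have Ym[measurable]: "?Y \<in> measurable N ?A" and idm[measurable]: "(\<lambda>w. w) \<in> measurable N F"
    using ind by (auto simp: indep_elements_def)
  have spF: "space F = space N" using F by (simp add: subalgebra_def)
  have pm[measurable]: "p \<in> borel_measurable \<nu>"
  proof -
    have "(\<lambda>x. 1 - (1 - p x)) \<in> borel_measurable \<nu>" by (intro borel_measurable_diff borel_measurable_integrable[OF p(3)] borel_measurable_const)
    then show ?thesis by simp
  qed
  interpret Y: prob_space "distr N ?A ?Y" by (rule prob_space_distr) simp
  interpret F: prob_space "distr N F (\<lambda>w. w)" by (rule prob_space_distr) simp
  have joint: "distr N ?A ?Y \<Otimes>\<^sub>M distr N F (\<lambda>w. w) = distr N (?A \<Otimes>\<^sub>M F) (\<lambda>w. (?Y w, w))"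
  proof (rule pair_measure_eqI)
    fix a b assume "a \<in> sets (distr N ?A ?Y)" "b \<in> sets (distr N F (\<lambda>w. w))"
    then have ab: "a \<in> sets ?A" "b \<in> sets F" by auto
    have "prob ((?Y -` a \<inter> space N) \<inter> ((\<lambda>w. w) -` b \<inter> space N)) = prob (?Y -` a \<inter> space N) * prob ((\<lambda>w. w) -` b \<inter> space N)"
      using ind unfolding indep_elements_def
      by (intro indep_setD[OF _ in_vimage_algebra[OF ab(1)] in_vimage_algebra[OF ab(2)]]) simp
    moreover have "(\<lambda>w. (?Y w, w)) -` (a \<times> b) \<inter> space N = (?Y -` a \<inter> space N) \<inter> ((\<lambda>w. w) -` b \<inter> space N)"
      by auto
    ultimately show "emeasure (distr N ?A ?Y) a * emeasure (distr N F (\<lambda>w. w)) b = emeasure (distr N (?A \<Otimes>\<^sub>M F) (\<lambda>w. (?Y w, w))) (a \<times> b)"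
      using ab by (simp add: emeasure_distr emeasure_eq_measure ennreal_mult)
  qed (unfold_locales, simp)
  have finm: "measure N {w \<in> space N. \<forall>i<m. U i (X i w) w} = (\<integral>w. (\<Prod>i<m. 1 - (1 - p (X i w))) \<partial>N)" for m
  proof -
    define G where "G = {z \<in> space (?A \<Otimes>\<^sub>M F). \<forall>i<m. U i (fst z i) (snd z)}"
    have G: "G \<in> sets (?A \<Otimes>\<^sub>M F)"
    proof -
      have "Measurable.pred (?A \<Otimes>\<^sub>M F) (\<lambda>z. (\<lambda>(x, w). U i x w) (fst z i, snd z))" for i
        by (rule measurable_compose[OF _ U]) measurable
      then have [measurable]: "Measurable.pred (?A \<Otimes>\<^sub>M F) (\<lambda>z. U i (fst z i) (snd z))" for i by simp
      show ?thesis unfolding G_def by measurable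
    qed
    have YA: "?Y w \<in> space ?A" if "w \<in> space N" for w
      by (rule measurable_space[OF Ym that])
    have "sets (?A \<Otimes>\<^sub>M distr N F (\<lambda>w. w)) = sets (?A \<Otimes>\<^sub>M F)"
      "sets (distr N ?A ?Y \<Otimes>\<^sub>M distr N F (\<lambda>w. w)) = sets (?A \<Otimes>\<^sub>M F)"
      by (rule sets_pair_measure_cong; simp)+
    then have G': "G \<in> sets (?A \<Otimes>\<^sub>M distr N F (\<lambda>w. w))" "G \<in> sets (distr N ?A ?Y \<Otimes>\<^sub>M distr N F (\<lambda>w. w))"
      using G by blast+
    have "(\<lambda>w. (?Y w, w)) -` G \<inter> space N = {w \<in> space N. \<forall>i<m. U i (X i w) w}"
    proof (rule set_eqI)
      fix v
      show "v \<in> (\<lambda>w. (?Y w, w)) -` G \<inter> space N \<longleftrightarrow> v \<in> {w \<in> space N. \<forall>i<m. U i (X i w) w}"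
        unfolding G_def space_pair_measure spF Int_iff vimage_eq mem_Collect_eq mem_Times_iff fst_conv snd_conv
        using YA[of v] by blast
    qed
    then have "emeasure N {w \<in> space N. \<forall>i<m. U i (X i w) w} = emeasure (distr N (?A \<Otimes>\<^sub>M F) (\<lambda>w. (?Y w, w))) G"
      using G by (simp add: emeasure_distr)
    also have "\<dots> = (\<integral>\<^sup>+y. emeasure (distr N F (\<lambda>w. w)) (Pair y -` G) \<partial>distr N ?A ?Y)"
      unfolding joint[symmetric] by (rule F.emeasure_pair_measure_alt[OF G'(2)])
    also have "\<dots> = (\<integral>\<^sup>+w. emeasure (distr N F (\<lambda>w. w)) (Pair (?Y w) -` G) \<partial>N)"
    proof (rule nn_integral_distr[OF Ym])
      show "(\<lambda>y. emeasure (distr N F (\<lambda>w. w)) (Pair y -` G)) \<in> borel_measurable (distr N ?A ?Y)"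
        using F.measurable_emeasure_Pair[OF G'(1)] by simp
    qed
    also have "\<dots> = (\<integral>\<^sup>+w. ennreal (\<Prod>i<m. p (X i w)) \<partial>N)"
    proof (rule nn_integral_cong)
      fix w assume w: "w \<in> space N"
      have "Pair (?Y w) -` G \<in> sets F" using G by (rule sets_Pair1)
      then have "emeasure (distr N F (\<lambda>w. w)) (Pair (?Y w) -` G) = emeasure N ((\<lambda>w. w) -` (Pair (?Y w) -` G) \<inter> space N)"
        by (simp add: emeasure_distr)
      also have "(\<lambda>w. w) -` (Pair (?Y w) -` G) \<inter> space N = {v \<in> space N. \<forall>i<m. U i (X i w) v}"
      proof (rule set_eqI)
        fix v
        show "v \<in> (\<lambda>w. w) -` (Pair (?Y w) -` G) \<inter> space N \<longleftrightarrow> v \<in> {v \<in> space N. \<forall>i<m. U i (X i w) v}"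
          unfolding G_def space_pair_measure spF Int_iff vimage_eq mem_Collect_eq mem_Times_iff fst_conv snd_conv
          using YA[OF w] by blast
      qed
      also have "emeasure N \<dots> = ennreal (\<Prod>i<m. p (X i w))"
        using measurable_space[OF Xm w] by (simp add: emeasure_eq_measure prod)
      finally show "emeasure (distr N F (\<lambda>w. w)) (Pair (?Y w) -` G) = ennreal (\<Prod>i<m. p (X i w))" .
    qed
    also have "\<dots> = ennreal (\<integral>w. (\<Prod>i<m. p (X i w)) \<partial>N)"
      using p(1,2) by (intro nn_integral_eq_integral integrable_const_bound[where B=1])
        (auto intro!: prod_nonneg prod_le_1 simp: abs_prod)
    finally show ?thesis
      using p(1) by (simp add: emeasure_eq_measure integral_nonneg_AE prod_nonneg)
  qed
  have Um[measurable]: "Measurable.pred N (\<lambda>w. U i (X i w) w)" for i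
  proof -
    have "(\<lambda>w. (X i w, w)) \<in> measurable N (\<nu> \<Otimes>\<^sub>M F)" by measurable
    from measurable_compose[OF this U] show ?thesis by simp
  qed
  have "(\<lambda>m. measure N {w \<in> space N. \<forall>i<m. U i (X i w) w}) \<longlonglongrightarrow> measure N (\<Inter>m. {w \<in> space N. \<forall>i<m. U i (X i w) w})"
    by (rule finite_Lim_measure_decseq) (auto simp: decseq_def)
  also have "(\<Inter>m. {w \<in> space N. \<forall>i<m. U i (X i w) w}) = {w \<in> space N. \<forall>i. U i (X i w) w}"
    by auto
  finally have lim: "(\<lambda>m. measure N {w \<in> space N. \<forall>i<m. U i (X i w) w}) \<longlonglongrightarrow> measure N {w \<in> space N. \<forall>i. U i (X i w) w}" .
  have "(\<lambda>m. measure N {w \<in> space N. \<forall>i<m. U i (X i w) w}) \<longlonglongrightarrow> exp (- (\<integral>x. 1 - p x \<partial>\<nu>))"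
    unfolding finm using p by (intro poisson_thinning[OF N P]) auto
  with lim show ?thesis by (rule LIMSEQ_unique)
qed

text \<open>
  Independence and equality of laws hold on the product sigma-algebra.  Events that involve path
  integrals lie in it only up to null sets, which is enough.
\<close>

lemma iid_fields_prob_Ball:
  fixes U :: "nat \<Rightarrow> 'x \<Rightarrow> 'w \<Rightarrow> bool"
  assumes N: "prob_space N" and iid: "iid_fields N X"
    and [measurable]: "\<And>i t. X i t \<in> borel_measurable N"
    and B: "\<And>x. B x \<in> sets (\<Pi>\<^sub>M t\<in>UNIV. borel)"
    and U: "\<And>i x. {w \<in> space N. U i x w} \<in> sets N"
    and AE: "\<And>i x. AE w in N. U i x w \<longleftrightarrow> (\<lambda>t. X i t w) \<in> B x"
  shows "measure N {w \<in> space N. \<forall>i<m. U i (x i) w} = (\<Prod>i<m. measure N {w \<in> space N. U 0 (x i) w})"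
proof -
  interpret prob_space N by fact
  have Xm[measurable]: "(\<lambda>w t. X i t w) \<in> measurable N (\<Pi>\<^sub>M t\<in>UNIV. borel)" for i
    by (auto intro!: measurable_PiM_single')
  have vm: "{w \<in> space N. (\<lambda>t. X i t w) \<in> B z} = (\<lambda>w t. X i t w) -` B z \<inter> space N" for i z by auto
  have Bm: "{w \<in> space N. (\<lambda>t. X i t w) \<in> B z} \<in> sets N" for i z
    unfolding vm by (rule measurable_sets[OF Xm B])
  have "measure N {w \<in> space N. \<forall>i<m. U i (x i) w} = measure N {w \<in> space N. \<forall>i<m. (\<lambda>t. X i t w) \<in> B (x i)}"
  proof (rule measure_eq_AE)
    have "AE w in N. \<forall>i<m. U i (x i) w \<longleftrightarrow> (\<lambda>t. X i t w) \<in> B (x i)"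
      using AE by (simp add: AE_all_countable)
    then show "AE w in N. w \<in> {w \<in> space N. \<forall>i<m. U i (x i) w} \<longleftrightarrow> w \<in> {w \<in> space N. \<forall>i<m. (\<lambda>t. X i t w) \<in> B (x i)}"
      by eventually_elim auto
    show "{w \<in> space N. \<forall>i<m. U i (x i) w} \<in> sets N"
      using U by (intro sets.sets_Collect_countable_All sets.sets_Collect_imp) auto
    show "{w \<in> space N. \<forall>i<m. (\<lambda>t. X i t w) \<in> B (x i)} \<in> sets N"
      using Bm by (intro sets.sets_Collect_countable_All sets.sets_Collect_imp) auto
  qed
  also have "\<dots> = (\<Prod>i<m. measure N {w \<in> space N. (\<lambda>t. X i t w) \<in> B (x i)})"
  proof (cases "m = 0")
    case True
    then show ?thesis by (simp add: prob_space)
  next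
    case False
    have "indep_vars (\<lambda>_. \<Pi>\<^sub>M t\<in>UNIV. borel) (\<lambda>i w t. X i t w) UNIV"
      using iid by (simp add: iid_fields_def)
    from indep_varsD[OF this, of "{..<m}" "\<lambda>i. B (x i)"] False B
    have "prob (\<Inter>i<m. (\<lambda>w t. X i t w) -` B (x i) \<inter> space N) = (\<Prod>i<m. prob ((\<lambda>w t. X i t w) -` B (x i) \<inter> space N))"
      by auto
    moreover have "(\<Inter>i<m. (\<lambda>w t. X i t w) -` B (x i) \<inter> space N) = {w \<in> space N. \<forall>i<m. (\<lambda>t. X i t w) \<in> B (x i)}"
      using False by auto
    ultimately show ?thesis by (simp only: vm)
  qed
  also have "\<dots> = (\<Prod>i<m. measure N {w \<in> space N. U 0 (x i) w})"
  proof (rule prod.cong[OF refl])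
    fix i
    have "distr N (\<Pi>\<^sub>M t\<in>UNIV. borel) (\<lambda>w t. X i t w) = distr N (\<Pi>\<^sub>M t\<in>UNIV. borel) (\<lambda>w t. X 0 t w)"
      using iid by (intro law_eq_of_same_fdd N) (auto simp: iid_fields_def)
    then have "measure (distr N (\<Pi>\<^sub>M t\<in>UNIV. borel) (\<lambda>w t. X i t w)) (B (x i)) = measure (distr N (\<Pi>\<^sub>M t\<in>UNIV. borel) (\<lambda>w t. X 0 t w)) (B (x i))"
      by simp
    then have "prob {w \<in> space N. (\<lambda>t. X i t w) \<in> B (x i)} = prob {w \<in> space N. (\<lambda>t. X 0 t w) \<in> B (x i)}"
      by (simp add: measure_distr[OF Xm B] vm)
    also have "\<dots> = prob {w \<in> space N. U 0 (x i) w}"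
    proof (rule measure_eq_AE[OF _ Bm U])
      show "AE w in N. w \<in> {w \<in> space N. (\<lambda>t. X 0 t w) \<in> B (x i)} \<longleftrightarrow> w \<in> {w \<in> space N. U 0 (x i) w}"
        using AE[of 0 "x i"] by eventually_elim auto
    qed
    finally show "prob {w \<in> space N. (\<lambda>t. X i t w) \<in> B (x i)} = prob {w \<in> space N. U 0 (x i) w}" .
  qed
  finally show ?thesis .
qed

text \<open>
  The exponent is the expected number of points whose mark violates \<open>U\<close>.
\<close>

lemma poisson_iid_void_probability:
  fixes X :: "nat \<Rightarrow> 'w \<Rightarrow> 'x"
  assumes N: "prob_space N" and P: "poisson_points N \<nu> X"
    and F: "subalgebra N F" and ind: "indep_elements N (\<Pi>\<^sub>M i\<in>UNIV. \<nu>) (\<lambda>w i. X i w) F (\<lambda>w. w)"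
    and U: "\<And>i. Measurable.pred (\<nu> \<Otimes>\<^sub>M F) (\<lambda>(x, w). U i x w)"
    and prod: "\<And>m x. (\<And>i. x i \<in> space \<nu>) \<Longrightarrow>
      measure N {w \<in> space N. \<forall>i<m. U i (x i) w} = (\<Prod>i<m. measure N {w \<in> space N. U 0 (x i) w})"
    and fin: "(\<integral>\<^sup>+x. emeasure N {w \<in> space N. \<not> U 0 x w} \<partial>\<nu>) < \<infinity>"
  shows "measure N {w \<in> space N. \<forall>i. U i (X i w) w} = exp (- enn2real (\<integral>\<^sup>+x. emeasure N {w \<in> space N. \<not> U 0 x w} \<partial>\<nu>))"
proof -
  interpret prob_space N by fact
  have idm: "(\<lambda>w. w) \<in> measurable N F" using ind by (simp add: indep_elements_def)
  have UN: "Measurable.pred (\<nu> \<Otimes>\<^sub>M N) (\<lambda>(x, w). U i x w)" for i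
  proof -
    have "(\<lambda>z. (fst z, snd z)) \<in> measurable (\<nu> \<Otimes>\<^sub>M N) (\<nu> \<Otimes>\<^sub>M F)"
      using measurable_compose[OF measurable_snd idm, of \<nu>] by (intro measurable_Pair) auto
    from measurable_compose[OF this U[of i]] show ?thesis by (simp add: case_prod_beta')
  qed
  define G where "G = {z \<in> space (\<nu> \<Otimes>\<^sub>M N). \<not> U 0 (fst z) (snd z)}"
  have G: "G \<in> sets (\<nu> \<Otimes>\<^sub>M N)"
    using UN[of 0] unfolding G_def by (intro sets.sets_Collect_neg) (simp add: pred_def case_prod_beta')
  have Geq: "Pair x -` G = {w \<in> space N. \<not> U 0 x w}" if "x \<in> space \<nu>" for x
    using that by (auto simp: G_def space_pair_measure)
  define p where "p x = (if x \<in> space \<nu> then measure N {w \<in> space N. U 0 x w} else 1)" for x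
  have Gm: "{w \<in> space N. \<not> U 0 x w} \<in> sets N" if "x \<in> space \<nu>" for x
    using sets_Pair1[OF G, of x] Geq[OF that] by simp
  have comp: "1 - p x = measure N {w \<in> space N. \<not> U 0 x w}" if "x \<in> space \<nu>" for x
  proof -
    have "space N - {w \<in> space N. \<not> U 0 x w} = {w \<in> space N. U 0 x w}" by auto
    then show ?thesis using prob_compl[OF Gm[OF that]] that by (simp add: p_def)
  qed
  have m: "(\<lambda>x. 1 - p x) \<in> borel_measurable \<nu>"
  proof -
    have "(\<lambda>x. enn2real (emeasure N (Pair x -` G))) \<in> borel_measurable \<nu>"
      using measurable_emeasure_Pair[OF G] by measurable
    then show ?thesis
      by (rule measurable_cong[THEN iffD1, rotated]) (simp add: Geq comp measure_def)
  qed
  have eq: "(\<integral>\<^sup>+x. ennreal (1 - p x) \<partial>\<nu>) = (\<integral>\<^sup>+x. emeasure N {w \<in> space N. \<not> U 0 x w} \<partial>\<nu>)"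
    by (intro nn_integral_cong) (simp add: comp emeasure_eq_measure)
  have p01: "0 \<le> p x" "p x \<le> 1" for x by (simp_all add: p_def)
  have int: "integrable \<nu> (\<lambda>x. 1 - p x)"
    using m p01 fin unfolding eq[symmetric] by (simp add: integrable_iff_bounded)
  have "measure N {w \<in> space N. \<forall>i. U i (X i w) w} = exp (- (\<integral>x. 1 - p x \<partial>\<nu>))"
    using prod by (intro poisson_void_probability[OF N P F ind U _ p01 int]) (simp add: p_def)
  also have "(\<integral>x. 1 - p x \<partial>\<nu>) = enn2real (\<integral>\<^sup>+x. ennreal (1 - p x) \<partial>\<nu>)"
    using m p01 by (intro integral_eq_nn_integral) auto
  finally show ?thesis unfolding eq .
qed

section \<open>Levels with exponential intensity\<close>

lemma sets_exp_intensity[measurable_cong]: "sets exp_intensity = sets borel"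
  by (simp add: exp_intensity_def)

lemma space_exp_intensity[simp]: "space exp_intensity = UNIV"
  by (simp add: exp_intensity_def)

lemma sigma_finite_exp_intensity: "sigma_finite_measure exp_intensity"
  unfolding exp_intensity_def
  by (subst sigma_finite_measure.sigma_finite_iff_density_finite[OF sigma_finite_lborel]) auto

text \<open>
  The scaling property of the intensity that makes the fields max-stable.
\<close>

lemma emeasure_exp_intensity_shift:
  assumes [measurable]: "A \<in> sets borel"
  shows "emeasure exp_intensity {v. v + c \<in> A} = ennreal (exp c) * emeasure exp_intensity A"
proof -
  have "emeasure exp_intensity {v. v + c \<in> A} = (\<integral>\<^sup>+v. ennreal (exp (- v)) * indicator A (v + c) \<partial>lborel)"
    unfolding exp_intensity_def by (subst emeasure_density) (auto simp: indicator_def intro!: nn_integral_cong)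
  also have "\<dots> = (\<integral>\<^sup>+v. ennreal (exp (- (c + 1 * v - c))) * indicator A (c + 1 * v) \<partial>lborel)"
    by (simp add: add.commute)
  also have "\<dots> = (\<integral>\<^sup>+v. ennreal (exp (- (v - c))) * indicator A v \<partial>lborel)"
    using nn_integral_real_affine[of "\<lambda>v. ennreal (exp (- (v - c))) * indicator A v" 1 c] by simp
  also have "\<dots> = (\<integral>\<^sup>+v. ennreal (exp c) * (ennreal (exp (- v)) * indicator A v) \<partial>lborel)"
    by (intro nn_integral_cong) (simp add: exp_diff exp_minus ennreal_mult[symmetric] mult.assoc[symmetric] divide_inverse)
  also have "\<dots> = ennreal (exp c) * emeasure exp_intensity A"
    unfolding exp_intensity_def by (subst nn_integral_cmult) (auto simp: emeasure_density)
  finally show ?thesis .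
qed

lemma emeasure_exp_intensity_above:
  assumes "y \<noteq> -\<infinity>"
  shows "emeasure exp_intensity {v. \<not> ereal v \<le> y} < \<infinity>"
proof (cases y)
  case (real r)
  have "emeasure exp_intensity {v. \<not> ereal v \<le> y} \<le> (\<integral>\<^sup>+v. ennreal (exp (- v)) * indicator {r..} v \<partial>lborel)"
    unfolding exp_intensity_def real
    by (subst emeasure_density) (auto intro!: nn_integral_mono simp: indicator_def)
  also have "\<dots> = 0 - (- exp (- r))"
  proof (rule nn_integral_FTC_atLeast)
    show "DERIV (\<lambda>v. - exp (- v)) v :> exp (- v)" for v :: real
      by (auto intro!: derivative_eq_intros)
    have "((\<lambda>v::real. exp (- v)) \<longlongrightarrow> 0) at_top"
      by (rule filterlim_compose[OF exp_at_bot filterlim_uminus_at_bot_at_top])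
    then show "((\<lambda>v::real. - exp (- v)) \<longlongrightarrow> 0) at_top" using tendsto_minus by fastforce
  qed auto
  finally show ?thesis by (simp add: le_less_trans)
qed (use assms in auto)

text \<open>
  Up to notation this is the maximum over \<open>S\<close> of \<open>exp (x t - y t)\<close>.  The form as a mass of levels
  covers the empty set and infinite levels, and makes homogeneity a matter of translation.
\<close>

definition exceedance :: "'t set \<Rightarrow> ('t \<Rightarrow> ereal) \<Rightarrow> ('t \<Rightarrow> real) \<Rightarrow> ennreal" where
  "exceedance S y x = emeasure exp_intensity {v. \<exists>t\<in>S. \<not> ereal (v + x t) \<le> y t}"

lemma exceedance_sets[measurable]:
  assumes "finite S" shows "{v. \<exists>t\<in>S. \<not> ereal (v + x t) \<le> y t} \<in> sets borel"
proof -
  have "{v \<in> space borel. \<exists>t\<in>S. \<not> ereal (v + x t) \<le> y t} \<in> sets borel"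
    using assms by measurable
  then show ?thesis by simp
qed

lemma exceedance_add_const:
  assumes "finite S"
  shows "exceedance S y (\<lambda>t. x t + c) = ennreal (exp c) * exceedance S y x"
  unfolding exceedance_def
  by (subst emeasure_exp_intensity_shift[OF exceedance_sets[OF assms], symmetric])
     (simp add: add_ac)

lemma measurable_exceedance:
  assumes S: "finite S" and [measurable]: "\<And>t. t \<in> S \<Longrightarrow> (\<lambda>w. x w t) \<in> borel_measurable M"
  shows "(\<lambda>w. exceedance S y (x w)) \<in> borel_measurable M"
proof -
  interpret sigma_finite_measure exp_intensity by (rule sigma_finite_exp_intensity)
  have "{p \<in> space (M \<Otimes>\<^sub>M exp_intensity). \<exists>t\<in>S. \<not> ereal (snd p + x (fst p) t) \<le> y t} \<in> sets (M \<Otimes>\<^sub>M exp_intensity)"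
    using S by measurable
  from measurable_emeasure_Pair[OF this]
  show ?thesis
    by (rule measurable_cong[THEN iffD1, rotated])
       (auto simp: exceedance_def space_pair_measure intro!: arg_cong[where f="emeasure exp_intensity"])
qed

text \<open>
  The maximum is at most the sum.  This makes the exponents of the void probabilities finite.
\<close>

lemma exceedance_bound:
  assumes S: "finite S" and y: "\<And>t. t \<in> S \<Longrightarrow> y t \<noteq> -\<infinity>"
  obtains K where "\<And>t. t \<in> S \<Longrightarrow> K t < \<infinity>" "\<And>x. exceedance S y x \<le> (\<Sum>t\<in>S. ennreal (exp (x t)) * K t)"
proof
  let ?K = "\<lambda>t. emeasure exp_intensity {v. \<not> ereal v \<le> y t}"
  show "?K t < \<infinity>" if "t \<in> S" for t
    using y[OF that] by (rule emeasure_exp_intensity_above)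
  have m: "{v. \<not> ereal v \<le> y t} \<in> sets borel" for t
  proof -
    have "{v \<in> space borel. \<not> ereal v \<le> y t} \<in> sets borel" by measurable
    then show ?thesis by simp
  qed
  fix x
  have "exceedance S y x = emeasure exp_intensity (\<Union>t\<in>S. {v. v + x t \<in> {v. \<not> ereal v \<le> y t}})"
    unfolding exceedance_def by (intro arg_cong[where f="emeasure exp_intensity"]) auto
  also have "\<dots> \<le> (\<Sum>t\<in>S. emeasure exp_intensity {v. v + x t \<in> {v. \<not> ereal v \<le> y t}})"
  proof (rule emeasure_subadditive_finite[OF S])
    have "{v \<in> space borel. v + x t \<in> {v. \<not> ereal v \<le> y t}} \<in> sets borel" for t
      using m[of t] by measurable
    then show "(\<lambda>t. {v. v + x t \<in> {v. \<not> ereal v \<le> y t}}) ` S \<subseteq> sets exp_intensity"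
      by (auto simp: sets_exp_intensity)
  qed
  also have "\<dots> = (\<Sum>t\<in>S. ennreal (exp (x t)) * ?K t)"
    by (simp only: emeasure_exp_intensity_shift[OF m])
  finally show "exceedance S y x \<le> (\<Sum>t\<in>S. ennreal (exp (x t)) * ?K t)" .
qed

section \<open>The change of measure at a random point\<close>

lemma measurable_field_eval:
  assumes X: "measurable_field F X" and f: "f \<in> measurable L F" and g: "g \<in> borel_measurable L"
  shows "(\<lambda>l. X (g l) (f l)) \<in> borel_measurable L"
proof -
  have "(\<lambda>l. (f l, g l)) \<in> measurable L (F \<Otimes>\<^sub>M borel)" using f g by measurable
  from measurable_compose[OF this X[unfolded measurable_field_def]] show ?thesis by simp
qed

lemma nn_integral_pos_prob:
  assumes "prob_space \<mu>" and [measurable]: "f \<in> borel_measurable \<mu>" and pos: "\<And>s. 0 < f s"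
  shows "0 < (\<integral>\<^sup>+s. f s \<partial>\<mu>)"
proof (rule ccontr)
  interpret prob_space \<mu> by fact
  assume "\<not> 0 < (\<integral>\<^sup>+s. f s \<partial>\<mu>)"
  then have "(\<integral>\<^sup>+s. f s \<partial>\<mu>) = 0" by (simp add: zero_less_iff_neq_zero)
  then have "AE s in \<mu>. f s = 0" by (simp add: nn_integral_0_iff_AE)
  then have "AE s in \<mu>. False" by eventually_elim (use pos in \<open>metis less_irrefl\<close>)
  then show False by simp
qed

text \<open>
  The hypothesis \<open>Q\<close> makes \<open>exp (X t)\<close> a probability density for each \<open>t\<close>.  A point \<open>t\<close> is
  selected with weight proportional to \<open>exp (X t)\<close>; under the law tilted at \<open>t\<close> the ratio of
  \<open>H\<close> and the average \<open>J\<close> only depends on the increments from \<open>t\<close>, whose law is that of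
  \<open>Z t\<close>.  The passage from \<open>X\<close> to \<open>Z t\<close> in the denominator needs \<open>average_functional\<close>, since
  \<open>J\<close> may involve uncountably many coordinates.
\<close>

lemma change_of_measure_at_random_point:
  fixes X :: "'t::topological_space \<Rightarrow> 'v \<Rightarrow> real" and Z :: "'t \<Rightarrow> 't \<Rightarrow> 'w \<Rightarrow> real" and H :: "('t \<Rightarrow> real) \<Rightarrow> ennreal"
  assumes M: "prob_space M" and X: "measurable_field M X" and N: "prob_space N" and Z: "\<And>t. measurable_field N (Z t)"
    and \<mu>: "prob_space \<mu>" "sets \<mu> = sets borel"
    and H[measurable]: "H \<in> borel_measurable (\<Pi>\<^sub>M t\<in>UNIV. borel)"
    and hom: "\<And>x c. H (\<lambda>t. x t + c) = ennreal (exp c) * H x"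
    and Q: "\<And>t. prob_space (density M (\<lambda>w. ennreal (exp (X t w))))"
    and fdd: "\<And>t. same_fdd (density M (\<lambda>w. ennreal (exp (X t w)))) (\<lambda>s w. X s w - X t w) N (Z t)"
  shows "(\<integral>\<^sup>+w. H (\<lambda>s. X s w) \<partial>M) = (\<integral>\<^sup>+t. (\<integral>\<^sup>+w. H (\<lambda>s. Z t s w) / (\<integral>\<^sup>+s. ennreal (exp (Z t s w)) \<partial>\<mu>) \<partial>N) \<partial>\<mu>)"
proof -
  interpret M: prob_space M by fact
  interpret \<mu>: prob_space \<mu> by fact
  interpret pair_sigma_finite M \<mu> by unfold_locales
  note [measurable_cong] = \<mu>(2)
  define J where "J x = (\<integral>\<^sup>+s. ennreal (exp (x s)) \<partial>\<mu>)" for x :: "'t \<Rightarrow> real"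
  have [measurable]: "X s \<in> borel_measurable M" "Z t s \<in> borel_measurable N" for s t
    using measurable_field_coordinate X Z by auto
  have Xm[measurable]: "(\<lambda>w s. X s w) \<in> measurable M (\<Pi>\<^sub>M s\<in>UNIV. borel)"
    by (auto intro!: measurable_PiM_single')
  have HX[measurable]: "(\<lambda>w. H (\<lambda>s. X s w)) \<in> borel_measurable M"
    by (rule measurable_compose[OF Xm H])
  have eX[measurable]: "(\<lambda>(w, t). ennreal (exp (X t w))) \<in> borel_measurable (M \<Otimes>\<^sub>M \<mu>)"
    using measurable_field_average(2)[OF X \<mu>, of "\<lambda>r. ennreal (exp r)"] by simp
  have JX[measurable]: "(\<lambda>w. J (\<lambda>s. X s w)) \<in> borel_measurable M"
    using measurable_field_average(1)[OF X \<mu>, of "\<lambda>r. ennreal (exp r)"] by (simp add: J_def)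
  have sec: "(\<lambda>t. X t w) \<in> borel_measurable \<mu>" if "w \<in> space M" for w
    using measurable_field_eval[OF X, of "\<lambda>_. w" \<mu> "\<lambda>t. t"] that by simp
  have one: "(\<integral>\<^sup>+w. ennreal (exp (X t w)) \<partial>M) = 1" for t
    using prob_space.emeasure_space_1[OF Q[of t]] by (simp add: emeasure_density cong: nn_integral_cong_simp)
  \<comment> \<open>The average \<open>J\<close> has expectation 1, so it is almost surely finite and can be cancelled.\<close>
  have "(\<integral>\<^sup>+w. J (\<lambda>s. X s w) \<partial>M) = (\<integral>\<^sup>+t. (\<integral>\<^sup>+w. ennreal (exp (X t w)) \<partial>M) \<partial>\<mu>)"
    unfolding J_def by (rule Fubini'[symmetric]) measurable
  also have "\<dots> = 1" by (simp add: one \<mu>.emeasure_space_1)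
  finally have "(\<integral>\<^sup>+w. J (\<lambda>s. X s w) \<partial>M) \<noteq> \<infinity>" by simp
  then have Jfin: "AE w in M. J (\<lambda>s. X s w) \<noteq> \<infinity>" by (intro nn_integral_PInf_AE) auto
  have Jpos: "J (\<lambda>s. X s w) \<noteq> 0" if "w \<in> space M" for w
    using nn_integral_pos_prob[OF \<mu>(1), of "\<lambda>s. ennreal (exp (X s w))"] sec[OF that] by (simp add: J_def)
  let ?R = "\<lambda>w. H (\<lambda>s. X s w) / J (\<lambda>s. X s w)"
  have "(\<integral>\<^sup>+w. H (\<lambda>s. X s w) \<partial>M) = (\<integral>\<^sup>+w. ?R w * J (\<lambda>s. X s w) \<partial>M)"
  proof (rule nn_integral_cong_AE)
    show "AE w in M. H (\<lambda>s. X s w) = ?R w * J (\<lambda>s. X s w)"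
      using Jfin AE_space
    proof eventually_elim
      fix w assume "J (\<lambda>s. X s w) \<noteq> \<infinity>" "w \<in> space M"
      then show "H (\<lambda>s. X s w) = ?R w * J (\<lambda>s. X s w)"
        using Jpos[of w] mult_divide_eq_ennreal[of "J (\<lambda>s. X s w)" "H (\<lambda>s. X s w)"]
        by (simp add: ennreal_times_divide mult.commute)
    qed
  qed
  also have "\<dots> = (\<integral>\<^sup>+w. (\<integral>\<^sup>+t. ennreal (exp (X t w)) * ?R w \<partial>\<mu>) \<partial>M)"
    using sec by (intro nn_integral_cong) (simp add: J_def nn_integral_multc mult.commute)
  also have "\<dots> = (\<integral>\<^sup>+t. (\<integral>\<^sup>+w. ennreal (exp (X t w)) * ?R w \<partial>M) \<partial>\<mu>)"
    by (rule Fubini'[symmetric]) measurable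
  also have "\<dots> = (\<integral>\<^sup>+t. (\<integral>\<^sup>+w. H (\<lambda>s. Z t s w) / J (\<lambda>s. Z t s w) \<partial>N) \<partial>\<mu>)"
  proof (rule nn_integral_cong)
    fix t
    define Qt where "Qt = density M (\<lambda>w. ennreal (exp (X t w)))"
    define \<xi> where "\<xi> s w = X s w - X t w" for s w
    have [measurable]: "\<xi> s \<in> borel_measurable Qt" for s by (simp add: \<xi>_def[abs_def] Qt_def)
    have \<xi>f: "measurable_field Qt \<xi>"
    proof -
      have "sets (Qt \<Otimes>\<^sub>M borel) = sets (M \<Otimes>\<^sub>M (borel :: 't measure))"
        by (rule sets_pair_measure_cong) (auto simp: Qt_def)
      moreover have "(\<lambda>(w, s). \<xi> s w) \<in> borel_measurable (M \<Otimes>\<^sub>M borel)"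
        using X unfolding measurable_field_def \<xi>_def by (simp add: case_prod_beta')
      ultimately show ?thesis unfolding measurable_field_def by (simp cong: measurable_cong_sets)
    qed
    have law: "distr Qt (\<Pi>\<^sub>M s\<in>UNIV. borel) (\<lambda>w s. \<xi> s w) = distr N (\<Pi>\<^sub>M s\<in>UNIV. borel) (\<lambda>w s. Z t s w)"
    proof (rule law_eq_of_same_fdd)
      show "prob_space Qt" using Q[of t] by (simp add: Qt_def)
      show "same_fdd Qt \<xi> N (Z t)" using fdd[of t] by (simp add: Qt_def \<xi>_def[abs_def])
    qed measurable
    define \<phi> where "\<phi> = average_functional Qt \<xi> \<mu> (\<lambda>r. ennreal (exp r))"
    have [measurable]: "\<phi> \<in> borel_measurable (\<Pi>\<^sub>M s\<in>UNIV. borel)" by (simp add: \<phi>_def)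
    have AE1: "AE w in Qt. J (\<lambda>s. \<xi> s w) = \<phi> (\<lambda>s. \<xi> s w)"
      unfolding J_def \<phi>_def by (rule average_functional[OF _ \<xi>f _ \<xi>f refl \<mu>]) (use Q[of t] in \<open>auto simp: Qt_def\<close>)
    have AE2: "AE w in N. J (\<lambda>s. Z t s w) = \<phi> (\<lambda>s. Z t s w)"
      unfolding J_def \<phi>_def by (rule average_functional[OF _ \<xi>f N Z law \<mu>]) (use Q[of t] in \<open>auto simp: Qt_def\<close>)
    have \<xi>m: "(\<lambda>w s. \<xi> s w) \<in> measurable Qt (\<Pi>\<^sub>M s\<in>UNIV. borel)" and Zm: "(\<lambda>w s. Z t s w) \<in> measurable N (\<Pi>\<^sub>M s\<in>UNIV. borel)"
      by (auto intro!: measurable_PiM_single')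
    have ratio: "?R w = H (\<lambda>s. \<xi> s w) / J (\<lambda>s. \<xi> s w)" if w: "w \<in> space M" for w
    proof -
      have "H (\<lambda>s. X s w) = H (\<lambda>s. \<xi> s w) * ennreal (exp (X t w))"
        using hom[of "\<lambda>s. \<xi> s w" "X t w"] by (simp add: \<xi>_def mult.commute)
      moreover have "J (\<lambda>s. X s w) = (\<integral>\<^sup>+s. ennreal (exp (\<xi> s w)) * ennreal (exp (X t w)) \<partial>\<mu>)"
        unfolding J_def by (intro nn_integral_cong) (simp add: \<xi>_def ennreal_mult[symmetric] exp_add[symmetric])
      moreover have "\<dots> = J (\<lambda>s. \<xi> s w) * ennreal (exp (X t w))"
        unfolding J_def using sec[OF w] by (intro nn_integral_multc) (simp add: \<xi>_def)
      ultimately show ?thesis by (simp add: divide_mult_eq)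
    qed
    have "(\<integral>\<^sup>+w. ennreal (exp (X t w)) * ?R w \<partial>M) = (\<integral>\<^sup>+w. ?R w \<partial>Qt)"
      unfolding Qt_def by (rule nn_integral_density[symmetric]) auto
    also have "\<dots> = (\<integral>\<^sup>+w. H (\<lambda>s. \<xi> s w) / \<phi> (\<lambda>s. \<xi> s w) \<partial>Qt)"
    proof (rule nn_integral_cong_AE)
      show "AE w in Qt. ?R w = H (\<lambda>s. \<xi> s w) / \<phi> (\<lambda>s. \<xi> s w)"
        using AE1 AE_space by eventually_elim (simp add: ratio Qt_def)
    qed
    also have "\<dots> = (\<integral>\<^sup>+x. H x / \<phi> x \<partial>distr Qt (\<Pi>\<^sub>M s\<in>UNIV. borel) (\<lambda>w s. \<xi> s w))"
      by (rule nn_integral_distr[OF \<xi>m, symmetric]) simp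
    also have "\<dots> = (\<integral>\<^sup>+w. H (\<lambda>s. Z t s w) / \<phi> (\<lambda>s. Z t s w) \<partial>N)"
      unfolding law by (rule nn_integral_distr[OF Zm]) simp
    also have "\<dots> = (\<integral>\<^sup>+w. H (\<lambda>s. Z t s w) / J (\<lambda>s. Z t s w) \<partial>N)"
      using AE2 by (intro nn_integral_cong_AE) (auto elim!: eventually_mono)
    finally show "(\<integral>\<^sup>+w. ennreal (exp (X t w)) * ?R w \<partial>M) = (\<integral>\<^sup>+w. H (\<lambda>s. Z t s w) / J (\<lambda>s. Z t s w) \<partial>N)" .
  qed
  finally show ?thesis unfolding J_def .
qed

section \<open>The two max-stable fields\<close>

lemma indep_elements_cong_sets:
  assumes "sets A = sets A'" and "indep_elements M A X B Y"
  shows "indep_elements M A' X B Y"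
  using assms measurable_cong_sets[OF refl assms(1), of M] sets_vimage_algebra_cong[OF assms(1), of "space M" X]
  unfolding indep_elements_def by simp

text \<open>
  The expected number of exceeding points, computed level by level or path by path.
\<close>

lemma exceedance_swap:
  fixes x :: "'w \<Rightarrow> 't \<Rightarrow> real"
  assumes N: "prob_space N" and S: "finite S" and x[measurable]: "\<And>t. t \<in> S \<Longrightarrow> (\<lambda>w. x w t) \<in> borel_measurable N"
  shows "(\<integral>\<^sup>+v. emeasure N {w \<in> space N. \<not> (\<forall>t\<in>S. ereal (v + x w t) \<le> y t)} \<partial>exp_intensity) = (\<integral>\<^sup>+w. exceedance S y (x w) \<partial>N)"
proof -
  interpret N: prob_space N by fact
  interpret E: sigma_finite_measure exp_intensity by (rule sigma_finite_exp_intensity)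
  interpret pair_sigma_finite exp_intensity N by unfold_locales
  define G where "G = {p \<in> space (exp_intensity \<Otimes>\<^sub>M N). \<not> (\<forall>t\<in>S. ereal (fst p + x (snd p) t) \<le> y t)}"
  have G: "G \<in> sets (exp_intensity \<Otimes>\<^sub>M N)" using S unfolding G_def by measurable
  have 1: "Pair v -` G = {w \<in> space N. \<not> (\<forall>t\<in>S. ereal (v + x w t) \<le> y t)}" for v
    by (auto simp: G_def space_pair_measure)
  have 2: "(\<lambda>v. (v, w)) -` G = {v. \<exists>t\<in>S. \<not> ereal (v + x w t) \<le> y t}" if "w \<in> space N" for w
    using that by (auto simp: G_def space_pair_measure)
  have "(\<integral>\<^sup>+v. emeasure N (Pair v -` G) \<partial>exp_intensity) = (\<integral>\<^sup>+w. emeasure exp_intensity ((\<lambda>v. (v, w)) -` G) \<partial>N)"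
    using N.emeasure_pair_measure_alt[OF G] emeasure_pair_measure_alt2[OF G] by simp
  also have "\<dots> = (\<integral>\<^sup>+w. exceedance S y (x w) \<partial>N)"
    by (intro nn_integral_cong) (simp add: 2 exceedance_def)
  finally show ?thesis unfolding 1 .
qed

text \<open>
  The paths are evaluated at the fixed points of \<open>S\<close>, so the sigma-algebra generated by the
  field values serves as the mark sigma-algebra.  The function \<open>d\<close> is a deterministic drift.
\<close>

lemma void_probability_spectral_functions:
  fixes W :: "nat \<Rightarrow> 't \<Rightarrow> 'v \<Rightarrow> real" and y :: "'t \<Rightarrow> ereal"
  assumes M: "prob_space M" and Wm[measurable]: "\<And>i t. W i t \<in> borel_measurable M" and iid: "iid_fields M W"
    and P: "poisson_points M exp_intensity V"
    and ind: "indep_elements M (\<Pi>\<^sub>M i\<in>UNIV. borel) (\<lambda>w i. V i w)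
          (\<Pi>\<^sub>M i\<in>UNIV. \<Pi>\<^sub>M t\<in>UNIV. borel) (\<lambda>w i t. W i t w)"
    and S: "finite S" and fin: "(\<integral>\<^sup>+w. exceedance S y (\<lambda>t. W 0 t w - d t) \<partial>M) < \<infinity>"
  shows "measure M {w \<in> space M. \<forall>i. \<forall>t\<in>S. ereal (V i w + (W i t w - d t)) \<le> y t}
    = exp (- enn2real (\<integral>\<^sup>+w. exceedance S y (\<lambda>t. W 0 t w - d t) \<partial>M))"
proof -
  interpret prob_space M by fact
  let ?B = "\<Pi>\<^sub>M i\<in>(UNIV::nat set). \<Pi>\<^sub>M t\<in>(UNIV::'t set). (borel :: real measure)"
  define F where "F = vimage_algebra (space M) (\<lambda>w i t. W i t w) ?B"
  have WB: "(\<lambda>w i t. W i t w) \<in> measurable M ?B" using ind by (simp add: indep_elements_def)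
  have F: "subalgebra M F"
    unfolding subalgebra_def F_def using sets_image_in_sets[OF refl WB] by simp
  have WF0: "(\<lambda>w i t. W i t w) \<in> measurable F ?B"
    unfolding F_def using measurable_space[OF WB] by (intro measurable_vimage_algebra1) auto
  have WF[measurable]: "W i t \<in> borel_measurable F" for i t
  proof -
    have 1: "(\<lambda>x. x i) \<in> measurable ?B (\<Pi>\<^sub>M t\<in>UNIV. borel)"
      and 2: "(\<lambda>x. x t) \<in> borel_measurable (\<Pi>\<^sub>M t\<in>(UNIV::'t set). (borel :: real measure))"
      by (rule measurable_component_singleton; simp)+
    from measurable_compose[OF measurable_compose[OF WF0 1] 2] have "(\<lambda>w. W i t w) \<in> borel_measurable F" .
    then show ?thesis by simp
  qed
  have sF: "space F = space M" "sets F \<subseteq> sets M" using F by (auto simp: subalgebra_def)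
  have idF: "(\<lambda>w. w) \<in> measurable M F"
    using sF by (intro measurableI) (auto simp: sets.Int_space_eq2)
  have "sets (vimage_algebra (space M) (\<lambda>w. w) F) = sets F"
  proof -
    have "A \<inter> space M = A" if "A \<in> sets F" for A
      using sets.sets_into_space[OF that] sF by auto
    then show ?thesis using sF by (subst sets_vimage_algebra2) auto
  qed
  moreover have "sets (vimage_algebra (space M) (\<lambda>w i. V i w) (\<Pi>\<^sub>M i\<in>UNIV. borel)) = sets (vimage_algebra (space M) (\<lambda>w i. V i w) (\<Pi>\<^sub>M i\<in>UNIV. exp_intensity))"
    by (intro sets_vimage_algebra_cong sets_PiM_cong) (auto simp: sets_exp_intensity)
  ultimately have indF: "indep_elements M (\<Pi>\<^sub>M i\<in>UNIV. exp_intensity) (\<lambda>w i. V i w) F (\<lambda>w. w)"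
    using ind idF unfolding indep_elements_def F_def[symmetric]
    by (simp cong: measurable_cong_sets sets_PiM_cong add: sets_exp_intensity)
  define U where "U i v w \<longleftrightarrow> (\<forall>t\<in>S. ereal (v + (W i t w - d t)) \<le> y t)" for i v w
  define B where "B v = {x \<in> space (\<Pi>\<^sub>M t\<in>(UNIV::'t set). (borel::real measure)). \<forall>t\<in>S. ereal (v + (x t - d t)) \<le> y t}" for v
  have swap: "(\<integral>\<^sup>+v. emeasure M {w \<in> space M. \<not> U 0 v w} \<partial>exp_intensity) = (\<integral>\<^sup>+w. exceedance S y (\<lambda>t. W 0 t w - d t) \<partial>M)"
    unfolding U_def by (rule exceedance_swap[OF M S]) measurable
  have "measure M {w \<in> space M. \<forall>i. U i (V i w) w} = exp (- enn2real (\<integral>\<^sup>+v. emeasure M {w \<in> space M. \<not> U 0 v w} \<partial>exp_intensity))"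
  proof (rule poisson_iid_void_probability[OF M P F indF])
    show "Measurable.pred (exp_intensity \<Otimes>\<^sub>M F) (\<lambda>(v, w). U i v w)" for i
      unfolding U_def case_prod_beta' using S by measurable
    show "measure M {w \<in> space M. \<forall>i<m. U i (x i) w} = (\<Prod>i<m. measure M {w \<in> space M. U 0 (x i) w})" for m x
    proof (rule iid_fields_prob_Ball[OF M iid, where B=B])
      show "B v \<in> sets (\<Pi>\<^sub>M t\<in>UNIV. borel)" for v unfolding B_def using S by measurable
      show "{w \<in> space M. U i v w} \<in> sets M" for i v unfolding U_def using S by measurable
      show "AE w in M. U i v w \<longleftrightarrow> (\<lambda>t. W i t w) \<in> B v" for i v
        by (simp add: U_def B_def space_PiM)
    qed simp
    show "(\<integral>\<^sup>+v. emeasure M {w \<in> space M. \<not> U 0 v w} \<partial>exp_intensity) < \<infinity>"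
      unfolding swap by (rule fin)
  qed
  then show ?thesis unfolding swap unfolding U_def .
qed

text \<open>
  The point \<open>(\<tau>, v)\<close> with mark \<open>Z\<close> exceeds \<open>y\<close> if \<open>v + Z (\<cdot> - \<tau>) - ln I\<close> does, where \<open>I\<close> is the
  integral of \<open>exp (Z (\<cdot> - \<tau>))\<close>.  By homogeneity, subtracting \<open>ln I\<close> divides the exceedance mass
  by \<open>I\<close>.  The functional \<open>\<phi>\<close> turns the event for a deterministic \<open>\<tau>\<close> into an event of the
  product sigma-algebra, so that the fields \<open>Z i\<close> can be treated as independent copies.
\<close>

lemma void_probability_random_shifts:
  fixes Z :: "nat \<Rightarrow> 't::euclidean_space \<Rightarrow> 'w \<Rightarrow> real" and T :: "nat \<Rightarrow> 'w \<Rightarrow> 't"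
    and y :: "'t \<Rightarrow> ereal"
  assumes \<mu>: "prob_space \<mu>" "sets \<mu> = sets borel"
    and N: "prob_space N" and Zf: "\<And>i. measurable_field N (Z i)" and iid: "iid_fields N Z"
    and P: "poisson_points N (\<mu> \<Otimes>\<^sub>M exp_intensity) (\<lambda>i w. (T i w, V i w))"
    and ind: "indep_of_measurable_fields N (\<Pi>\<^sub>M i\<in>UNIV. borel) (\<lambda>w i. (T i w, V i w)) Z"
    and one: "\<And>t. (\<integral>\<^sup>+w. ennreal (exp (Z 0 t w)) \<partial>N) = 1"
    and S: "finite S"
  defines "L \<equiv> \<integral>\<^sup>+\<tau>. (\<integral>\<^sup>+w. exceedance S y (\<lambda>t. Z 0 (t - \<tau>) w) / (\<integral>\<^sup>+s. ennreal (exp (Z 0 (s - \<tau>) w)) \<partial>\<mu>) \<partial>N) \<partial>\<mu>"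
  assumes fin: "L < \<infinity>"
  shows "measure N {w \<in> space N. \<forall>i. \<forall>t\<in>S. ereal (V i w + (Z i (t - T i w) w - ln (\<integral>s. exp (Z i (s - T i w) w) \<partial>\<mu>))) \<le> y t}
    = exp (- enn2real L)"
proof -
  interpret N: prob_space N by fact
  interpret \<mu>: prob_space \<mu> by fact
  interpret E: sigma_finite_measure exp_intensity by (rule sigma_finite_exp_intensity)
  note [measurable_cong] = \<mu>(2)
  let ?\<nu> = "\<mu> \<Otimes>\<^sub>M exp_intensity"
  have sets_\<nu>: "sets (borel :: ('t \<times> real) measure) = sets ?\<nu>"
    unfolding borel_prod[symmetric] using \<mu>(2) by (intro sets_pair_measure_cong) (auto simp: sets_exp_intensity)
  obtain F where F: "subalgebra N F" and ZF: "\<And>i. measurable_field F (Z i)"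
    and indF: "indep_elements N (\<Pi>\<^sub>M i\<in>UNIV. borel) (\<lambda>w i. (T i w, V i w)) F (\<lambda>w. w)"
    using ind unfolding indep_of_measurable_fields_def by blast
  have indF': "indep_elements N (\<Pi>\<^sub>M i\<in>UNIV. ?\<nu>) (\<lambda>w i. (T i w, V i w)) F (\<lambda>w. w)"
    by (rule indep_elements_cong_sets[OF _ indF]) (intro sets_PiM_cong sets_\<nu> refl)
  have Zm[measurable]: "Z i t \<in> borel_measurable N" for i t by (rule measurable_field_coordinate[OF Zf])
  define I where "I i \<tau> w = (\<integral>s. exp (Z i (s - \<tau>) w) \<partial>\<mu>)" for i \<tau> w
  define J where "J i \<tau> w = (\<integral>\<^sup>+s. ennreal (exp (Z i (s - \<tau>) w)) \<partial>\<mu>)" for i \<tau> w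
  have shift_field: "measurable_field N (\<lambda>s w. Z i (s - \<tau>) w)" for i \<tau>
    unfolding measurable_field_def case_prod_beta' by (rule measurable_field_eval[OF Zf]) measurable
  have sec: "(\<lambda>s. Z i (s - \<tau>) w) \<in> borel_measurable \<mu>" if "w \<in> space N" for i \<tau> w
    by (rule measurable_field_eval[OF Zf]) (use that in measurable)
  have IJ: "I i \<tau> w = enn2real (J i \<tau> w)" if "w \<in> space N" for i \<tau> w
    unfolding I_def J_def using sec[OF that] by (intro integral_eq_nn_integral) auto
  have Jm[measurable]: "J i \<tau> \<in> borel_measurable N" for i \<tau>
    unfolding J_def[abs_def] by (rule measurable_field_average(1)[OF shift_field \<mu>]) simp
  have Im[measurable]: "I i \<tau> \<in> borel_measurable N" for i \<tau>
  proof -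
    have "(\<lambda>w. enn2real (J i \<tau> w)) \<in> borel_measurable N" by measurable
    then show ?thesis by (rule measurable_cong[THEN iffD1, rotated]) (simp add: IJ)
  qed
  have Jpos: "J i \<tau> w \<noteq> 0" if "w \<in> space N" for i \<tau> w
    using nn_integral_pos_prob[OF \<mu>(1), of "\<lambda>s. ennreal (exp (Z i (s - \<tau>) w))"] sec[OF that] by (simp add: J_def)
  have Jfin: "AE w in N. J 0 \<tau> w \<noteq> \<infinity>" for \<tau>
  proof (rule nn_integral_PInf_AE)
    interpret pair_sigma_finite N \<mu> by unfold_locales
    have [measurable]: "(\<lambda>(w, s). ennreal (exp (Z 0 (s - \<tau>) w))) \<in> borel_measurable (N \<Otimes>\<^sub>M \<mu>)"
      using measurable_field_average(2)[OF shift_field \<mu>, of "\<lambda>r. ennreal (exp r)"] by simp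
    have "(\<integral>\<^sup>+w. J 0 \<tau> w \<partial>N) = (\<integral>\<^sup>+s. (\<integral>\<^sup>+w. ennreal (exp (Z 0 (s - \<tau>) w)) \<partial>N) \<partial>\<mu>)"
      unfolding J_def by (rule Fubini'[symmetric]) measurable
    also have "\<dots> = 1" by (simp add: one \<mu>.emeasure_space_1)
    finally show "(\<integral>\<^sup>+w. J 0 \<tau> w \<partial>N) \<noteq> \<infinity>" by simp
  qed simp
  define \<phi> where "\<phi> \<tau> = average_functional N (\<lambda>s w. Z 0 (s - \<tau>) w) \<mu> (\<lambda>r. ennreal (exp r))" for \<tau>
  have \<phi>m: "\<phi> \<tau> \<in> borel_measurable (\<Pi>\<^sub>M t\<in>UNIV. borel)" for \<tau> by (simp add: \<phi>_def)
  have shift_m: "(\<lambda>x t. x (t - \<tau>)) \<in> measurable (\<Pi>\<^sub>M t\<in>(UNIV::'t set). (borel::real measure)) (\<Pi>\<^sub>M t\<in>UNIV. borel)" for \<tau>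
    by (intro measurable_PiM_single') auto
  have \<phi>_shift[measurable]: "(\<lambda>x. \<phi> \<tau> (\<lambda>t. x (t - \<tau>))) \<in> borel_measurable (\<Pi>\<^sub>M t\<in>UNIV. borel)" for \<tau>
    by (rule measurable_compose[OF shift_m \<phi>m])
  have law: "distr N (\<Pi>\<^sub>M t\<in>UNIV. borel) (\<lambda>w t. Z 0 (t - \<tau>) w) = distr N (\<Pi>\<^sub>M t\<in>UNIV. borel) (\<lambda>w t. Z i (t - \<tau>) w)" for i \<tau>
  proof -
    have Zi: "(\<lambda>w t. Z i t w) \<in> measurable N (\<Pi>\<^sub>M t\<in>UNIV. borel)" for i by (auto intro!: measurable_PiM_single')
    have "distr N (\<Pi>\<^sub>M t\<in>UNIV. borel) (\<lambda>w t. Z i (t - \<tau>) w) =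
      distr (distr N (\<Pi>\<^sub>M t\<in>UNIV. borel) (\<lambda>w t. Z i t w)) (\<Pi>\<^sub>M t\<in>UNIV. borel) (\<lambda>x t. x (t - \<tau>))" for i
      by (subst distr_distr[OF shift_m Zi]) (simp add: comp_def)
    moreover have "distr N (\<Pi>\<^sub>M t\<in>UNIV. borel) (\<lambda>w t. Z 0 t w) = distr N (\<Pi>\<^sub>M t\<in>UNIV. borel) (\<lambda>w t. Z i t w)"
      using iid by (intro law_eq_of_same_fdd N) (auto simp: iid_fields_def)
    ultimately show ?thesis by simp
  qed
  have J\<phi>: "AE w in N. J i \<tau> w = \<phi> \<tau> (\<lambda>t. Z i (t - \<tau>) w)" for i \<tau>
    unfolding J_def \<phi>_def by (rule average_functional[OF N shift_field N shift_field law \<mu>]) simp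
  define U where "U i p w \<longleftrightarrow> (\<forall>t\<in>S. ereal (snd p + (Z i (t - fst p) w - ln (I i (fst p) w))) \<le> y t)" for i and p :: "'t \<times> real" and w
  define B where "B p = {x \<in> space (\<Pi>\<^sub>M t\<in>(UNIV::'t set). (borel::real measure)).
     \<forall>t\<in>S. ereal (snd p + (x (t - fst p) - ln (enn2real (\<phi> (fst p) (\<lambda>t. x (t - fst p)))))) \<le> y t}" for p :: "'t \<times> real"
  have UF: "Measurable.pred (?\<nu> \<Otimes>\<^sub>M F) (\<lambda>(p, w). U i p w)" for i
  proof -
    have Zq: "(\<lambda>q. Z i (t - fst (fst q)) (snd q)) \<in> borel_measurable (?\<nu> \<Otimes>\<^sub>M F)" for t
      by (rule measurable_field_eval[OF ZF]) measurable
    have "(\<lambda>r. Z i (snd r - fst (fst (fst r))) (snd (fst r))) \<in> borel_measurable ((?\<nu> \<Otimes>\<^sub>M F) \<Otimes>\<^sub>M \<mu>)"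
      by (rule measurable_field_eval[OF ZF]) measurable
    then have "(\<lambda>(q, s). exp (Z i (s - fst (fst q)) (snd q))) \<in> borel_measurable ((?\<nu> \<Otimes>\<^sub>M F) \<Otimes>\<^sub>M \<mu>)"
      unfolding case_prod_beta' by (rule borel_measurable_exp[THEN measurable_compose[rotated]])
    then have Iq: "(\<lambda>q. I i (fst (fst q)) (snd q)) \<in> borel_measurable (?\<nu> \<Otimes>\<^sub>M F)"
      unfolding I_def by (rule \<mu>.borel_measurable_lebesgue_integral)
    define h where "h t q = snd (fst q) + (Z i (t - fst (fst q)) (snd q) - ln (I i (fst (fst q)) (snd q)))" for t q
    have vq: "(\<lambda>q. snd (fst q)) \<in> borel_measurable (?\<nu> \<Otimes>\<^sub>M F)" by measurable
    have [measurable]: "h t \<in> borel_measurable (?\<nu> \<Otimes>\<^sub>M F)" for t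
      unfolding h_def[abs_def] by (intro borel_measurable_add borel_measurable_diff borel_measurable_ln vq Zq Iq)
    have "Measurable.pred (?\<nu> \<Otimes>\<^sub>M F) (\<lambda>q. \<forall>t\<in>S. ereal (h t q) \<le> y t)"
      using S by measurable
    then show ?thesis unfolding U_def h_def case_prod_beta' .
  qed
  have lnI: "(\<integral>\<^sup>+w. exceedance S y (\<lambda>t. Z 0 (t - \<tau>) w - ln (I 0 \<tau> w)) \<partial>N) =
    (\<integral>\<^sup>+w. exceedance S y (\<lambda>t. Z 0 (t - \<tau>) w) / J 0 \<tau> w \<partial>N)" for \<tau>
  proof (rule nn_integral_cong_AE)
    show "AE w in N. exceedance S y (\<lambda>t. Z 0 (t - \<tau>) w - ln (I 0 \<tau> w)) = exceedance S y (\<lambda>t. Z 0 (t - \<tau>) w) / J 0 \<tau> w"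
      using Jfin[of \<tau>] AE_space
    proof eventually_elim
      fix w assume J: "J 0 \<tau> w \<noteq> \<infinity>" and w: "w \<in> space N"
      obtain r where r: "J 0 \<tau> w = ennreal r" "0 < r"
        using J Jpos[OF w, of 0 \<tau>] by (cases "J 0 \<tau> w") (auto simp: less_le)
      have "exceedance S y (\<lambda>t. Z 0 (t - \<tau>) w - ln (I 0 \<tau> w)) = ennreal (exp (- ln r)) * exceedance S y (\<lambda>t. Z 0 (t - \<tau>) w)"
        using exceedance_add_const[OF S, of y "\<lambda>t. Z 0 (t - \<tau>) w" "- ln r"] r by (simp add: IJ[OF w])
      also have "exp (- ln r) = inverse r" using r by (simp add: exp_minus)
      also have "ennreal (inverse r) = inverse (ennreal r)" using r by (simp add: inverse_ennreal)
      finally show "exceedance S y (\<lambda>t. Z 0 (t - \<tau>) w - ln (I 0 \<tau> w)) = exceedance S y (\<lambda>t. Z 0 (t - \<tau>) w) / J 0 \<tau> w"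
        by (simp add: r divide_ennreal_def mult.commute)
    qed
  qed
  have sF: "space F = space N" "sets F \<subseteq> sets N" using F by (auto simp: subalgebra_def)
  have UN: "Measurable.pred (?\<nu> \<Otimes>\<^sub>M N) (\<lambda>(p, w). U i p w)" for i
  proof -
    have "(\<lambda>w. w) \<in> measurable N F" using indF by (simp add: indep_elements_def)
    then have "(\<lambda>z. (fst z, snd z)) \<in> measurable (?\<nu> \<Otimes>\<^sub>M N) (?\<nu> \<Otimes>\<^sub>M F)"
      by (intro measurable_Pair measurable_compose[OF measurable_snd]) auto
    from measurable_compose[OF this UF[of i]] show ?thesis by (simp add: case_prod_beta')
  qed
  have void: "(\<integral>\<^sup>+p. emeasure N {w \<in> space N. \<not> U 0 p w} \<partial>?\<nu>) = L"
  proof -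
    define G where "G = {z \<in> space (?\<nu> \<Otimes>\<^sub>M N). \<not> U 0 (fst z) (snd z)}"
    have G: "G \<in> sets (?\<nu> \<Otimes>\<^sub>M N)"
      using UN[of 0] unfolding G_def by (intro sets.sets_Collect_neg) (simp add: pred_def case_prod_beta')
    have Geq: "Pair p -` G = {w \<in> space N. \<not> U 0 p w}" if "p \<in> space ?\<nu>" for p
      using that by (auto simp: G_def space_pair_measure)
    have "(\<integral>\<^sup>+p. emeasure N {w \<in> space N. \<not> U 0 p w} \<partial>?\<nu>) = (\<integral>\<^sup>+p. emeasure N (Pair p -` G) \<partial>?\<nu>)"
      by (intro nn_integral_cong) (simp add: Geq)
    also have "\<dots> = (\<integral>\<^sup>+\<tau>. (\<integral>\<^sup>+v. emeasure N (Pair (\<tau>, v) -` G) \<partial>exp_intensity) \<partial>\<mu>)"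
      by (rule E.nn_integral_fst[symmetric]) (rule N.measurable_emeasure_Pair[OF G])
    also have "\<dots> = (\<integral>\<^sup>+\<tau>. (\<integral>\<^sup>+v. emeasure N {w \<in> space N. \<not> (\<forall>t\<in>S. ereal (v + (Z 0 (t - \<tau>) w - ln (I 0 \<tau> w))) \<le> y t)} \<partial>exp_intensity) \<partial>\<mu>)"
      by (intro nn_integral_cong) (simp add: Geq space_pair_measure U_def)
    also have "\<dots> = (\<integral>\<^sup>+\<tau>. (\<integral>\<^sup>+w. exceedance S y (\<lambda>t. Z 0 (t - \<tau>) w - ln (I 0 \<tau> w)) \<partial>N) \<partial>\<mu>)"
      by (intro nn_integral_cong exceedance_swap[OF N S]) measurable
    also have "\<dots> = L" unfolding lnI L_def J_def ..
    finally show ?thesis .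
  qed
  have "measure N {w \<in> space N. \<forall>i. U i (T i w, V i w) w} = exp (- enn2real (\<integral>\<^sup>+p. emeasure N {w \<in> space N. \<not> U 0 p w} \<partial>?\<nu>))"
  proof (rule poisson_iid_void_probability[OF N P F indF' UF])
    show "measure N {w \<in> space N. \<forall>i<m. U i (x i) w} = (\<Prod>i<m. measure N {w \<in> space N. U 0 (x i) w})" for m x
    proof (rule iid_fields_prob_Ball[OF N iid, where B=B])
      show "B p \<in> sets (\<Pi>\<^sub>M t\<in>UNIV. borel)" for p unfolding B_def using S by measurable
      show "{w \<in> space N. U i p w} \<in> sets N" for i p unfolding U_def using S by measurable
      show "AE w in N. U i p w \<longleftrightarrow> (\<lambda>t. Z i t w) \<in> B p" for i p
        using J\<phi>[of i "fst p"] AE_space by eventually_elim (simp add: U_def B_def space_PiM IJ)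
    qed simp
    show "(\<integral>\<^sup>+p. emeasure N {w \<in> space N. \<not> U 0 p w} \<partial>?\<nu>) < \<infinity>"
      unfolding void by (rule fin)
  qed
  then show ?thesis unfolding void unfolding U_def I_def fst_conv snd_conv .
qed

theorem theorem2p1:
  fixes \<mu> :: "(real ^ 'd) measure"
    and \<sigma>2 \<gamma> :: "real ^ 'd \<Rightarrow> real"
    and M :: "'v measure"
    and W :: "nat \<Rightarrow> real ^ 'd \<Rightarrow> 'v \<Rightarrow> real"
    and V' :: "nat \<Rightarrow> 'v \<Rightarrow> real"
    and N :: "'w measure"
    and Z :: "nat \<Rightarrow> real ^ 'd \<Rightarrow> 'w \<Rightarrow> real"
    and T :: "nat \<Rightarrow> 'w \<Rightarrow> real ^ 'd"
    and V :: "nat \<Rightarrow> 'w \<Rightarrow> real"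
  assumes \<mu>: "prob_space \<mu>" "sets \<mu> = sets borel"
    and M: "prob_space M"
    and W_meas: "\<And>i. measurable_field M (W i)"
    and W_iid: "iid_fields M W"
    and W_gauss: "\<And>i. gaussian_field M (W i)"
    and W_centered: "\<And>i t. mean_fun M (W i) t = 0"
    and W_stat: "\<And>i. stationary_increments M (W i)"
    and W_variance: "\<And>i t. variance_fun M (W i) t = \<sigma>2 t"
    and W_variogram: "\<And>i t. variogram M (W i) t = \<gamma> t"
    and V'_poisson: "poisson_points M exp_intensity V'"
    and V'_indep: "indep_elements M
          (\<Pi>\<^sub>M i\<in>UNIV. borel) (\<lambda>w i. V' i w)
          (\<Pi>\<^sub>M i\<in>UNIV. \<Pi>\<^sub>M t\<in>UNIV. borel) (\<lambda>w i t. W i t w)"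
    and N: "prob_space N"
    and Z_meas: "\<And>i. measurable_field N (Z i)"
    and Z_iid: "iid_fields N Z"
    and Z_gauss: "\<And>i. gaussian_field N (Z i)"
    and Z_origin: "\<And>i. AE w in N. Z i 0 w = 0"
    and Z_mean: "\<And>i t. mean_fun N (Z i) t = - \<gamma> t"
    and Z_variance: "\<And>i t. variance_fun N (Z i) t = 2 * \<gamma> t"
    and Z_stat: "\<And>i. stationary_increments N (\<lambda>t w. Z i t w + \<gamma> t)"
    and Z_variogram: "\<And>i t. variogram N (\<lambda>t w. Z i t w + \<gamma> t) t = \<gamma> t"
    and TV_poisson: "poisson_points N (\<mu> \<Otimes>\<^sub>M exp_intensity) (\<lambda>i w. (T i w, V i w))"
    and TV_indep: "indep_of_measurable_fields N
          (\<Pi>\<^sub>M i\<in>UNIV. borel) (\<lambda>w i. (T i w, V i w)) Z"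
  shows "same_fdd
     M (\<lambda>t w. SUP i. ereal (V' i w + W i t w - \<sigma>2 t / 2))
     N (\<lambda>t w. SUP i. ereal (V i w + Z i (t - T i w) w
            - ln (\<integral>s. exp (Z i (s - T i w) w) \<partial>\<mu>)))"
proof -
  interpret M: prob_space M by fact
  interpret N: prob_space N by fact
  note [measurable_cong] = \<mu>(2)
  have Wm[measurable]: "W i t \<in> borel_measurable M" and Zm: "Z i t \<in> borel_measurable N" for i t
    using measurable_field_coordinate[OF W_meas] measurable_field_coordinate[OF Z_meas] by auto
  define X where "X s w = W 0 s w - \<sigma>2 s / 2" for s w
  have tilt: "prob_space (density M (\<lambda>w. ennreal (exp (X t w))))"
    "same_fdd (density M (\<lambda>w. ennreal (exp (X t w)))) (\<lambda>s w. X s w - X t w) N (\<lambda>s w. Z 0 (s - t) w)" for t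
    unfolding X_def
    using tilted_increments[OF M W_gauss W_centered W_stat W_variance W_variogram N Z_gauss Z_mean Z_variance Z_stat Z_variogram]
    by blast+
  have X1: "(\<integral>\<^sup>+w. ennreal (exp (X t w)) \<partial>M) = 1" for t
    using prob_space.emeasure_space_1[OF tilt(1)[of t]] by (simp add: X_def emeasure_density cong: nn_integral_cong_simp)
  have Z1: "(\<integral>\<^sup>+w. ennreal (exp (Z 0 t w)) \<partial>N) = 1" for t
    using gaussian_rv_mgf[OF N gaussian_field_imp_gaussian_rv[OF Z_gauss], of 0 t] Z_mean[of 0 t] Z_variance[of 0 t]
    by (simp add: mean_fun_def variance_fun_def)
  have Xf: "measurable_field M X"
  proof -
    have [measurable]: "(\<lambda>p. W 0 (snd p) (fst p)) \<in> borel_measurable (M \<Otimes>\<^sub>M borel)"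
      by (rule measurable_field_eval[OF W_meas]) measurable
    have "(\<lambda>p. W 0 (fst p) (snd p)) \<in> borel_measurable (borel \<Otimes>\<^sub>M M)"
      by (rule measurable_field_eval[OF W_meas]) measurable
    then have "(\<lambda>(t, w). (W 0 t w)\<^sup>2) \<in> borel_measurable (borel \<Otimes>\<^sub>M M)"
      unfolding case_prod_beta' by measurable
    then have "(\<lambda>t. \<integral>w. (W 0 t w)\<^sup>2 \<partial>M) \<in> borel_measurable borel"
      by (rule M.borel_measurable_lebesgue_integral)
    moreover have "(\<integral>w. (W 0 t w)\<^sup>2 \<partial>M) = \<sigma>2 t" for t
      using W_variance[of 0 t] W_centered[of 0 t] by (simp add: variance_fun_def)
    ultimately have [measurable]: "\<sigma>2 \<in> borel_measurable borel" by simp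
    show ?thesis unfolding measurable_field_def X_def case_prod_beta' by measurable
  qed
  have Zf: "measurable_field N (\<lambda>s w. Z 0 (s - t) w)" for t
    unfolding measurable_field_def case_prod_beta' by (rule measurable_field_eval[OF Z_meas]) measurable
  have TV: "T i \<in> borel_measurable N" "V i \<in> borel_measurable N" for i
  proof -
    have "(\<lambda>w. (T i w, V i w)) \<in> measurable N (\<mu> \<Otimes>\<^sub>M exp_intensity)"
      using TV_poisson by (simp add: poisson_points_def)
    from measurable_compose[OF this measurable_fst] measurable_compose[OF this measurable_snd]
    have "T i \<in> measurable N \<mu>" "V i \<in> measurable N exp_intensity" by simp_all
    then show "T i \<in> borel_measurable N" "V i \<in> borel_measurable N"
      using measurable_cong_sets[OF refl \<mu>(2), of N] measurable_cong_sets[OF refl sets_exp_intensity, of N] by simp_all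
  qed
  have V'm: "V' i \<in> borel_measurable M" for i
    using V'_poisson sets_exp_intensity unfolding poisson_points_def by (simp cong: measurable_cong_sets)
  show ?thesis
  proof (rule same_fddI_ereal[OF M N])
    show "(\<lambda>w. SUP i. ereal (V' i w + W i t w - \<sigma>2 t / 2)) \<in> borel_measurable M" for t
      using V'm by measurable
    show "(\<lambda>w. SUP i. ereal (V i w + Z i (t - T i w) w - ln (\<integral>s. exp (Z i (s - T i w) w) \<partial>\<mu>))) \<in> borel_measurable N" for t
    proof -
      interpret \<mu>: prob_space \<mu> by fact
      note TV[measurable]
      have [measurable]: "(\<lambda>w. Z i (t - T i w) w) \<in> borel_measurable N" for i
        by (rule measurable_field_eval[OF Z_meas]) measurable
      have "(\<lambda>p. Z i (snd p - T i (fst p)) (fst p)) \<in> borel_measurable (N \<Otimes>\<^sub>M \<mu>)" for i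
        by (rule measurable_field_eval[OF Z_meas]) measurable
      then have "(\<lambda>(w, s). exp (Z i (s - T i w) w)) \<in> borel_measurable (N \<Otimes>\<^sub>M \<mu>)" for i
        unfolding case_prod_beta' by measurable
      then have [measurable]: "(\<lambda>w. \<integral>s. exp (Z i (s - T i w) w) \<partial>\<mu>) \<in> borel_measurable N" for i
        by (rule \<mu>.borel_measurable_lebesgue_integral)
      show ?thesis by measurable
    qed
    fix S :: "(real ^ 'd) set" and y :: "real ^ 'd \<Rightarrow> ereal"
    assume S: "finite S" and y: "\<And>t. t \<in> S \<Longrightarrow> y t \<noteq> -\<infinity>"
    define L where "L = (\<integral>\<^sup>+w. exceedance S y (\<lambda>s. X s w) \<partial>M)"
    have L: "L = (\<integral>\<^sup>+t. (\<integral>\<^sup>+w. exceedance S y (\<lambda>s. Z 0 (s - t) w) / (\<integral>\<^sup>+s. ennreal (exp (Z 0 (s - t) w)) \<partial>\<mu>) \<partial>N) \<partial>\<mu>)"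
      unfolding L_def
      by (rule change_of_measure_at_random_point[OF M Xf N Zf \<mu> _ exceedance_add_const[OF S] tilt])
         (rule measurable_exceedance[OF S], simp)
    have fin: "L < \<infinity>"
    proof -
      obtain K where K: "\<And>t. t \<in> S \<Longrightarrow> K t < \<infinity>" "\<And>x. exceedance S y x \<le> (\<Sum>t\<in>S. ennreal (exp (x t)) * K t)"
        using exceedance_bound[OF S, of y] y by blast
      have "L \<le> (\<integral>\<^sup>+w. (\<Sum>t\<in>S. ennreal (exp (X t w)) * K t) \<partial>M)"
        unfolding L_def by (intro nn_integral_mono K)
      also have "\<dots> = (\<Sum>t\<in>S. K t)"
        by (subst nn_integral_sum) (simp_all add: X_def nn_integral_multc X1[unfolded X_def])
      also have "\<dots> < \<infinity>" using K(1) by (simp add: S)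
      finally show ?thesis .
    qed
    have "measure M {w \<in> space M. \<forall>i. \<forall>t\<in>S. ereal (V' i w + (W i t w - \<sigma>2 t / 2)) \<le> y t} = exp (- enn2real L)"
      using void_probability_spectral_functions[OF M Wm W_iid V'_poisson V'_indep S, of y "\<lambda>t. \<sigma>2 t / 2"] fin
      by (simp add: L_def X_def)
    moreover have "measure N {w \<in> space N. \<forall>i. \<forall>t\<in>S. ereal (V i w + (Z i (t - T i w) w - ln (\<integral>s. exp (Z i (s - T i w) w) \<partial>\<mu>))) \<le> y t} = exp (- enn2real L)"
      unfolding L by (rule void_probability_random_shifts[OF \<mu> N Z_meas Z_iid TV_poisson TV_indep Z1 S fin[unfolded L]])
    moreover have "{w \<in> space M. \<forall>t\<in>S. (SUP i. ereal (V' i w + W i t w - \<sigma>2 t / 2)) \<le> y t} =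
       {w \<in> space M. \<forall>i. \<forall>t\<in>S. ereal (V' i w + (W i t w - \<sigma>2 t / 2)) \<le> y t}"
      by (auto simp: SUP_le_iff add_diff_eq)
    moreover have "{w \<in> space N. \<forall>t\<in>S. (SUP i. ereal (V i w + Z i (t - T i w) w - ln (\<integral>s. exp (Z i (s - T i w) w) \<partial>\<mu>))) \<le> y t} =
       {w \<in> space N. \<forall>i. \<forall>t\<in>S. ereal (V i w + (Z i (t - T i w) w - ln (\<integral>s. exp (Z i (s - T i w) w) \<partial>\<mu>))) \<le> y t}"
      by (auto simp: SUP_le_iff add_diff_eq)
    ultimately show "measure M {w \<in> space M. \<forall>t\<in>S. (SUP i. ereal (V' i w + W i t w - \<sigma>2 t / 2)) \<le> y t} =
      measure N {w \<in> space N. \<forall>t\<in>S. (SUP i. ereal (V i w + Z i (t - T i w) w - ln (\<integral>s. exp (Z i (s - T i w) w) \<partial>\<mu>))) \<le> y t}"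
      by simp
  qed
qed

end
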